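(* Let $a\in\mathbb{K}$ and $R>0$. Let $P\in\mathbb{K}[x]$ be a polynomial of uniqueness for ${\cal M}_u(d(a,R^-))$ such that $$P'(x)=b(x-a_1)^n\prod_{i=2}^l(x-a_i)^{k_i},$$ where $b\in\mathbb{K}^*$, $l\geq 2$, $a_1,\dots,a_l\in\mathbb{K}$ are pairwise distinct, $n,k_2,\dots,k_l$ are positive integers with $k_i\geq k_{i+1}$ for $2\leq i\leq l-1$, and let $k=\sum_{i=2}^l k_i$. Suppose that: (i) $n\geq 10+\sum_{i=3}^{l}\max(0,4-k_i)+\max(0,5-k_2)$; (ii) $n\geq k+3$; (iii) if $l=2$, then $n\neq 2k$, $n\neq 2k+1$, $n\neq 3k+1$; (iv) if $l=3$, then $n\neq 2k+1$ and $n\neq 3k_i-k$ for $i=2,3$. Let $f,g\in{\cal M}_u(d(a,R^-))$ and let $\alpha\in{\cal M}(d(a,R^-))$ be non-identically zero and small with respect to both $f$ and $g$. If $f'P'(f)$ and $g'P'(g)$ share $\alpha$ C.M., then $f=g$.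
   Context: $\mathbb{K}$ is an algebraically closed field of characteristic zero, complete with respect to an ultrametric absolute value $|\cdot|$. $d(a,R^-)=\{x\in\mathbb{K}:|x-a|<R\}$. ${\cal A}(d(a,R^-))$ is the algebra of power series $\sum_{n\ge0}c_n(x-a)^n$ converging in $d(a,R^-)$, ${\cal A}_b(d(a,R^-))$ its subalgebra of those with $\sup_n|c_n|R^n<+\infty$; ${\cal M}(d(a,R^-))$ and ${\cal M}_b(d(a,R^-))$ are their fields of fractions, and ${\cal M}_u(d(a,R^-))={\cal M}(d(a,R^-))\setminus{\cal M}_b(d(a,R^-))$. For $h\in{\cal M}(d(a,R^-))$ and $\gamma$ in the disk, $\omega_\gamma(h)$ is $m$ if $h$ has a zero of order $m$ at $\gamma$, $-m$ if a pole of order $m$, $0$ otherwise. For $h$ with no zero or pole at $a$ and $0<r<R$: $Z(r,h)=\sum_{\omega_\gamma(h)>0,\ |\gamma-a|\leq r}\omega_\gamma(h)(\log r-\log|\gamma-a|)$ (terms with $\gamma=a$ absent), $N(r,h)=Z(r,1/h)$, $T(r,h)=\max\{Z(r,h)+\log|h(a)|,N(r,h)\}$. $\alpha$ is small with respect to $f$ if $\lim_{r\to R^-}T(r,\alpha)/T(r,f)=0$ (if the center is a zero or pole of $f$ or $\alpha$, one first changes the origin to a point of the disk which is neither; the condition does not depend on this choice). Two meromorphic functions $F,G$ share $\alpha$ C.M. if $F-\alpha$ and $G-\alpha$ have the same zeroes with the same multiplicities. A polynomial $P$ is a polynomial of uniqueness for a class ${\cal F}$ if for all $f,g\in{\cal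 F}$, $P(f)=P(g)$ implies $f=g$. *)

theory Defs
  imports
    "HOL-Analysis.Analysis"
    "HOL-Computational_Algebra.Computational_Algebra"
    "HOL-Library.Extended_Nat"
begin

text \<open>
  A field with an ultrametric absolute value \<open>abv\<close> and its induced metric. The library's
  \<^const>\<open>norm\<close> is reserved for real normed vector spaces, hence Archimedean.
  Completeness, algebraic closedness and characteristic zero are the library classes
  \<^class>\<open>complete_space\<close>, \<^class>\<open>alg_closed_field\<close> and
  \<^class>\<open>field_char_0\<close>. Nonnegativity and definiteness of \<open>abv\<close> follow from
  the metric axioms.
\<close>

class ultrametric_field = field + metric_space +
  fixes abv :: "'a \<Rightarrow> real"
  assumes dist_abv: "dist x y = abv (x - y)"
    and abv_mult: "abv (x * y) = abv x * abv y"
    and abv_add_le: "abv (x + y) \<le> max (abv x) (abv y)"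

text \<open>
  The open disk of centre \<open>c\<close> and radius \<open>R\<close> is \<open>ball c R\<close>. A formal power
  series \<open>F\<close> stands for the expansion with coefficients \<open>fps_nth F n\<close> in powers of
  \<open>x - c\<close>.
\<close>

definition fps_val :: "'a::ultrametric_field \<Rightarrow> 'a fps \<Rightarrow> 'a \<Rightarrow> 'a" where
  "fps_val c F x = (\<Sum>n. fps_nth F n * (x - c) ^ n)"

definition disk_analytic :: "'a::ultrametric_field \<Rightarrow> real \<Rightarrow> 'a fps set" where
  "disk_analytic c R = {F. \<forall>x\<in>ball c R. summable (\<lambda>n. fps_nth F n * (x - c) ^ n)}"

definition disk_analytic_bounded :: "'a::ultrametric_field \<Rightarrow> real \<Rightarrow> 'a fps set" where
  "disk_analytic_bounded c R =
     {F \<in> disk_analytic c R. bdd_above (range (\<lambda>n. abv (fps_nth F n) * R ^ n))}"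

text \<open>
  The fields of fractions are realised inside the field of formal Laurent series in
  \<open>x - c\<close>, which contains every power series ring above as a subring.
\<close>

definition fraction_field_of :: "'a::field fps set \<Rightarrow> 'a fls set" where
  "fraction_field_of A = {fps_to_fls F / fps_to_fls G | F G. F \<in> A \<and> G \<in> A \<and> G \<noteq> 0}"

definition disk_mero :: "'a::ultrametric_field \<Rightarrow> real \<Rightarrow> 'a fls set" where
  "disk_mero c R = fraction_field_of (disk_analytic c R)"

definition disk_mero_bounded :: "'a::ultrametric_field \<Rightarrow> real \<Rightarrow> 'a fls set" where
  "disk_mero_bounded c R = fraction_field_of (disk_analytic_bounded c R)"

definition disk_mero_unbounded :: "'a::ultrametric_field \<Rightarrow> real \<Rightarrow> 'a fls set" where
  "disk_mero_unbounded c R = disk_mero c R - disk_mero_bounded c R"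

definition fls_poly :: "'a::field poly \<Rightarrow> 'a fls \<Rightarrow> 'a fls" where
  "fls_poly P f = poly (map_poly fls_const P) f"

definition uniqueness_poly :: "'a::field poly \<Rightarrow> 'a fls set \<Rightarrow> bool" where
  "uniqueness_poly P \<F> \<longleftrightarrow> (\<forall>f\<in>\<F>. \<forall>g\<in>\<F>. fls_poly P f = fls_poly P g \<longrightarrow> f = g)"

text \<open>
  The value at \<open>x\<close> in the disk of a meromorphic function without pole at \<open>x\<close>.
\<close>

definition mero_val :: "'a::ultrametric_field \<Rightarrow> real \<Rightarrow> 'a fls \<Rightarrow> 'a \<Rightarrow> 'a" where
  "mero_val c R h x = (THE v. \<exists>F\<in>disk_analytic c R. \<exists>G\<in>disk_analytic c R.
     fps_val c G x \<noteq> 0 \<and> h = fps_to_fls F / fps_to_fls G \<and> v = fps_val c F x / fps_val c G x)"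

text \<open>
  For nonzero \<open>h\<close>, the integer \<open>m\<close> such that \<open>h = (x - \<gamma>)\<^sup>m F / G\<close> with
  \<open>F\<close> and \<open>G\<close> analytic in the disk and nonvanishing at \<open>\<gamma>\<close>; note that
  \<open>x - \<gamma> = (x - c) - (\<gamma> - c)\<close>.
\<close>

definition mero_order :: "'a::ultrametric_field \<Rightarrow> real \<Rightarrow> 'a fls \<Rightarrow> 'a \<Rightarrow> int" where
  "mero_order c R h \<gamma> = (THE m. \<exists>F\<in>disk_analytic c R. \<exists>G\<in>disk_analytic c R.
     fps_val c F \<gamma> \<noteq> 0 \<and> fps_val c G \<gamma> \<noteq> 0 \<and>
     h = (fls_X - fls_const (\<gamma> - c)) powi m * (fps_to_fls F / fps_to_fls G))"

text \<open>
  The counting functions are taken with respect to an origin \<open>z\<close> in the disk, which may differ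
  from the expansion point \<open>c\<close>. For nonzero \<open>h\<close> and \<open>r < R\<close> the index set of the sum
  is finite.
\<close>

definition Z_fun :: "'a::ultrametric_field \<Rightarrow> real \<Rightarrow> 'a \<Rightarrow> real \<Rightarrow> 'a fls \<Rightarrow> real" where
  "Z_fun c R z r h =
     (\<Sum>\<gamma> | \<gamma> \<in> ball c R \<and> mero_order c R h \<gamma> > 0 \<and> abv (\<gamma> - z) \<le> r.
        of_int (mero_order c R h \<gamma>) * (ln r - ln (abv (\<gamma> - z))))"

definition N_fun :: "'a::ultrametric_field \<Rightarrow> real \<Rightarrow> 'a \<Rightarrow> real \<Rightarrow> 'a fls \<Rightarrow> real" where
  "N_fun c R z r h = Z_fun c R z r (1 / h)"

definition T_fun :: "'a::ultrametric_field \<Rightarrow> real \<Rightarrow> 'a \<Rightarrow> real \<Rightarrow> 'a fls \<Rightarrow> real" where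
  "T_fun c R z r h = max (Z_fun c R z r h + ln (abv (mero_val c R h z))) (N_fun c R z r h)"

text \<open>
  The origin \<open>z\<close> must be neither a zero nor a pole of \<open>f\<close> or \<open>\<alpha>\<close>. The
  condition does not depend on its choice; in particular \<open>z = c\<close> may be taken when \<open>c\<close>
  is admissible.
\<close>

definition small_wrt ::
  "'a::ultrametric_field \<Rightarrow> real \<Rightarrow> 'a fls \<Rightarrow> 'a fls \<Rightarrow> bool" where
  "small_wrt c R \<alpha> f \<longleftrightarrow>
     (\<exists>z\<in>ball c R. mero_order c R f z = 0 \<and> mero_order c R \<alpha> z = 0 \<and>
        ((\<lambda>r. T_fun c R z r \<alpha> / T_fun c R z r f) \<longlongrightarrow> 0) (at_left R))"

text \<open>
  The identically zero function has a zero of infinite multiplicity at every point.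
\<close>

definition zero_mult ::
  "'a::ultrametric_field \<Rightarrow> real \<Rightarrow> 'a fls \<Rightarrow> 'a \<Rightarrow> enat" where
  "zero_mult c R h \<gamma> = (if h = 0 then \<infinity> else enat (nat (mero_order c R h \<gamma>)))"

definition share_CM ::
  "'a::ultrametric_field \<Rightarrow> real \<Rightarrow> 'a fls \<Rightarrow> 'a fls \<Rightarrow> 'a fls \<Rightarrow> bool" where
  "share_CM c R \<alpha> F G \<longleftrightarrow> (\<forall>\<gamma>\<in>ball c R. zero_mult c R (F - \<alpha>) \<gamma> = zero_mult c R (G - \<alpha>) \<gamma>)"

end

theory Submission
  imports Defs
begin

text \<open>
  The Gauss norm of a meromorphic function is piecewise monomial in the radius, and its slopes count
  zeros minus poles (Jensen). This gives a Nevanlinna theory on the disk in which every error term is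
  bounded, while the characteristic function of an element of \<open>\<M>\<^sub>u\<close> is unbounded: a divisor with
  bounded counting function is dominated by the divisor of a bounded analytic function.

  Put \<open>F = f' P'(f) / \<alpha>\<close>, \<open>G = g' P'(g) / \<alpha>\<close> and \<open>w = (1 / (F - 1))' / (1 / (G - 1))'\<close>. If
  \<open>w\<close> is not constant, then \<open>w' / w\<close> has only simple poles and vanishes at the common simple zeros of
  \<open>F - 1\<close> and \<open>G - 1\<close>. Together with the second main theorem for \<open>0, 1, \<infinity>\<close> this bounds the
  characteristic functions of \<open>F\<close> and \<open>G\<close> by their zeros and poles truncated at multiplicity \<open>2\<close>,
  which is impossible because \<open>deg P' \<ge> 4 l + 7\<close>. If \<open>w\<close> is constant, then \<open>F\<close> is a Moebius
  transform of \<open>G\<close>, and the second main theorem only leaves \<open>F G = 1\<close> and \<open>F = G\<close>. In the first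
  case zeros of \<open>f - a\<^sub>i\<close> are poles of \<open>g\<close> and their multiplicities are too large. In the second case
  \<open>P(f) = P(g) + C\<close>. If \<open>C \<noteq> 0\<close>, then \<open>P - P(a\<^sub>1) + C\<close> has at least \<open>n + 1\<close> distinct roots, whereas
  \<open>P - P(a\<^sub>1)\<close> has at most \<open>k + 1\<close>, which contradicts the second main theorem for \<open>g\<close> at these
  \<open>n + 1\<close> values.
\<close>

section \<open>Ultrametric absolute values\<close>

text \<open>Error terms stay bounded because integers have absolute value at most 1: differentiation
  divides a Gauss norm by at least the radius, so no exceptional radii and no logarithmic terms
  appear. Every argument thus ends in \<open>T r f\<close> being at most a multiple of
  \<open>T r \<alpha>\<close> plus a constant. To exclude this, functions of bounded characteristic
  must be shown to be quotients of bounded analytic functions, which is the only place where an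
  infinite product is built. Division by \<alpha> damages the sharing only at zeros and poles of
  \<alpha>, and these are counted by \<open>2 * T r \<alpha>\<close>. The degree bound comes from
  using the sharing inequality in both directions: together they cost twice the zeros and poles
  truncated at 2. In the case \<open>F G = 1\<close> the second main theorem at all l values
  \<open>a\<^sub>i\<close> is opposed by weights, each 2 divided by a lower bound for the
  multiplicity that the equation of orders allows; for l = 2 the excluded values of n keep these
  bounds large enough.\<close>

lemma abv_zero [simp]: "abv (0::'a::ultrametric_field) = 0"
  by (metis cancel_comm_monoid_add_class.diff_cancel dist_abv dist_self)

lemma abv_nonneg [simp]: "0 \<le> abv (x::'a::ultrametric_field)"
  by (metis diff_zero dist_abv zero_le_dist)

lemma abv_eq_0_iff [simp]: "abv (x::'a::ultrametric_field) = 0 \<longleftrightarrow> x = 0"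
  by (metis diff_zero dist_abv dist_eq_0_iff)

lemma abv_pos_iff [simp]: "0 < abv (x::'a::ultrametric_field) \<longleftrightarrow> x \<noteq> 0"
  using abv_nonneg[of x] abv_eq_0_iff[of x] by (metis less_eq_real_def less_irrefl)

lemma abv_one [simp]: "abv (1::'a::ultrametric_field) = 1"
  using abv_mult[of "1::'a" 1] by simp

lemma abv_minus [simp]: "abv (- x) = abv (x::'a::ultrametric_field)"
  by (metis diff_0 diff_zero dist_abv dist_commute)

lemma abv_power: "abv (x ^ n) = abv (x::'a::ultrametric_field) ^ n"
  by (induction n) (simp_all add: abv_mult)

lemma abv_divide: "abv (x / y) = abv x / abv (y::'a::ultrametric_field)"
  by (metis abv_eq_0_iff abv_mult divide_eq_0_iff nonzero_eq_divide_eq)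

lemma abv_inverse: "abv (inverse y) = inverse (abv (y::'a::ultrametric_field))"
  using abv_divide[of 1 y] by (simp add: divide_inverse)

lemma abv_diff_le: "abv (x - y) \<le> max (abv x) (abv (y::'a::ultrametric_field))"
  using abv_add_le[of x "- y"] by simp

lemma abv_minus_commute: "abv (x - y) = abv (y - (x::'a::ultrametric_field))"
  using abv_minus[of "x - y"] by simp

lemma abv_add_eq:
  assumes "abv x < abv (y::'a::ultrametric_field)"
  shows "abv (x + y) = abv y"
  using abv_add_le[of x y] abv_diff_le[of "x + y" x] assms by (auto simp: max_def split: if_splits)

lemma abv_diff_eq:
  assumes "abv x < abv (y::'a::ultrametric_field)"
  shows "abv (y - x) = abv y"
  using abv_add_eq[of "- x" y] assms by simp

lemma abv_of_nat_le: "abv (of_nat n :: 'a::ultrametric_field) \<le> 1"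
proof (induction n)
  case (Suc n)
  then show ?case using abv_add_le[of 1 "of_nat n :: 'a"] by simp
qed simp

lemma abv_sum_le:
  fixes f :: "'b \<Rightarrow> 'a::ultrametric_field"
  assumes "\<And>i. i \<in> I \<Longrightarrow> abv (f i) \<le> B" "0 \<le> B"
  shows "abv (sum f I) \<le> B"
  using assms
proof (induction I rule: infinite_finite_induct)
  case (insert x F)
  then have "abv (f x) \<le> B" "abv (sum f F) \<le> B" by auto
  then show ?case using abv_add_le[of "f x" "sum f F"] insert.hyps by simp
qed auto

lemma abv_sum_less:
  fixes f :: "'b \<Rightarrow> 'a::ultrametric_field"
  assumes "finite I" "\<And>i. i \<in> I \<Longrightarrow> abv (f i) < B" "0 < B"
  shows "abv (sum f I) < B"
  using assms
proof (induction I rule: finite_induct)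
  case (insert x F)
  then have "abv (f x) < B" "abv (sum f F) < B" by auto
  then show ?case using abv_add_le[of "f x" "sum f F"] insert.hyps by simp
qed auto

lemma abv_LIMSEQ_0_iff: "(X :: nat \<Rightarrow> 'a::ultrametric_field) \<longlonglongrightarrow> L \<longleftrightarrow> (\<lambda>n. abv (X n - L)) \<longlonglongrightarrow> 0"
  by (subst tendsto_dist_iff) (simp add: dist_abv)

text \<open>The strong triangle inequality bounds a difference over any number of steps by the
  largest single step, so vanishing steps suffice where real sequences would need a summable
  bound.\<close>

lemma ultra_Cauchy:
  fixes X :: "nat \<Rightarrow> 'a::ultrametric_field"
  assumes "(\<lambda>n. abv (X (Suc n) - X n)) \<longlonglongrightarrow> 0"
  shows "Cauchy X"
proof (rule metric_CauchyI)
  fix e :: real assume e: "0 < e"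
  then obtain M where M: "\<And>n. n \<ge> M \<Longrightarrow> abv (X (Suc n) - X n) < e"
    using LIMSEQ_D[OF assms e] by auto
  have *: "abv (X (m + j) - X m) < e" if "m \<ge> M" for m j
  proof (induction j)
    case (Suc j)
    have "X (m + Suc j) - X m = (X (Suc (m + j)) - X (m + j)) + (X (m + j) - X m)" by simp
    also have "abv \<dots> < e"
      using abv_add_le[of "X (Suc (m + j)) - X (m + j)" "X (m + j) - X m"] Suc M[of "m + j"] that
      by (simp add: max_def split: if_splits)
    finally show ?case .
  qed (use e in simp)
  have "dist (X m) (X n) < e" if "m \<ge> M" "n \<ge> M" for m n
  proof (cases "m \<le> n")
    case True
    then show ?thesis using *[of m "n - m"] that by (simp add: dist_abv abv_minus_commute)
  next
    case False
    then show ?thesis using *[of n "m - n"] that by (simp add: dist_abv)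
  qed
  then show "\<exists>M. \<forall>m\<ge>M. \<forall>n\<ge>M. dist (X m) (X n) < e" by blast
qed

lemma ultra_summable:
  fixes f :: "nat \<Rightarrow> 'a::{ultrametric_field, complete_space}"
  assumes "(\<lambda>n. abv (f n)) \<longlonglongrightarrow> 0"
  shows "summable f"
proof -
  have "Cauchy (\<lambda>n. \<Sum>i<n. f i)"
    by (rule ultra_Cauchy) (use assms in simp)
  then show ?thesis
    using Cauchy_convergent summable_iff_convergent by blast
qed

lemma summable_abv_tendsto_0:
  fixes f :: "nat \<Rightarrow> 'a::ultrametric_field"
  assumes "summable f"
  shows "(\<lambda>n. abv (f n)) \<longlonglongrightarrow> 0"
proof -
  let ?s = "\<lambda>n. \<Sum>i<n. f i"
  obtain L where L: "?s \<longlonglongrightarrow> L"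
    using assms summable_iff_convergent convergent_def by blast
  then have "(\<lambda>n. ?s (Suc n)) \<longlonglongrightarrow> L" by (subst filterlim_sequentially_Suc)
  then have "(\<lambda>n. max (abv (?s (Suc n) - L)) (abv (?s n - L))) \<longlonglongrightarrow> max 0 0"
    using L by (intro tendsto_max) (subst (asm) abv_LIMSEQ_0_iff, assumption)+
  moreover have "abv (f n) \<le> max (abv (?s (Suc n) - L)) (abv (?s n - L))" for n
    using abv_diff_le[of "?s (Suc n) - L" "?s n - L"] by simp
  ultimately show ?thesis
    by (intro Lim_null_comparison[of "\<lambda>n. abv (f n)"]) (simp_all del: sum.lessThan_Suc)
qed

text \<open>The partial-sum computation behind synthetic division of a series by \<open>X - d\<close>.\<close>

lemma ultra_suminf_Suc:
  fixes f :: "nat \<Rightarrow> 'a::{ultrametric_field, complete_space}"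
  assumes g: "(\<lambda>n. abv (g n)) \<longlonglongrightarrow> 0" and f: "\<And>n. f (Suc n) = d * g n"
  shows "suminf f = f 0 + d * suminf g"
proof -
  have "(\<lambda>n. \<Sum>i<n. g i) \<longlonglongrightarrow> suminf g"
    using ultra_summable[OF g] summable_LIMSEQ by blast
  then have "(\<lambda>n. abv d * abv ((\<Sum>i<n. g i) - suminf g)) \<longlonglongrightarrow> 0"
    by (intro tendsto_mult_right_zero) (simp add: abv_LIMSEQ_0_iff)
  moreover have "(\<Sum>i<Suc n. f i) - (f 0 + d * suminf g) = d * ((\<Sum>i<n. g i) - suminf g)" for n
    by (subst sum.lessThan_Suc_shift) (simp add: f sum_distrib_left algebra_simps)
  ultimately have "(\<lambda>n. \<Sum>i<Suc n. f i) \<longlonglongrightarrow> f 0 + d * suminf g"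
    by (subst abv_LIMSEQ_0_iff) (simp add: abv_mult del: sum.lessThan_Suc)
  then have "f sums (f 0 + d * suminf g)"
    unfolding sums_def by (subst (asm) filterlim_sequentially_Suc)
  then show ?thesis by (simp add: sums_iff)
qed

section \<open>Gauss norms\<close>

text \<open>The greatest index at which the Gauss norm of radius \<open>r\<close> is attained. It is the number of
  zeros in the closed disk of radius \<open>r\<close>, see \<open>zeros_factorization\<close>.\<close>

definition gauss_dom :: "real \<Rightarrow> 'a::ultrametric_field fps \<Rightarrow> nat \<Rightarrow> bool" where
  "gauss_dom r F i \<longleftrightarrow> fps_nth F i \<noteq> 0 \<and>
     (\<forall>n. abv (fps_nth F n) * r ^ n \<le> abv (fps_nth F i) * r ^ i) \<and>
     (\<forall>n>i. abv (fps_nth F n) * r ^ n < abv (fps_nth F i) * r ^ i)"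

definition gauss :: "real \<Rightarrow> 'a::ultrametric_field fps \<Rightarrow> real" where
  "gauss r F = (SUP n. abv (fps_nth F n) * r ^ n)"

lemma gauss_dom_eq: "gauss_dom r F i \<Longrightarrow> gauss r F = abv (fps_nth F i) * r ^ i"
  unfolding gauss_dom_def gauss_def by (intro cSup_eq_maximum) auto

lemma gauss_dom_unique: "gauss_dom r F i \<Longrightarrow> gauss_dom r F j \<Longrightarrow> i = j"
  unfolding gauss_dom_def by (metis linorder_neqE_nat not_le)

lemma gauss_dom_pos: "gauss_dom r F i \<Longrightarrow> r > 0 \<Longrightarrow> gauss r F > 0"
  by (simp add: gauss_dom_eq) (simp add: gauss_dom_def)

lemma gauss_zero [simp]: "gauss r 0 = 0"
  by (simp add: gauss_def)

text \<open>Gauss's lemma. In the convolution at index \<open>i + j\<close> every other pair of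
  indices has one entry beyond a greatest maximal index, hence a strictly smaller term, so the term
  of \<open>i\<close> and \<open>j\<close> cannot be cancelled.\<close>

lemma
  assumes i: "gauss_dom r F i" and j: "gauss_dom r G j" and r: "r > 0"
  shows gauss_dom_mult: "gauss_dom r (F * G) (i + j)"
    and gauss_mult_dom: "gauss r (F * G) = gauss r F * gauss r G"
proof -
  define A where "A = abv (fps_nth F i) * r ^ i"
  define B where "B = abv (fps_nth G j) * r ^ j"
  have AB: "A > 0" "B > 0" using i j r by (auto simp: A_def B_def gauss_dom_def)
  define a where "a m = abv (fps_nth F m) * r ^ m" for m
  define b where "b m = abv (fps_nth G m) * r ^ m" for m
  have nn: "a m \<ge> 0" "b m \<ge> 0" for m using r by (auto simp: a_def b_def)
  have a: "a m \<le> A" "m > i \<Longrightarrow> a m < A" for m using i by (auto simp: a_def A_def gauss_dom_def)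
  have b: "b m \<le> B" "m > j \<Longrightarrow> b m < B" for m using j by (auto simp: b_def B_def gauss_dom_def)
  have tm: "abv (fps_nth F m * fps_nth G (n - m)) = a m * b (n - m) / r ^ n" if "m \<le> n" for m n
    using r that by (simp add: a_def b_def abv_mult field_simps flip: power_add)
  have lt: "a m * b k < A * B" if "m > i \<or> k > j" for m k
  proof (cases "m > i")
    case True
    then have "a m * b k \<le> a m * B" using b nn by (intro mult_left_mono) auto
    also have "\<dots> < A * B" using a(2)[OF True] AB by simp
    finally show ?thesis .
  next
    case False
    then have "a m * b k \<le> A * b k" using a nn by (intro mult_right_mono) auto
    also have "\<dots> < A * B" using b(2)[of k] that False AB by simp
    finally show ?thesis .
  qed
  have main: "abv (fps_nth (F * G) (i + j)) = A * B / r ^ (i + j)"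
  proof -
    let ?t = "\<lambda>m. fps_nth F m * fps_nth G (i + j - m)"
    have "fps_nth (F * G) (i + j) = (\<Sum>m\<in>{0..i + j} - {i}. ?t m) + ?t i"
      by (simp add: fps_mult_nth sum.remove[of "{0..i + j}" i] add.commute)
    moreover have "abv (?t i) = A * B / r ^ (i + j)"
      by (subst tm) (auto simp: A_def B_def a_def b_def)
    moreover have "abv (\<Sum>m\<in>{0..i + j} - {i}. ?t m) < A * B / r ^ (i + j)"
    proof (rule abv_sum_less)
      fix m assume m: "m \<in> {0..i + j} - {i}"
      then have "m > i \<or> i + j - m > j" by auto
      then show "abv (?t m) < A * B / r ^ (i + j)"
        using m r by (subst tm) (auto intro!: divide_strict_right_mono lt)
    qed (use AB r in auto)
    ultimately show ?thesis using abv_add_eq by metis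
  qed
  then have ne: "fps_nth (F * G) (i + j) \<noteq> 0"
    using AB r by (metis abv_zero divide_pos_pos mult_pos_pos order_less_irrefl zero_less_power)
  have eq: "abv (fps_nth (F * G) (i + j)) * r ^ (i + j) = A * B"
    using main r by simp
  have "abv (fps_nth (F * G) n) * r ^ n \<le> A * B" for n
  proof -
    have "abv (fps_nth (F * G) n) \<le> A * B / r ^ n"
      unfolding fps_mult_nth
    proof (rule abv_sum_le)
      fix m assume "m \<in> {0..n}"
      then show "abv (fps_nth F m * fps_nth G (n - m)) \<le> A * B / r ^ n"
        using r AB nn a(1) b(1) by (subst tm) (auto intro!: divide_right_mono mult_mono)
    qed (use AB r in auto)
    then show ?thesis using r by (simp add: field_simps)
  qed
  moreover have "abv (fps_nth (F * G) n) * r ^ n < A * B" if "n > i + j" for n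
  proof -
    have "abv (fps_nth (F * G) n) < A * B / r ^ n"
      unfolding fps_mult_nth
    proof (rule abv_sum_less)
      fix m assume m: "m \<in> {0..n}"
      then have "m > i \<or> n - m > j" using that by auto
      then show "abv (fps_nth F m * fps_nth G (n - m)) < A * B / r ^ n"
        using m r by (subst tm) (auto intro!: divide_strict_right_mono lt)
    qed (use AB r in auto)
    then show ?thesis using r by (simp add: field_simps)
  qed
  ultimately show dom: "gauss_dom r (F * G) (i + j)"
    unfolding gauss_dom_def using ne eq by simp
  show "gauss r (F * G) = gauss r F * gauss r G"
    using gauss_dom_eq[OF dom] gauss_dom_eq[OF i] gauss_dom_eq[OF j] eq by (simp add: A_def B_def)
qed

lemma gauss_dom_const: "x \<noteq> 0 \<Longrightarrow> r > 0 \<Longrightarrow> gauss_dom r (fps_const x) 0"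
  by (auto simp: gauss_dom_def)

text \<open>For \<open>abv d = r\<close> both coefficients attain the norm; the greatest index wins,
  so a zero on the boundary circle is counted.\<close>

lemma gauss_dom_lin:
  fixes d :: "'a::ultrametric_field"
  assumes "r > 0"
  shows "gauss_dom r (fps_X - fps_const d) (if abv d \<le> r then 1 else 0)"
proof -
  have "abv (fps_nth (fps_X - fps_const d) n) * r ^ n = (if n = 0 then abv d else if n = 1 then r else 0)" for n
    by (auto simp: fps_X_def)
  then show ?thesis using assms by (auto simp: gauss_dom_def fps_X_def)
qed

lemma gauss_lin: "r > 0 \<Longrightarrow> gauss r (fps_X - fps_const (d::'a::ultrametric_field)) = max r (abv d)"
  using gauss_dom_eq[OF gauss_dom_lin[of r d]] by (auto simp: fps_X_def split: if_splits)

lemma ex_gauss_dom: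
  fixes F :: "'a::ultrametric_field fps"
  assumes F: "F \<noteq> 0" and r: "r > 0" and lim: "(\<lambda>n. abv (fps_nth F n) * r ^ n) \<longlonglongrightarrow> 0"
  shows "\<exists>i. gauss_dom r F i"
proof -
  let ?a = "\<lambda>n. abv (fps_nth F n) * r ^ n"
  obtain k where k: "fps_nth F k \<noteq> 0" using F by (auto simp: fps_eq_iff)
  then have "?a k > 0" using r by simp
  \<comment> \<open>Beyond \<open>N\<close> no term reaches the nonzero term at \<open>k\<close>, so
    the supremum is a maximum over finitely many indices.\<close>
  then obtain N where N: "\<And>n. n \<ge> N \<Longrightarrow> ?a n < ?a k"
    using order_tendstoD(2)[OF lim] by (auto simp: eventually_sequentially)
  have kN: "k < N" using N[of k] by (meson less_irrefl not_less)
  define S where "S = {n. n < N \<and> ?a n = Max (?a ` {..<N})}"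
  have "Max (?a ` {..<N}) \<in> ?a ` {..<N}" using kN by (intro Max_in) auto
  then have S: "finite S" "S \<noteq> {}" by (auto simp: S_def)
  have "Max S \<in> S" using S by (rule Max_in)
  then have i: "Max S < N" "?a (Max S) = Max (?a ` {..<N})" by (auto simp: S_def)
  have le: "?a n \<le> ?a (Max S)" if "n < N" for n using that by (simp add: i)
  have lt: "?a n < ?a (Max S)" if "n \<ge> N" for n using N[OF that] le[OF kN] by linarith
  have "?a n < ?a (Max S)" if "n > Max S" for n
  proof (cases "n < N")
    case True
    have "n \<notin> S" using that S Max_ge not_less by blast
    then have "?a n \<noteq> ?a (Max S)" using True i(2) by (metis (mono_tags, lifting) S_def mem_Collect_eq)
    then show ?thesis using le[OF True] by linarith
  qed (simp add: lt)
  moreover have "?a n \<le> ?a (Max S)" for n using le[of n] lt[of n] by (meson less_imp_le not_less)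
  moreover have "fps_nth F (Max S) \<noteq> 0"
  proof
    assume "fps_nth F (Max S) = 0"
    then show False using le[OF kN] \<open>?a k > 0\<close> by simp
  qed
  ultimately show ?thesis unfolding gauss_dom_def by blast
qed

section \<open>Analytic functions on the disk\<close>

text \<open>If the limit were larger than the bound, a late partial sum would differ from it by less
  than its size and so have exactly the same absolute value.\<close>

lemma abv_suminf_le:
  fixes f :: "nat \<Rightarrow> 'a::ultrametric_field"
  assumes "summable f" "\<And>n. abv (f n) \<le> B"
  shows "abv (suminf f) \<le> B"
proof (rule ccontr)
  assume "\<not> ?thesis"
  moreover have B: "0 \<le> B" using assms(2)[of 0] abv_nonneg order_trans by blast
  ultimately have pos: "abv (suminf f) > 0" and gt: "abv (suminf f) > B" by linarith+
  have "(\<lambda>n. abv ((\<Sum>i<n. f i) - suminf f)) \<longlonglongrightarrow> 0"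
    using summable_LIMSEQ[OF assms(1)] by (subst (asm) abv_LIMSEQ_0_iff)
  from order_tendstoD(2)[OF this pos] obtain n where n: "abv ((\<Sum>i<n. f i) - suminf f) < abv (suminf f)"
    by (auto simp: eventually_sequentially)
  have "abv (\<Sum>i<n. f i) = abv (suminf f)"
    using abv_add_eq[OF n] by simp
  moreover have "abv (\<Sum>i<n. f i) \<le> B" by (rule abv_sum_le) (use assms B in auto)
  ultimately show False using gt by simp
qed

text \<open>The centre is translated to 0. \<open>\<rho>\<close> is the radius from which zeros and
  poles are counted; it is fixed at the end, large enough to enclose the origins occurring in the
  two smallness conditions.\<close>

locale disc =
  fixes R \<rho> :: real
  assumes rho_pos: "0 < \<rho>" and rho_less: "\<rho> < R"
begin

lemma R_pos: "0 < R" using rho_pos rho_less by simp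

text \<open>Convergence on the open disk, expressed by the growth of the coefficients so that no
  points of prescribed absolute value are needed. For a nontrivial absolute value it agrees with
  convergence at every point, see \<open>disk_analytic_eq\<close>.\<close>

definition anal :: "'a::ultrametric_field fps set" where
  "anal = {F. \<forall>r. 0 < r \<longrightarrow> r < R \<longrightarrow> bdd_above (range (\<lambda>n. abv (fps_nth F n) * r ^ n))}"

lemma analI:
  assumes "\<And>r. 0 < r \<Longrightarrow> r < R \<Longrightarrow> \<exists>B. \<forall>n. abv (fps_nth F n) * r ^ n \<le> B"
  shows "F \<in> anal"
  using assms unfolding anal_def bdd_above_def by fastforce

lemma anal_bound:
  assumes "F \<in> anal" "0 < r" "r < R"
  obtains B where "0 \<le> B" "\<And>n. abv (fps_nth F n) * r ^ n \<le> B"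
proof -
  obtain B where B: "\<And>n. abv (fps_nth F n) * r ^ n \<le> B"
    using assms by (fastforce simp: anal_def bdd_above_def)
  have "0 \<le> abv (fps_nth F 0) * r ^ 0" by simp
  then have "0 \<le> B" using B[of 0] by linarith
  with B show ?thesis using that by blast
qed

lemma anal_tendsto_0:
  assumes F: "F \<in> anal" and r: "0 \<le> r" "r < R"
  shows "(\<lambda>n. abv (fps_nth F n) * r ^ n) \<longlonglongrightarrow> 0"
proof -
  define s where "s = (r + R) / 2"
  have s: "0 < s" "s < R" "r < s" using r R_pos by (auto simp: s_def)
  obtain B where B: "0 \<le> B" "\<And>n. abv (fps_nth F n) * s ^ n \<le> B" using anal_bound[OF F s(1,2)] by blast
  have lim: "(\<lambda>n. B * (r / s) ^ n) \<longlonglongrightarrow> 0"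
    using r s by (intro tendsto_mult_right_zero LIMSEQ_realpow_zero) auto
  have le: "norm (abv (fps_nth F n) * r ^ n) \<le> B * (r / s) ^ n" for n
  proof -
    have "abv (fps_nth F n) * r ^ n = (abv (fps_nth F n) * s ^ n) * (r / s) ^ n"
      using s by (simp add: power_divide)
    also have "\<dots> \<le> B * (r / s) ^ n" using B s r by (intro mult_right_mono) auto
    finally show ?thesis using r by (simp add: abs_mult)
  qed
  show ?thesis by (rule Lim_null_comparison[OF always_eventually[OF allI[OF le]] lim])
qed

lemma ex_dom: "F \<in> anal \<Longrightarrow> F \<noteq> 0 \<Longrightarrow> 0 < r \<Longrightarrow> r < R \<Longrightarrow> \<exists>i. gauss_dom r F i"
  by (intro ex_gauss_dom anal_tendsto_0) auto

lemma anal_const [simp]: "fps_const x \<in> anal"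
proof (rule analI)
  fix r :: real assume "0 < r" "r < R"
  have "abv (fps_nth (fps_const x) n) * r ^ n \<le> abv x" for n by (cases n) auto
  then show "\<exists>B. \<forall>n. abv (fps_nth (fps_const x) n) * r ^ n \<le> B" by blast
qed

lemma anal_X [simp]: "fps_X \<in> anal"
proof (rule analI)
  fix r :: real assume r: "0 < r" "r < R"
  have "abv (fps_nth (fps_X :: 'a fps) n) * r ^ n \<le> r" for n using r by (auto simp: fps_X_def)
  then show "\<exists>B. \<forall>n. abv (fps_nth (fps_X :: 'a fps) n) * r ^ n \<le> B" by blast
qed

lemma anal_0 [simp]: "0 \<in> anal" and anal_1 [simp]: "1 \<in> anal"
  using anal_const[of 0] anal_const[of 1] by simp_all

lemma anal_add:
  assumes "F \<in> anal" "G \<in> anal"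
  shows "F + G \<in> anal"
proof (rule analI)
  fix r :: real assume r: "0 < r" "r < R"
  obtain A where A: "0 \<le> A" "\<And>n. abv (fps_nth F n) * r ^ n \<le> A" using anal_bound[OF assms(1) r] by blast
  obtain B where B: "0 \<le> B" "\<And>n. abv (fps_nth G n) * r ^ n \<le> B" using anal_bound[OF assms(2) r] by blast
  have "abv (fps_nth (F + G) n) * r ^ n \<le> max A B" for n
  proof -
    have "abv (fps_nth (F + G) n) * r ^ n \<le> max (abv (fps_nth F n)) (abv (fps_nth G n)) * r ^ n"
      using r abv_add_le by (intro mult_right_mono) auto
    also have "\<dots> \<le> max A B" using A(2)[of n] B(2)[of n] by (auto simp: max_def)
    finally show ?thesis .
  qed
  then show "\<exists>B. \<forall>n. abv (fps_nth (F + G) n) * r ^ n \<le> B" by blast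
qed

lemma anal_mult:
  assumes "F \<in> anal" "G \<in> anal"
  shows "F * G \<in> anal"
proof (rule analI)
  fix r :: real assume r: "0 < r" "r < R"
  obtain A where A: "0 \<le> A" "\<And>n. abv (fps_nth F n) * r ^ n \<le> A" using anal_bound[OF assms(1) r] by blast
  obtain B where B: "0 \<le> B" "\<And>n. abv (fps_nth G n) * r ^ n \<le> B" using anal_bound[OF assms(2) r] by blast
  have "abv (fps_nth (F * G) n) \<le> A * B / r ^ n" for n
    unfolding fps_mult_nth
  proof (rule abv_sum_le)
    fix i assume i: "i \<in> {0..n}"
    have "abv (fps_nth F i * fps_nth G (n - i)) * r ^ n
        = (abv (fps_nth F i) * r ^ i) * (abv (fps_nth G (n - i)) * r ^ (n - i))"
      using i by (simp add: abv_mult mult_ac flip: power_add)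
    also have "\<dots> \<le> A * B" using A B r by (intro mult_mono) auto
    finally show "abv (fps_nth F i * fps_nth G (n - i)) \<le> A * B / r ^ n"
      using r by (simp add: field_simps)
  qed (use A B r in auto)
  then have "abv (fps_nth (F * G) n) * r ^ n \<le> A * B" for n
    using r by (simp add: field_simps)
  then show "\<exists>B. \<forall>n. abv (fps_nth (F * G) n) * r ^ n \<le> B" by blast
qed

lemma anal_uminus: "F \<in> anal \<Longrightarrow> - F \<in> anal"
  by (simp add: anal_def)

lemma anal_diff: "F \<in> anal \<Longrightarrow> G \<in> anal \<Longrightarrow> F - G \<in> anal"
  using anal_add[of F "- G"] anal_uminus[of G] by simp

lemma anal_power: "F \<in> anal \<Longrightarrow> F ^ n \<in> anal"
  by (induction n) (auto intro: anal_mult)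

lemma anal_lin [simp]: "fps_X - fps_const d \<in> anal"
  by (intro anal_diff) auto

lemma anal_deriv:
  assumes "F \<in> anal"
  shows "fps_deriv F \<in> anal"
proof (rule analI)
  fix r :: real assume r: "0 < r" "r < R"
  obtain B where B: "0 \<le> B" "\<And>n. abv (fps_nth F n) * r ^ n \<le> B" using anal_bound[OF assms r] by blast
  have "abv (fps_nth (fps_deriv F) n) * r ^ n \<le> B / r" for n
  proof -
    have "abv (fps_nth (fps_deriv F) n) * r ^ n \<le> abv (fps_nth F (n + 1)) * r ^ n"
      using abv_of_nat_le[of "n + 1"] r
      by (auto simp: abv_mult simp del: of_nat_Suc of_nat_add intro!: mult_right_mono mult_left_le_one_le)
    also have "\<dots> = abv (fps_nth F (n + 1)) * r ^ (n + 1) / r" using r by simp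
    also have "\<dots> \<le> B / r" using B(2)[of "n + 1"] r by (intro divide_right_mono) simp_all
    finally show ?thesis .
  qed
  then show "\<exists>B. \<forall>n. abv (fps_nth (fps_deriv F) n) * r ^ n \<le> B" by blast
qed

lemma gauss_ge:
  assumes "F \<in> anal" "0 < r" "r < R"
  shows "abv (fps_nth F n) * r ^ n \<le> gauss r F"
  unfolding gauss_def using assms by (intro cSUP_upper) (auto simp: anal_def)

lemma gauss_least: "(\<And>n. abv (fps_nth F n) * r ^ n \<le> B) \<Longrightarrow> gauss r F \<le> B"
  unfolding gauss_def by (intro cSUP_least) auto

lemma gauss_nonneg: "F \<in> anal \<Longrightarrow> 0 < r \<Longrightarrow> r < R \<Longrightarrow> 0 \<le> gauss r F"
  using gauss_ge[of F r 0] order_trans[OF abv_nonneg[of "fps_nth F 0"]] by simp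

lemma gauss_pos: "F \<in> anal \<Longrightarrow> F \<noteq> 0 \<Longrightarrow> 0 < r \<Longrightarrow> r < R \<Longrightarrow> 0 < gauss r F"
  using ex_dom gauss_dom_pos by blast

lemma gauss_mult:
  assumes "F \<in> anal" "G \<in> anal" "0 < r" "r < R"
  shows "gauss r (F * G) = gauss r F * gauss r G"
proof (cases "F = 0 \<or> G = 0")
  case False
  then obtain i j where ij: "gauss_dom r F i" "gauss_dom r G j" using ex_dom assms by meson
  show ?thesis using gauss_mult_dom[OF ij assms(3)] .
qed auto

lemma gauss_add_le:
  assumes "F \<in> anal" "G \<in> anal" "0 < r" "r < R"
  shows "gauss r (F + G) \<le> max (gauss r F) (gauss r G)"
proof (rule gauss_least)
  fix n
  have "abv (fps_nth (F + G) n) * r ^ n \<le> max (abv (fps_nth F n)) (abv (fps_nth G n)) * r ^ n"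
    using assms abv_add_le by (intro mult_right_mono) auto
  also have "\<dots> \<le> max (gauss r F) (gauss r G)"
    using gauss_ge[OF assms(1,3,4), of n] gauss_ge[OF assms(2-4), of n] by (auto simp: max_def)
  finally show "abv (fps_nth (F + G) n) * r ^ n \<le> max (gauss r F) (gauss r G)" .
qed

text \<open>The integer factor \<open>n + 1\<close> has absolute value at most 1. This inequality
  replaces the lemma on the logarithmic derivative and has no error term.\<close>

lemma gauss_deriv_le:
  assumes "F \<in> anal" "0 < r" "r < R"
  shows "gauss r (fps_deriv F) \<le> gauss r F / r"
proof (rule gauss_least)
  fix n
  have "abv (fps_nth (fps_deriv F) n) * r ^ n \<le> abv (fps_nth F (n + 1)) * r ^ n"
    using abv_of_nat_le[of "n + 1"] assms
    by (auto simp: abv_mult simp del: of_nat_Suc of_nat_add intro!: mult_right_mono mult_left_le_one_le)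
  also have "\<dots> = abv (fps_nth F (n + 1)) * r ^ (n + 1) / r" using assms by simp
  also have "\<dots> \<le> gauss r F / r" using gauss_ge[OF assms, of "n + 1"] assms by (intro divide_right_mono) simp_all
  finally show "abv (fps_nth (fps_deriv F) n) * r ^ n \<le> gauss r F / r" .
qed

section \<open>Evaluation and division by linear factors\<close>

definition ev :: "'a::ultrametric_field \<Rightarrow> 'a fps \<Rightarrow> 'a" where
  "ev d F = (\<Sum>n. fps_nth F n * d ^ n)"

text \<open>The quotient \<open>(F - F(d)) / (X - d)\<close>. Its coefficients are tails of the
  value series divided by powers of \<open>d\<close>, written so as to make sense for
  \<open>d = 0\<close>.\<close>

definition quo :: "'a::ultrametric_field \<Rightarrow> 'a fps \<Rightarrow> 'a fps" where
  "quo d F = Abs_fps (\<lambda>n. \<Sum>j. fps_nth F (j + n + 1) * d ^ j)"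

lemma anal_shift_tendsto_0:
  assumes "F \<in> anal" "abv d < R"
  shows "(\<lambda>j. abv (fps_nth F (j + m) * d ^ j)) \<longlonglongrightarrow> 0"
proof -
  define s where "s = (abv d + R) / 2"
  have s: "0 < s" "s < R" "abv d \<le> s" using assms R_pos by (auto simp: s_def add_nonneg_pos)
  have "(\<lambda>j. abv (fps_nth F (j + m)) * s ^ (j + m)) \<longlonglongrightarrow> 0"
    using anal_tendsto_0[OF assms(1), of s] s LIMSEQ_ignore_initial_segment by force
  then have lim: "(\<lambda>j. (abv (fps_nth F (j + m)) * s ^ (j + m)) / s ^ m) \<longlonglongrightarrow> 0"
    by (rule tendsto_divide_zero)
  have le: "norm (abv (fps_nth F (j + m) * d ^ j)) \<le> (abv (fps_nth F (j + m)) * s ^ (j + m)) / s ^ m" for j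
    using s by (auto simp: abv_mult abv_power power_add intro!: mult_left_mono power_mono)
  show ?thesis by (rule Lim_null_comparison[OF always_eventually[OF allI[OF le]] lim])
qed

lemma anal_quo:
  fixes d :: "'a::{ultrametric_field, complete_space}"
  assumes F: "F \<in> anal" and d: "abv d < R"
  shows "quo d F \<in> anal"
proof (rule analI)
  fix r :: real assume r: "0 < r" "r < R"
  define s where "s = max r (abv d)"
  have s: "0 < s" "s < R" "abv d \<le> s" "r \<le> s" using r d by (auto simp: s_def)
  obtain B where B: "0 \<le> B" "\<And>n. abv (fps_nth F n) * s ^ n \<le> B" using anal_bound[OF F s(1,2)] by blast
  have "abv (fps_nth (quo d F) n) * r ^ n \<le> B / s" for n
  proof -
    have "abv (\<Sum>j. fps_nth F (j + n + 1) * d ^ j) \<le> B / s ^ (n + 1)"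
    proof (rule abv_suminf_le)
      show "summable (\<lambda>j. fps_nth F (j + n + 1) * d ^ j)"
        using anal_shift_tendsto_0[OF F d, of "n + 1"] by (intro ultra_summable) (simp add: add.assoc)
      fix j
      have "abv (fps_nth F (j + n + 1) * d ^ j) * s ^ (n + 1) \<le> abv (fps_nth F (j + n + 1)) * s ^ j * s ^ (n + 1)"
        using s by (intro mult_right_mono) (auto simp: abv_mult abv_power intro!: mult_left_mono power_mono)
      also have "\<dots> = abv (fps_nth F (j + n + 1)) * s ^ (j + n + 1)"
        by (simp add: power_add)
      also have "\<dots> \<le> B" by (rule B)
      finally show "abv (fps_nth F (j + n + 1) * d ^ j) \<le> B / s ^ (n + 1)"
        using s by (simp add: field_simps)
    qed
    then have "abv (fps_nth (quo d F) n) * r ^ n \<le> B / s ^ (n + 1) * s ^ n"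
      using s r B by (intro mult_mono power_mono) (auto simp: quo_def)
    also have "\<dots> = B / s" using s by simp
    finally show ?thesis .
  qed
  then show "\<exists>B. \<forall>n. abv (fps_nth (quo d F) n) * r ^ n \<le> B" by blast
qed

lemma ev_quo:
  fixes d :: "'a::{ultrametric_field, complete_space}"
  assumes F: "F \<in> anal" and d: "abv d < R"
  shows "F = fps_const (ev d F) + (fps_X - fps_const d) * quo d F"
proof (rule fps_ext)
  fix n
  define S where "S m = (\<Sum>j. fps_nth F (j + m) * d ^ j)" for m
  have S: "S m = fps_nth F m + d * S (Suc m)" for m
    unfolding S_def
    using anal_shift_tendsto_0[OF F d, of "Suc m"]
    by (subst ultra_suminf_Suc[where g = "\<lambda>j. fps_nth F (j + Suc m) * d ^ j"]) auto
  have q: "fps_nth (quo d F) n = S (Suc n)" for n by (simp add: quo_def S_def)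
  have e: "ev d F = S 0" by (simp add: ev_def S_def)
  show "fps_nth F n = fps_nth (fps_const (ev d F) + (fps_X - fps_const d) * quo d F) n"
  proof (cases n)
    case 0
    then show ?thesis using S[of 0] by (simp add: q e)
  next
    case (Suc m)
    have "fps_nth ((fps_X - fps_const d) * quo d F) n = fps_nth (quo d F) m - d * fps_nth (quo d F) n"
      by (simp add: left_diff_distrib Suc)
    then show ?thesis using S[of n] Suc by (simp add: q)
  qed
qed

text \<open>At a radius of at least \<open>abv d\<close> the factor \<open>X - d\<close> has
  dominant index 1 and indices add up, whereas a nonzero constant has index 0.\<close>

lemma lin_mult_const:
  assumes H: "H \<in> anal" and d: "abv d < R" and eq: "fps_const e = (fps_X - fps_const d) * H"
  shows "e = 0"
proof (rule ccontr)
  assume e: "e \<noteq> 0"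
  define r where "r = (abv d + R) / 2"
  have r: "0 < r" "r < R" "abv d \<le> r" using d R_pos by (auto simp: r_def add_nonneg_pos)
  have "H \<noteq> 0" using eq e by (metis fps_const_eq_0_iff mult_zero_right)
  then obtain j where j: "gauss_dom r H j" using ex_dom H r by blast
  have "gauss_dom r ((fps_X - fps_const d) * H) (1 + j)"
    using gauss_dom_mult[OF gauss_dom_lin[of r d] j] r by simp
  moreover have "gauss_dom r (fps_const e) 0" using e r(1) by (rule gauss_dom_const)
  ultimately show False using gauss_dom_unique[of r "fps_const e" 0 "1 + j"] unfolding eq by simp
qed

text \<open>The value at \<open>d\<close> is identified as the remainder of division by
  \<open>X - d\<close>. Compatibility of \<open>ev\<close> with sums and products then follows from
  ring identities, without multiplying convergent series.\<close>

lemma ev_eqI: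
  fixes d :: "'a::{ultrametric_field, complete_space}"
  assumes "H \<in> anal" "abv d < R" "F = fps_const e + (fps_X - fps_const d) * H"
  shows "ev d F = e"
proof -
  have F: "F \<in> anal" unfolding assms(3) using assms(1) by (intro anal_add anal_mult) auto
  have *: "x - z = w - y" if "x + y = z + w" for x y z w :: "'a fps"
    using that by (simp add: algebra_simps)
  have "fps_const (ev d F - e) = (fps_X - fps_const d) * (H - quo d F)"
  proof -
    have "fps_const (ev d F) + (fps_X - fps_const d) * quo d F = fps_const e + (fps_X - fps_const d) * H"
      using trans[OF ev_quo[OF F assms(2), symmetric] assms(3)] .
    then have "fps_const (ev d F) - fps_const e = (fps_X - fps_const d) * H - (fps_X - fps_const d) * quo d F"
      by (rule *)
    then show ?thesis by (simp add: right_diff_distrib)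
  qed
  from lin_mult_const[OF anal_diff[OF assms(1) anal_quo[OF F assms(2)]] assms(2) this]
  show ?thesis by simp
qed

context
  fixes d :: "'a::{ultrametric_field, complete_space}"
  assumes d: "abv d < R"
begin

lemma ev_const [simp]: "ev d (fps_const e) = e"
  using ev_eqI[of 0 d "fps_const e" e] d by simp

lemma ev_lin_mult: "H \<in> anal \<Longrightarrow> ev d ((fps_X - fps_const d) * H) = 0"
  using ev_eqI[of H d _ 0] d by simp

lemma ev_add:
  assumes "F \<in> anal" "G \<in> anal"
  shows "ev d (F + G) = ev d F + ev d G"
proof (rule ev_eqI[OF _ d])
  let ?L = "fps_X - fps_const d"
  show "quo d F + quo d G \<in> anal" using assms d by (intro anal_add anal_quo)
  have "F + G = (fps_const (ev d F) + ?L * quo d F) + (fps_const (ev d G) + ?L * quo d G)"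
    by (rule arg_cong2[where f = "(+)", OF ev_quo[OF assms(1) d] ev_quo[OF assms(2) d]])
  also have "\<dots> = fps_const (ev d F + ev d G) + ?L * (quo d F + quo d G)"
    by (simp add: algebra_simps flip: fps_const_add)
  finally show "F + G = fps_const (ev d F + ev d G) + ?L * (quo d F + quo d G)" .
qed

lemma ev_mult:
  assumes "F \<in> anal" "G \<in> anal"
  shows "ev d (F * G) = ev d F * ev d G"
proof (rule ev_eqI[OF _ d])
  let ?L = "fps_X - fps_const d"
  let ?H = "fps_const (ev d F) * quo d G + fps_const (ev d G) * quo d F + ?L * quo d F * quo d G"
  show "?H \<in> anal" using assms d by (intro anal_add anal_mult anal_quo) auto
  have "F * G = (fps_const (ev d F) + ?L * quo d F) * (fps_const (ev d G) + ?L * quo d G)"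
    by (rule arg_cong2[where f = "(*)", OF ev_quo[OF assms(1) d] ev_quo[OF assms(2) d]])
  also have "\<dots> = fps_const (ev d F * ev d G) + ?L * ?H"
    by (simp add: algebra_simps flip: fps_const_mult)
  finally show "F * G = fps_const (ev d F * ev d G) + ?L * ?H" .
qed

lemma ev_power: "F \<in> anal \<Longrightarrow> ev d (F ^ n) = ev d F ^ n"
  using ev_const[of 1] by (induction n) (auto simp: ev_mult anal_power)

text \<open>Every division by \<open>X - d\<close> lowers the dominant index at a radius enclosing
  \<open>d\<close> by one, so the multiplicity is finite.\<close>

lemma anal_factor_at:
  assumes F: "F \<in> anal" "F \<noteq> 0"
  shows "\<exists>m G. G \<in> anal \<and> ev d G \<noteq> 0 \<and> F = (fps_X - fps_const d) ^ m * G"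
proof -
  define r where "r = (abv d + R) / 2"
  have r: "0 < r" "r < R" "abv d \<le> r" using d R_pos by (auto simp: r_def add_nonneg_pos)
  obtain i where "gauss_dom r F i" using ex_dom F r by blast
  then show ?thesis using F
  proof (induction i arbitrary: F rule: less_induct)
    case (less i)
    show ?case
    proof (cases "ev d F = 0")
      case True
      then have eq: "F = (fps_X - fps_const d) * quo d F" using ev_quo[OF less.prems(2) d] by simp
      have q: "quo d F \<in> anal" "quo d F \<noteq> 0" using anal_quo[OF less.prems(2) d] eq less.prems by auto
      then obtain j where j: "gauss_dom r (quo d F) j" using ex_dom r by blast
      have "gauss_dom r ((fps_X - fps_const d) * quo d F) (1 + j)"
        using gauss_dom_mult[OF gauss_dom_lin[of r d] j] r by simp
      then have "i = 1 + j" using gauss_dom_unique less.prems(1) eq by metis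
      then obtain m G where "G \<in> anal" "ev d G \<noteq> 0" "quo d F = (fps_X - fps_const d) ^ m * G"
        using less.IH[OF _ j q] by auto
      then show ?thesis using eq by (intro exI[of _ "Suc m"] exI[of _ G]) (simp add: mult.assoc)
    next
      case False
      then show ?thesis using less.prems by (intro exI[of _ 0] exI[of _ F]) auto
    qed
  qed
qed

end

end

section \<open>Zeros\<close>

lemma fps_of_poly_lin: "fps_of_poly [:- x, 1:] = fps_X - fps_const (x :: 'a :: field)"
  by (simp add: fps_of_poly_pCons)

lemma gauss_dom_linear_factors:
  assumes "r > 0"
  shows "gauss_dom r (\<Prod>x\<in>#A. fps_X - fps_const (x :: 'a::ultrametric_field))
           (size (filter_mset (\<lambda>x. abv x \<le> r) A)) \<and>
         gauss r (\<Prod>x\<in>#A. fps_X - fps_const x) = (\<Prod>x\<in>#A. max r (abv x))"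
proof (induction A)
  case empty
  have "gauss_dom r (1 :: 'a fps) 0" using gauss_dom_const[of "1::'a" r] assms by simp
  then show ?case using gauss_dom_eq by fastforce
next
  case (add x A)
  let ?P = "\<Prod>x\<in>#A. fps_X - fps_const x" and ?k = "size (filter_mset (\<lambda>x. abv x \<le> r) A)"
  have "gauss_dom r ((fps_X - fps_const x) * ?P) ((if abv x \<le> r then 1 else 0) + ?k)"
    using gauss_dom_mult[OF gauss_dom_lin[of r x]] add.IH assms by blast
  moreover have "gauss r ((fps_X - fps_const x) * ?P) = max r (abv x) * gauss r ?P"
    using gauss_mult_dom[OF gauss_dom_lin[of r x]] add.IH assms gauss_lin[of r x] by auto
  ultimately show ?case using add.IH by (cases "abv x \<le> r") auto
qed

text \<open>A root \<open>x\<close> outside the radius has \<open>abv (y - x) = abv x\<close>,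
  without loss; each root inside shrinks the product, relative to its Gauss norm, by a factor
  \<open>\<delta> / r\<close> at worst.\<close>

lemma linear_factors_lower_bound:
  fixes y :: "'a::ultrametric_field"
  assumes r: "r > 0" and y: "abv y \<le> r" and \<delta>: "0 \<le> \<delta>" "\<And>x. x \<in># A \<Longrightarrow> abv x \<le> r \<Longrightarrow> \<delta> \<le> abv (y - x)"
  shows "(\<delta> / r) ^ size (filter_mset (\<lambda>x. abv x \<le> r) A) * (\<Prod>x\<in>#A. max r (abv x)) \<le> (\<Prod>x\<in>#A. abv (y - x))"
  using \<delta>(2)
proof (induction A)
  case (add x A)
  let ?k = "size (filter_mset (\<lambda>x. abv x \<le> r) A)" and ?M = "\<Prod>x\<in>#A. max r (abv x)"
  have IH: "(\<delta> / r) ^ ?k * ?M \<le> (\<Prod>x\<in>#A. abv (y - x))" using add by simp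
  have "0 \<le> ?M" using r by (induction A) (auto simp: max_def)
  then have nn: "0 \<le> (\<delta> / r) ^ ?k * ?M" using r \<delta> by simp
  show ?case
  proof (cases "abv x \<le> r")
    case True
    have "\<delta> * ((\<delta> / r) ^ ?k * ?M) \<le> abv (y - x) * (\<Prod>x\<in>#A. abv (y - x))"
      using add.prems[of x] True IH nn \<delta> by (intro mult_mono) auto
    then show ?thesis using True r by (simp add: max_def mult_ac)
  next
    case False
    then have "abv (y - x) = abv x" using y abv_diff_eq[of y x] by (simp add: abv_minus_commute)
    then show ?thesis using False IH mult_left_mono[OF IH, of "abv x"] by (simp add: max_def mult_ac)
  qed
qed simp

lemma prod_mset_map_abv: "abv (\<Prod>x\<in>#A. f x :: 'a::ultrametric_field) = (\<Prod>x\<in>#A. abv (f x))"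
  by (induction A) (auto simp: abv_mult)

text \<open>A small value at \<open>y\<close> forces a root close to \<open>y\<close>: the root
  nearest to \<open>y\<close> within the radius supplies the distance \<open>\<delta>\<close> of the
  previous bound.\<close>

lemma poly_near_root:
  fixes p :: "'a::{ultrametric_field, alg_closed_field} poly"
  assumes dom: "gauss_dom r (fps_of_poly p) k" and k: "k > 0" and r: "r > 0" and y: "abv y \<le> r"
  shows "\<exists>x. poly p x = 0 \<and> abv x \<le> r \<and> (abv (y - x) / r) ^ k * gauss r (fps_of_poly p) \<le> abv (poly p y)"
proof -
  have p0: "p \<noteq> 0" using dom by (auto simp: gauss_dom_def)
  obtain A where A: "p = smult (lead_coeff p) (\<Prod>x\<in>#A. [:-x, 1:])"
    using alg_closed_imp_factorization[OF p0] by auto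
  define c where "c = lead_coeff p"
  have c: "c \<noteq> 0" using p0 by (simp add: c_def)
  let ?P = "\<Prod>x\<in>#A. fps_X - fps_const x" and ?B = "filter_mset (\<lambda>x. abv x \<le> r) A"
  have eq: "p = smult c (\<Prod>x\<in>#A. [:-x, 1:])" using A by (simp add: c_def)
  have fp: "fps_of_poly (\<Prod>x\<in>#A. [:-x, 1:]) = ?P"
    by (induction A) (simp_all del: mult_pCons_left add: fps_of_poly_mult fps_of_poly_lin)
  have Fp: "fps_of_poly p = fps_const c * ?P"
    by (subst eq) (simp add: fps_of_poly_smult fp)
  have dP: "gauss_dom r ?P (size ?B)" "gauss r ?P = (\<Prod>x\<in>#A. max r (abv x))"
    using gauss_dom_linear_factors[OF r, of A] by auto
  have dc: "gauss_dom r (fps_const c) 0" using gauss_dom_const[OF c r] .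
  have kB: "k = size ?B"
    using gauss_dom_unique[OF dom] gauss_dom_mult[OF dc dP(1) r] Fp by simp
  have g: "gauss r (fps_of_poly p) = abv c * (\<Prod>x\<in>#A. max r (abv x))"
    using gauss_mult_dom[OF dc dP(1) r] Fp gauss_dom_eq[OF dc] dP(2) by simp
  have pev: "poly p z = c * (\<Prod>x\<in>#A. z - x)" for z
  proof -
    have "poly (\<Prod>x\<in>#A. [:-x, 1:]) z = (\<Prod>x\<in>#A. z - x)"
      by (induction A) (auto simp: left_diff_distrib)
    then show ?thesis by (subst eq) simp
  qed
  have "?B \<noteq> {#}" using kB k by (metis size_empty less_irrefl)
  then have ne: "set_mset ?B \<noteq> {}" by (simp only: set_mset_eq_empty_iff not_False_eq_True)
  define x where "x = arg_min_on (\<lambda>x. abv (y - x)) (set_mset ?B)"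
  have xB: "x \<in> set_mset ?B" and xmin: "\<And>z. z \<in> set_mset ?B \<Longrightarrow> abv (y - x) \<le> abv (y - z)"
    using arg_min_if_finite[OF _ ne, of "\<lambda>x. abv (y - x)"] by (force simp: x_def not_less)+
  have "(abv (y - x) / r) ^ size ?B * (\<Prod>x\<in>#A. max r (abv x)) \<le> (\<Prod>x\<in>#A. abv (y - x))"
    by (rule linear_factors_lower_bound[OF r y]) (use xmin in auto)
  then have "abv c * ((abv (y - x) / r) ^ k * (\<Prod>x\<in>#A. max r (abv x))) \<le> abv c * (\<Prod>x\<in>#A. abv (y - x))"
    by (intro mult_left_mono) (auto simp: kB)
  then have "(abv (y - x) / r) ^ k * gauss r (fps_of_poly p) \<le> abv (poly p y)"
    by (simp add: g pev abv_mult prod_mset_map_abv mult_ac)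
  moreover have "poly p x = 0"
  proof -
    have "x \<in># A" using xB by simp
    then show ?thesis unfolding pev by (auto simp: prod_mset_zero_iff image_iff)
  qed
  ultimately show ?thesis using xB by auto
qed

text \<open>A Lipschitz bound for powers. The factor \<open>r\<close> stands on the left to avoid
  the exponent \<open>n - 1\<close>.\<close>

lemma abv_power_diff_le:
  fixes x y :: "'a::ultrametric_field"
  assumes "abv x \<le> r" "abv y \<le> r"
  shows "r * abv (x ^ n - y ^ n) \<le> abv (x - y) * r ^ n"
proof (induction n)
  case (Suc n)
  have r: "0 \<le> r" using assms(1) abv_nonneg order_trans by blast
  have "x ^ Suc n - y ^ Suc n = x * (x ^ n - y ^ n) + (x - y) * y ^ n" by (simp add: algebra_simps)
  then have "abv (x ^ Suc n - y ^ Suc n) \<le> max (abv x * abv (x ^ n - y ^ n)) (abv (x - y) * abv y ^ n)"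
    by (metis abv_add_le abv_mult abv_power)
  then have "r * abv (x ^ Suc n - y ^ Suc n) \<le> r * max (abv x * abv (x ^ n - y ^ n)) (abv (x - y) * abv y ^ n)"
    using r by (rule mult_left_mono)
  also have "\<dots> \<le> abv (x - y) * r ^ Suc n"
  proof -
    have "r * (abv x * abv (x ^ n - y ^ n)) \<le> r * (abv (x - y) * r ^ n)"
      using Suc assms mult_mono[OF assms(1) Suc] r by (simp add: mult_ac)
    moreover have "r * (abv (x - y) * abv y ^ n) \<le> r * (abv (x - y) * r ^ n)"
      using assms r by (intro mult_left_mono power_mono) auto
    ultimately show ?thesis by (simp add: max_def mult_ac)
  qed
  finally show ?case .
qed (use abv_nonneg in simp)

lemma abv_lim_le:
  fixes X :: "nat \<Rightarrow> 'a::ultrametric_field"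
  assumes "X \<longlonglongrightarrow> L" "\<And>n. abv (X n) \<le> B"
  shows "abv L \<le> B"
proof (rule ccontr)
  assume n: "\<not> ?thesis"
  moreover have B: "0 \<le> B" using assms(2)[of 0] abv_nonneg order_trans by blast
  ultimately have pos: "abv L > 0" by linarith
  have "(\<lambda>n. abv (X n - L)) \<longlonglongrightarrow> 0" using assms(1) by (subst (asm) abv_LIMSEQ_0_iff)
  from order_tendstoD(2)[OF this pos] obtain n where "abv (X n - L) < abv L"
    by (auto simp: eventually_sequentially)
  from abv_add_eq[OF this] have "abv (X n) = abv L" by simp
  then show False using assms(2)[of n] n by simp
qed

context disc
begin

text \<open>Truncations of \<open>F\<close> that retain the coefficient at \<open>k\<close> share
  its dominant index. Each chosen root of a truncation is close to the previous one, because at the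
  previous root the next truncation reduces to its top term. These terms tend to 0, so the roots
  converge, and the limit is a zero of \<open>F\<close>.\<close>

lemma ex_zero:
  fixes F :: "'a::{ultrametric_field, complete_space, alg_closed_field} fps"
  assumes F: "F \<in> anal" and r: "0 < r" "r < R" and dom: "gauss_dom r F k" and k: "k > 0"
  shows "\<exists>d. abv d \<le> r \<and> ev d F = 0"
proof -
  define p where "p N = (\<Sum>n<N. monom (fps_nth F n) n)" for N
  have cp: "coeff (p N) n = (if n < N then fps_nth F n else 0)" for N n
    by (simp add: p_def coeff_sum)
  have pp: "poly (p N) x = (\<Sum>n<N. fps_nth F n * x ^ n)" for N x
    by (simp add: p_def poly_sum poly_monom)
  have pS: "poly (p (Suc N)) x = poly (p N) x + fps_nth F N * x ^ N" for N x
    by (simp add: pp)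
  define M where "M = gauss r F"
  have M: "M > 0" "M = abv (fps_nth F k) * r ^ k" using gauss_dom_pos[OF dom r(1)] gauss_dom_eq[OF dom] by (auto simp: M_def)
  have dp: "gauss_dom r (fps_of_poly (p N)) k" if "N > k" for N
    using dom that r M unfolding gauss_dom_def by (auto simp: cp)
  have gp: "gauss r (fps_of_poly (p N)) = M" if "N > k" for N
    using gauss_dom_eq[OF dp[OF that]] that M by (simp add: cp)
  let ?N = "\<lambda>m. Suc k + m"
  have "\<exists>Y. \<forall>m. (poly (p (?N m)) (Y m) = 0 \<and> abv (Y m) \<le> r) \<and>
      (abv (Y m - Y (Suc m)) / r) ^ k * M \<le> abv (fps_nth F (?N m)) * r ^ (?N m)"
  proof (rule dependent_nat_choice)
    show "\<exists>x. poly (p (?N 0)) x = 0 \<and> abv x \<le> r"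
      using poly_near_root[OF dp k r(1), of "?N 0" 0] r by auto
  next
    fix x m assume x: "poly (p (?N m)) x = 0 \<and> abv x \<le> r"
    obtain y where y: "poly (p (?N (Suc m))) y = 0" "abv y \<le> r"
      "(abv (x - y) / r) ^ k * M \<le> abv (poly (p (?N (Suc m))) x)"
      using poly_near_root[OF dp k r(1), of "?N (Suc m)" x] x gp[of "?N (Suc m)"] by auto
    have "abv (poly (p (?N (Suc m))) x) = abv (fps_nth F (?N m)) * abv x ^ ?N m"
      using pS[of "?N m" x] x by (simp add: abv_mult abv_power)
    also have "\<dots> \<le> abv (fps_nth F (?N m)) * r ^ ?N m"
      using x by (intro mult_left_mono power_mono) auto
    finally show "\<exists>y. (poly (p (?N (Suc m))) y = 0 \<and> abv y \<le> r) \<and>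
        (abv (x - y) / r) ^ k * M \<le> abv (fps_nth F (?N m)) * r ^ ?N m"
      using y by (intro exI[of _ y]) auto
  qed
  then obtain Y where Y: "\<And>m. poly (p (?N m)) (Y m) = 0" "\<And>m. abv (Y m) \<le> r"
    "\<And>m. (abv (Y m - Y (Suc m)) / r) ^ k * M \<le> abv (fps_nth F (?N m)) * r ^ (?N m)" by blast
  have lim: "(\<lambda>m. abv (fps_nth F (?N m)) * r ^ ?N m) \<longlonglongrightarrow> 0"
    using LIMSEQ_ignore_initial_segment[OF anal_tendsto_0[OF F, of r], of "Suc k"] r
    by (simp add: add.commute)
  have "(\<lambda>m. abv (Y (Suc m) - Y m)) \<longlonglongrightarrow> 0"
  proof (rule LIMSEQ_I)
    fix e :: real assume e: "0 < e"
    then have "0 < (e / r) ^ k * M" using M r by simp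
    from order_tendstoD(2)[OF lim this] obtain N
      where N: "\<And>m. m \<ge> N \<Longrightarrow> abv (fps_nth F (?N m)) * r ^ ?N m < (e / r) ^ k * M"
      by (auto simp: eventually_sequentially)
    have "abv (Y (Suc m) - Y m) < e" if "m \<ge> N" for m
    proof -
      have "(abv (Y m - Y (Suc m)) / r) ^ k * M < (e / r) ^ k * M"
        using N[OF that] Y(3)[of m] by linarith
      then have "(abv (Y m - Y (Suc m)) / r) ^ k < (e / r) ^ k"
        using mult_less_cancel_right_pos[OF M(1)] by blast
      then have "abv (Y m - Y (Suc m)) / r < e / r"
        by (rule power_less_imp_less_base) (use e r in simp)
      then show ?thesis using r by (simp add: divide_less_cancel abv_minus_commute)
    qed
    then show "\<exists>no. \<forall>n\<ge>no. norm (abv (Y (Suc n) - Y n) - 0) < e" by auto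
  qed
  then have "Cauchy Y" by (rule ultra_Cauchy)
  then obtain y where y: "Y \<longlonglongrightarrow> y" using Cauchy_convergent convergent_def by blast
  have yr: "abv y \<le> r" using abv_lim_le[OF y Y(2)] .
  have "summable (\<lambda>n. fps_nth F n * y ^ n)"
    using anal_shift_tendsto_0[OF F, of y 0] yr r by (intro ultra_summable) simp
  then have "(\<lambda>N. poly (p N) y) \<longlonglongrightarrow> ev y F"
    unfolding pp ev_def by (rule summable_LIMSEQ)
  then have l1: "(\<lambda>m. poly (p (?N m)) y) \<longlonglongrightarrow> ev y F"
    using LIMSEQ_ignore_initial_segment[of "\<lambda>N. poly (p N) y" _ "Suc k"] by (simp add: add.commute)
  \<comment> \<open>On the closed disk all truncations are Lipschitz with the same constant
    \<open>M / r\<close>, so their values at the limit \<open>y\<close> tend to 0 with the distance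
    to the roots.\<close>
  have le: "norm (abv (poly (p (?N m)) y - 0)) \<le> abv (Y m - y) * (M / r)" for m
  proof -
    have "poly (p (?N m)) y = poly (p (?N m)) y - poly (p (?N m)) (Y m)" using Y(1) by simp
    also have "\<dots> = (\<Sum>n<?N m. fps_nth F n * (y ^ n - Y m ^ n))"
      by (simp add: pp right_diff_distrib sum_subtractf)
    also have "abv \<dots> \<le> abv (y - Y m) * (M / r)"
    proof (rule abv_sum_le)
      fix n
      have "r * abv (fps_nth F n * (y ^ n - Y m ^ n)) \<le> abv (fps_nth F n) * (abv (y - Y m) * r ^ n)"
        using mult_left_mono[OF abv_power_diff_le[OF yr Y(2), of n m] abv_nonneg[of "fps_nth F n"]]
        by (simp add: abv_mult mult_ac)
      also have "\<dots> = abv (y - Y m) * (abv (fps_nth F n) * r ^ n)" by simp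
      also have "\<dots> \<le> abv (y - Y m) * M"
        unfolding M_def by (intro mult_left_mono gauss_ge F r) auto
      finally show "abv (fps_nth F n * (y ^ n - Y m ^ n)) \<le> abv (y - Y m) * (M / r)"
        using r by (simp add: field_simps)
    qed (use M r in auto)
    finally show ?thesis by (simp add: abv_minus_commute)
  qed
  have "(\<lambda>m. abv (Y m - y)) \<longlonglongrightarrow> 0" using y by (subst (asm) abv_LIMSEQ_0_iff)
  then have "(\<lambda>m. abv (Y m - y) * (M / r)) \<longlonglongrightarrow> 0" by (rule tendsto_mult_left_zero)
  from Lim_null_comparison[OF always_eventually[OF allI[OF le]] this]
  have "(\<lambda>m. poly (p (?N m)) y) \<longlonglongrightarrow> 0" by (subst abv_LIMSEQ_0_iff)
  then have "ev y F = 0" using l1 LIMSEQ_unique by blast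
  then show ?thesis using yr by blast
qed

lemma anal_prod_mset [simp]: "(\<Prod>x\<in>#A. fps_X - fps_const x) \<in> anal"
  by (induction A) (auto intro!: anal_mult)

text \<open>Weierstrass factorization at one radius: zeros are split off until the dominant index is
  0, and a factor of index 0 has no zero in the closed disk.\<close>

lemma zeros_factorization:
  fixes F :: "'a::{ultrametric_field, complete_space, alg_closed_field} fps"
  assumes r: "0 < r" "r < R" and F: "F \<in> anal" "F \<noteq> 0"
  shows "\<exists>A u. u \<in> anal \<and> gauss_dom r u 0 \<and> (\<forall>x\<in>#A. abv x \<le> r) \<and> F = (\<Prod>x\<in>#A. fps_X - fps_const x) * u"
proof -
  obtain i where "gauss_dom r F i" using ex_dom F r by blast
  then show ?thesis using F(1)
  proof (induction i arbitrary: F)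
    case 0
    then show ?case by (intro exI[of _ "{#}"] exI[of _ F]) auto
  next
    case (Suc i)
    obtain d where d: "abv d \<le> r" "ev d F = 0" using ex_zero[OF Suc.prems(2) r Suc.prems(1)] by auto
    have dR: "abv d < R" using d r by simp
    have eq: "F = (fps_X - fps_const d) * quo d F" using ev_quo[OF Suc.prems(2) dR] d by simp
    have "F \<noteq> 0" using Suc.prems by (auto simp: gauss_dom_def)
    then have q: "quo d F \<in> anal" "quo d F \<noteq> 0"
      using anal_quo[OF Suc.prems(2) dR] eq by (blast, metis mult_zero_right)
    then obtain j where j: "gauss_dom r (quo d F) j" using ex_dom r by blast
    have "gauss_dom r ((fps_X - fps_const d) * quo d F) (1 + j)"
      using gauss_dom_mult[OF gauss_dom_lin[of r d] j] r d by simp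
    then have "gauss_dom r F (1 + j)" using eq by simp
    then have "i = j" using gauss_dom_unique Suc.prems(1) by fastforce
    then obtain A u where "u \<in> anal" "gauss_dom r u 0" "\<forall>x\<in>#A. abv x \<le> r"
      "quo d F = (\<Prod>x\<in>#A. fps_X - fps_const x) * u" using Suc.IH[of "quo d F"] j q by blast
    then show ?case using d(1) eq
      by (intro exI[of _ "add_mset d A"] exI[of _ u]) (auto simp: mult.assoc)
  qed
qed

lemma gauss_dom_0_mono:
  assumes "gauss_dom r u 0" "0 < s" "s \<le> r"
  shows "gauss_dom s u 0"
proof -
  have le: "abv (fps_nth u n) * s ^ n \<le> abv (fps_nth u n) * r ^ n" for n
    using assms by (intro mult_left_mono power_mono) auto
  have r: "abv (fps_nth u n) * r ^ n \<le> abv (fps_nth u 0)" "n > 0 \<Longrightarrow> abv (fps_nth u n) * r ^ n < abv (fps_nth u 0)" for n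
    using assms(1) by (simp_all add: gauss_dom_def)
  have "abv (fps_nth u n) * s ^ n \<le> abv (fps_nth u 0)" for n
    by (rule order_trans[OF le r(1)])
  moreover have "abv (fps_nth u n) * s ^ n < abv (fps_nth u 0)" if "n > 0" for n
    by (rule le_less_trans[OF le r(2)[OF that]])
  moreover have "fps_nth u 0 \<noteq> 0" using assms(1) by (simp add: gauss_dom_def)
  ultimately show ?thesis by (simp add: gauss_dom_def)
qed

end

section \<open>Meromorphic functions\<close>

definition lin :: "'a::field \<Rightarrow> 'a fls" where "lin d = fls_X - fls_const d"

lemma lin_fps: "lin d = fps_to_fls (fps_X - fps_const d)"
  by (simp add: lin_def)

lemma lin_nz [simp]: "lin d \<noteq> 0"
proof
  assume "lin d = 0"
  then have "fls_nth (lin d) 1 = 0" by simp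
  then show False by (simp add: lin_def)
qed

lemma fls_deriv_lin [simp]: "fls_deriv (lin d) = 1"
  by (simp add: lin_def)

lemma fls_deriv_divide:
  fixes f g :: "'a::field fls"
  assumes "g \<noteq> 0"
  shows "fls_deriv (f / g) = (fls_deriv f * g - f * fls_deriv g) / (g * g)"
proof -
  have "fls_deriv f = fls_deriv (f / g * g)" using assms by simp
  also have "\<dots> = f / g * fls_deriv g + fls_deriv (f / g) * g" by (rule fls_deriv_mult)
  finally have "fls_deriv f * g = (f / g) * g * fls_deriv g + fls_deriv (f / g) * (g * g)"
    by (simp add: algebra_simps)
  then show ?thesis using assms by (simp add: field_simps)
qed

lemma fls_deriv_lin_powi:
  fixes d :: "'a::field"
  shows "fls_deriv (lin d powi m) = of_int m * lin d powi (m - 1)"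
proof (cases "m \<ge> 0")
  case True
  then obtain n where n: "m = int n" using nonneg_int_cases by blast
  show ?thesis
  proof (cases n)
    case (Suc k)
    have "fls_deriv (lin d ^ n) = of_nat n * lin d ^ (n - 1)" by (simp add: fls_deriv_power)
    moreover have "lin d powi m = lin d ^ n" using n by simp
    moreover have "m - 1 = int (n - 1)" using n Suc by simp
    then have "lin d powi (m - 1) = lin d ^ (n - 1)" by (metis power_int_of_nat)
    ultimately show ?thesis using n by simp
  qed (use n in simp)
next
  case False
  define n where "n = nat (- m)"
  have n: "m = - int n" "n > 0" using False by (auto simp: n_def)
  then obtain k where k: "n = Suc k" by (cases n) auto
  have "fls_deriv (lin d powi m) = fls_deriv (1 / lin d ^ n)" using n by (simp add: power_int_minus divide_inverse)
  also have "\<dots> = - (of_nat n * lin d ^ (n - 1)) / (lin d ^ n * lin d ^ n)"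
    by (subst fls_deriv_divide) (auto simp: fls_deriv_power)
  also have "\<dots> = - of_nat n / (lin d ^ Suc n)" using k by (simp add: field_simps)
  also have "\<dots> = of_int m * lin d powi (m - 1)"
  proof -
    have "m - 1 = - int (Suc n)" using n by simp
    then have "lin d powi (m - 1) = inverse (lin d ^ Suc n)"
      by (simp only: power_int_minus power_int_of_nat)
    then show ?thesis using n(1) by (simp only: divide_inverse of_int_minus of_int_of_nat_eq)
  qed
  finally show ?thesis .
qed

context disc
begin

definition mer :: "'a::ultrametric_field fls set" where
  "mer = fraction_field_of anal"

lemma merI: "F \<in> anal \<Longrightarrow> G \<in> anal \<Longrightarrow> G \<noteq> 0 \<Longrightarrow> fps_to_fls F / fps_to_fls G \<in> mer"
  unfolding mer_def fraction_field_of_def by blast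

lemma merE:
  assumes "h \<in> mer"
  obtains F G where "F \<in> anal" "G \<in> anal" "G \<noteq> 0" "h = fps_to_fls F / fps_to_fls G"
  using assms unfolding mer_def fraction_field_of_def by blast

lemma mer_anal: "F \<in> anal \<Longrightarrow> fps_to_fls F \<in> mer"
  using merI[of F 1] by simp

lemma mer_const [simp]: "fls_const e \<in> mer"
  using mer_anal[of "fps_const e"] by simp

lemma mer_0 [simp]: "0 \<in> mer" and mer_1 [simp]: "1 \<in> mer"
  using mer_const[of 0] mer_const[of 1] by simp_all

lemma mer_lin [simp]: "lin d \<in> mer"
  unfolding lin_fps by (intro mer_anal) simp

lemma mer_add:
  assumes "g \<in> mer" "h \<in> mer"
  shows "g + h \<in> mer"
proof -
  obtain F G where 1: "F \<in> anal" "G \<in> anal" "G \<noteq> 0" "g = fps_to_fls F / fps_to_fls G" using assms merE by blast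
  obtain F' G' where 2: "F' \<in> anal" "G' \<in> anal" "G' \<noteq> 0" "h = fps_to_fls F' / fps_to_fls G'" using assms merE by blast
  have "g + h = fps_to_fls (F * G' + F' * G) / fps_to_fls (G * G')"
    using 1 2 by (simp add: fls_times_fps_to_fls add_frac_eq)
  also have "\<dots> \<in> mer" using 1 2 by (intro merI anal_add anal_mult) auto
  finally show ?thesis .
qed

lemma mer_mult:
  assumes "g \<in> mer" "h \<in> mer"
  shows "g * h \<in> mer"
proof -
  obtain F G where 1: "F \<in> anal" "G \<in> anal" "G \<noteq> 0" "g = fps_to_fls F / fps_to_fls G" using assms merE by blast
  obtain F' G' where 2: "F' \<in> anal" "G' \<in> anal" "G' \<noteq> 0" "h = fps_to_fls F' / fps_to_fls G'" using assms merE by blast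
  have "g * h = fps_to_fls (F * F') / fps_to_fls (G * G')"
    using 1 2 by (simp add: fls_times_fps_to_fls)
  also have "\<dots> \<in> mer" using 1 2 by (intro merI anal_mult) auto
  finally show ?thesis .
qed

lemma mer_inverse:
  assumes "h \<in> mer"
  shows "inverse h \<in> mer"
proof (cases "h = 0")
  case False
  obtain F G where 1: "F \<in> anal" "G \<in> anal" "G \<noteq> 0" "h = fps_to_fls F / fps_to_fls G" using assms merE by blast
  then have "inverse h = fps_to_fls G / fps_to_fls F" by simp
  then show ?thesis using merI[of G F] 1 False by auto
qed simp

lemma mer_uminus: "h \<in> mer \<Longrightarrow> - h \<in> mer"
  using mer_mult[OF mer_const[of "- 1"]] by fastforce

lemma mer_diff: "g \<in> mer \<Longrightarrow> h \<in> mer \<Longrightarrow> g - h \<in> mer"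
  using mer_add[OF _ mer_uminus] by fastforce

lemma mer_divide: "g \<in> mer \<Longrightarrow> h \<in> mer \<Longrightarrow> g / h \<in> mer"
  using mer_mult[OF _ mer_inverse] by (simp add: divide_inverse)

lemma mer_power: "h \<in> mer \<Longrightarrow> h ^ n \<in> mer"
  by (induction n) (auto intro: mer_mult)

lemma mer_prod: "(\<And>i. i \<in> I \<Longrightarrow> h i \<in> mer) \<Longrightarrow> prod h I \<in> mer"
  by (induction I rule: infinite_finite_induct) (auto intro: mer_mult)

lemma mer_deriv:
  assumes "h \<in> mer"
  shows "fls_deriv h \<in> mer"
proof -
  obtain F G where 1: "F \<in> anal" "G \<in> anal" "G \<noteq> 0" "h = fps_to_fls F / fps_to_fls G" using assms merE by blast
  have "fls_deriv h = (fps_to_fls (fps_deriv F) * fps_to_fls G - fps_to_fls F * fps_to_fls (fps_deriv G)) / (fps_to_fls G * fps_to_fls G)"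
    unfolding 1(4) by (subst fls_deriv_divide) (use 1 in \<open>simp_all add: fls_deriv_fps_to_fls\<close>)
  also have "\<dots> \<in> mer" using 1 by (intro mer_divide mer_diff mer_mult mer_anal anal_deriv)
  finally show ?thesis .
qed

subsection \<open>Gauss norms of meromorphic functions\<close>

text \<open>Independent of the representation as a quotient, because the Gauss norm is
  multiplicative on \<open>anal\<close>.\<close>

definition gm :: "real \<Rightarrow> 'a::ultrametric_field fls \<Rightarrow> real" where
  "gm r h = (THE v. \<exists>F\<in>anal. \<exists>G\<in>anal. G \<noteq> 0 \<and> h = fps_to_fls F / fps_to_fls G \<and> v = gauss r F / gauss r G)"

lemma gm_eq:
  assumes r: "0 < r" "r < R" and "F \<in> anal" "G \<in> anal" "G \<noteq> 0"
  shows "gm r (fps_to_fls F / fps_to_fls G) = gauss r F / gauss r G"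
  unfolding gm_def
proof (rule the_equality)
  fix v assume "\<exists>F'\<in>anal. \<exists>G'\<in>anal. G' \<noteq> 0 \<and> fps_to_fls F / fps_to_fls G = fps_to_fls F' / fps_to_fls G'
    \<and> v = gauss r F' / gauss r G'"
  then obtain F' G' where 1: "F' \<in> anal" "G' \<in> anal" "G' \<noteq> 0" "v = gauss r F' / gauss r G'"
    and eq: "fps_to_fls F / fps_to_fls G = fps_to_fls F' / fps_to_fls G'" by blast
  have "fps_to_fls (F * G') = fps_to_fls (F' * G)"
    using eq 1 assms by (simp add: fls_times_fps_to_fls frac_eq_eq)
  then have "F * G' = F' * G" by simp
  then have "gauss r F * gauss r G' = gauss r F' * gauss r G"
    using gauss_mult[OF _ _ r] 1 assms by metis
  moreover have pos: "gauss r G > 0" "gauss r G' > 0" using gauss_pos 1 assms by auto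
  then have "gauss r F' = v * gauss r G'" using 1 by simp
  ultimately have "gauss r F * gauss r G' = (v * gauss r G) * gauss r G'" by simp
  then show "v = gauss r F / gauss r G" using pos by simp
qed (use assms in blast)

context
  fixes r :: real
  assumes r: "0 < r" "r < R"
begin

lemma gauss_one [simp]: "gauss r (1 :: 'a::ultrametric_field fps) = 1"
  using gauss_dom_eq[OF gauss_dom_const[of "1::'a" r]] r by simp

lemma gm_anal: "F \<in> anal \<Longrightarrow> gm r (fps_to_fls F) = gauss r F"
  using gm_eq[OF r, of F 1] by simp

lemma gm_const [simp]: "gm r (fls_const e) = abv e"
proof (cases "e = 0")
  case True
  then show ?thesis using gm_anal[of 0] by simp
next
  case False
  then show ?thesis using gm_anal[of "fps_const e"] gauss_dom_eq[OF gauss_dom_const[of e r]] r by simp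
qed

lemma gm_lin: "gm r (lin d) = max r (abv d)"
  unfolding lin_fps using gm_anal[OF anal_lin[of d]] gauss_lin[of r d] r by simp

lemma gm_mult:
  assumes "g \<in> mer" "h \<in> mer"
  shows "gm r (g * h) = gm r g * gm r h"
proof -
  obtain F G where 1: "F \<in> anal" "G \<in> anal" "G \<noteq> 0" "g = fps_to_fls F / fps_to_fls G" using assms merE by blast
  obtain F' G' where 2: "F' \<in> anal" "G' \<in> anal" "G' \<noteq> 0" "h = fps_to_fls F' / fps_to_fls G'" using assms merE by blast
  have "g * h = fps_to_fls (F * F') / fps_to_fls (G * G')"
    using 1 2 by (simp add: fls_times_fps_to_fls)
  then have "gm r (g * h) = gauss r (F * F') / gauss r (G * G')"
    using gm_eq[OF r, of "F * F'" "G * G'"] 1 2 by (simp add: anal_mult)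
  then show ?thesis using 1 2 r by (simp add: gm_eq gauss_mult)
qed

lemma gm_pos:
  assumes "h \<in> mer" "h \<noteq> 0"
  shows "0 < gm r h"
proof -
  obtain F G where 1: "F \<in> anal" "G \<in> anal" "G \<noteq> 0" "h = fps_to_fls F / fps_to_fls G" using assms merE by blast
  then have "F \<noteq> 0" using assms by auto
  then show ?thesis using 1 r gauss_pos[of F r] gauss_pos[of G r] by (simp add: gm_eq)
qed

lemma gm_divide:
  assumes "g \<in> mer" "h \<in> mer" "h \<noteq> 0"
  shows "gm r (g / h) = gm r g / gm r h"
proof -
  have "gm r g = gm r (g / h * h)" using assms by simp
  also have "\<dots> = gm r (g / h) * gm r h" using assms by (intro gm_mult mer_divide)
  finally show ?thesis using gm_pos[OF assms(2,3)] by simp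
qed

lemma gm_add_le:
  assumes "g \<in> mer" "h \<in> mer"
  shows "gm r (g + h) \<le> max (gm r g) (gm r h)"
proof -
  obtain F G where 1: "F \<in> anal" "G \<in> anal" "G \<noteq> 0" "g = fps_to_fls F / fps_to_fls G" using assms merE by blast
  obtain F' G' where 2: "F' \<in> anal" "G' \<in> anal" "G' \<noteq> 0" "h = fps_to_fls F' / fps_to_fls G'" using assms merE by blast
  have "g + h = fps_to_fls (F * G' + F' * G) / fps_to_fls (G * G')"
    using 1 2 by (simp add: fls_times_fps_to_fls add_frac_eq)
  then have "gm r (g + h) = gauss r (F * G' + F' * G) / (gauss r G * gauss r G')"
    using gm_eq[OF r, of "F * G' + F' * G" "G * G'"] 1 2
    by (simp add: anal_add anal_mult gauss_mult r)
  also have "\<dots> \<le> max (gauss r F * gauss r G') (gauss r F' * gauss r G) / (gauss r G * gauss r G')"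
    using gauss_add_le[of "F * G'" "F' * G" r] gauss_pos[of G r] gauss_pos[of G' r] 1 2 r
    by (intro divide_right_mono) (simp_all add: gauss_mult anal_mult)
  also have "\<dots> = max (gm r g) (gm r h)"
  proof -
    have pos: "gauss r G > 0" "gauss r G' > 0" using 1 2 r gauss_pos by auto
    have "gm r g = gauss r F / gauss r G" "gm r h = gauss r F' / gauss r G'"
      unfolding 1(4) 2(4) by (intro gm_eq r 1 2)+
    then show ?thesis using pos by (simp add: max_divide_distrib_right)
  qed
  finally show ?thesis .
qed

lemma gm_uminus: "(h :: 'a::ultrametric_field fls) \<in> mer \<Longrightarrow> gm r (- h) = gm r h"
  using gm_mult[OF mer_const[of "- 1"], of h] gm_const[of "- 1 :: 'a"] by simp

lemma gm_diff_le: "g \<in> mer \<Longrightarrow> h \<in> mer \<Longrightarrow> gm r (g - h) \<le> max (gm r g) (gm r h)"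
  using gm_add_le[of g "- h"] by (simp add: mer_uminus gm_uminus)

lemma gm_diff_eq:
  assumes "g \<in> mer" "h \<in> mer" "gm r h < gm r g"
  shows "gm r (g - h) = gm r g"
  using gm_diff_le[of g h] gm_add_le[of "g - h" h] assms mer_diff[of g h]
  by (auto simp: max_def split: if_splits)

text \<open>Both products in the quotient rule contain exactly one derivative and so gain one factor
  \<open>1 / r\<close>.\<close>

lemma gm_deriv_le:
  assumes "h \<in> mer"
  shows "gm r (fls_deriv h) \<le> gm r h / r"
proof -
  obtain F G where 1: "F \<in> anal" "G \<in> anal" "G \<noteq> 0" "h = fps_to_fls F / fps_to_fls G" using assms merE by blast
  have "fls_deriv h = (fps_to_fls (fps_deriv F) * fps_to_fls G - fps_to_fls F * fps_to_fls (fps_deriv G)) / (fps_to_fls G * fps_to_fls G)"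
    unfolding 1(4) by (subst fls_deriv_divide) (use 1 in \<open>simp_all add: fls_deriv_fps_to_fls\<close>)
  also have "gm r \<dots> = gm r (fps_to_fls (fps_deriv F) * fps_to_fls G - fps_to_fls F * fps_to_fls (fps_deriv G)) / (gauss r G * gauss r G)"
    using 1 by (subst gm_divide) (simp_all add: mer_diff mer_mult mer_anal anal_deriv gm_mult gm_anal)
  also have "\<dots> \<le> (gauss r F / r * gauss r G) / (gauss r G * gauss r G)"
  proof (rule divide_right_mono)
    have "gm r (fps_to_fls (fps_deriv F) * fps_to_fls G - fps_to_fls F * fps_to_fls (fps_deriv G))
      \<le> max (gauss r (fps_deriv F) * gauss r G) (gauss r F * gauss r (fps_deriv G))"
      using gm_diff_le[of "fps_to_fls (fps_deriv F) * fps_to_fls G" "fps_to_fls F * fps_to_fls (fps_deriv G)"] 1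
      by (simp add: mer_mult mer_anal anal_deriv gm_mult gm_anal)
    also have "\<dots> \<le> gauss r F / r * gauss r G"
    proof -
      have "gauss r (fps_deriv F) * gauss r G \<le> gauss r F / r * gauss r G"
        using gauss_deriv_le[OF 1(1) r] gauss_nonneg[OF 1(2) r] by (rule mult_right_mono)
      moreover have "gauss r F * gauss r (fps_deriv G) \<le> gauss r F * (gauss r G / r)"
        using gauss_deriv_le[OF 1(2) r] gauss_nonneg[OF 1(1) r] by (rule mult_left_mono)
      ultimately show ?thesis by simp
    qed
    finally show "gm r (fps_to_fls (fps_deriv F) * fps_to_fls G - fps_to_fls F * fps_to_fls (fps_deriv G)) \<le> gauss r F / r * gauss r G" .
  qed (use gauss_nonneg[OF 1(2) r] in simp)
  also have "\<dots> = gm r h / r" 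
  proof -
    have "gm r h = gauss r F / gauss r G" unfolding 1(4) by (intro gm_eq r 1)
    then show ?thesis using gauss_pos[OF 1(2,3) r] r by (simp add: field_simps)
  qed
  finally show ?thesis .
qed

end

subsection \<open>Orders\<close>

text \<open>The local ring of the disk at \<open>d\<close>. Its units are given by
  \<open>loc_unit\<close>, its maximal ideal is generated by \<open>lin d\<close>, and
  \<open>ord d\<close> is the associated valuation on nonzero meromorphic functions.\<close>

definition loc_ring :: "'a::ultrametric_field \<Rightarrow> 'a fls \<Rightarrow> bool" where
  "loc_ring d h \<longleftrightarrow> (\<exists>F\<in>anal. \<exists>G\<in>anal. ev d G \<noteq> 0 \<and> h = fps_to_fls F / fps_to_fls G)"

definition loc_unit :: "'a::ultrametric_field \<Rightarrow> 'a fls \<Rightarrow> bool" where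
  "loc_unit d h \<longleftrightarrow> (\<exists>F\<in>anal. \<exists>G\<in>anal. ev d F \<noteq> 0 \<and> ev d G \<noteq> 0 \<and> h = fps_to_fls F / fps_to_fls G)"

text \<open>Meaningful only for nonzero \<open>h\<close>: no exponent represents 0, whose order is
  unspecified. Hence the many nonvanishing assumptions below.\<close>

definition ord :: "'a::ultrametric_field \<Rightarrow> 'a fls \<Rightarrow> int" where
  "ord d h = (THE m. \<exists>F\<in>anal. \<exists>G\<in>anal. ev d F \<noteq> 0 \<and> ev d G \<noteq> 0 \<and>
     h = lin d powi m * (fps_to_fls F / fps_to_fls G))"

lemma loc_unit_ring: "loc_unit d h \<Longrightarrow> loc_ring d h"
  unfolding loc_unit_def loc_ring_def by blast

lemma loc_unit_inverse: "loc_unit d h \<Longrightarrow> loc_unit d (inverse h)"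
  unfolding loc_unit_def by (metis inverse_divide)

context
  fixes d :: "'a::{ultrametric_field, complete_space}"
  assumes d: "abv d < R"
begin

lemma ev_0 [simp]: "ev d 0 = 0" and ev_1 [simp]: "ev d 1 = 1"
  using ev_const[OF d, of 0] ev_const[OF d, of 1] by simp_all

lemma loc_ring_mer: "loc_ring d h \<Longrightarrow> h \<in> mer"
  unfolding loc_ring_def by (auto intro!: merI)

lemma loc_unit_nz: "loc_unit d h \<Longrightarrow> h \<noteq> 0"
  unfolding loc_unit_def by auto

lemma loc_unit_const: "e \<noteq> 0 \<Longrightarrow> loc_unit d (fls_const e)"
  unfolding loc_unit_def
  by (intro bexI[of _ "fps_const e"] bexI[of _ 1]) (simp_all add: ev_const[OF d])

lemma loc_unit_mult:
  assumes "loc_unit d g" "loc_unit d h"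
  shows "loc_unit d (g * h)"
proof -
  obtain F G where 1: "F \<in> anal" "G \<in> anal" "ev d F \<noteq> 0" "ev d G \<noteq> 0" "g = fps_to_fls F / fps_to_fls G"
    using assms unfolding loc_unit_def by blast
  obtain F' G' where 2: "F' \<in> anal" "G' \<in> anal" "ev d F' \<noteq> 0" "ev d G' \<noteq> 0" "h = fps_to_fls F' / fps_to_fls G'"
    using assms unfolding loc_unit_def by blast
  have "g * h = fps_to_fls (F * F') / fps_to_fls (G * G')" using 1 2 by (simp add: fls_times_fps_to_fls)
  then show ?thesis unfolding loc_unit_def using 1 2
    by (intro bexI[of _ "F * F'"] bexI[of _ "G * G'"]) (simp_all add: ev_mult[OF d] anal_mult)
qed

lemma loc_ring_mult:
  assumes "loc_ring d g" "loc_ring d h"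
  shows "loc_ring d (g * h)"
proof -
  obtain F G where 1: "F \<in> anal" "G \<in> anal" "ev d G \<noteq> 0" "g = fps_to_fls F / fps_to_fls G"
    using assms unfolding loc_ring_def by blast
  obtain F' G' where 2: "F' \<in> anal" "G' \<in> anal" "ev d G' \<noteq> 0" "h = fps_to_fls F' / fps_to_fls G'"
    using assms unfolding loc_ring_def by blast
  have "g * h = fps_to_fls (F * F') / fps_to_fls (G * G')" using 1 2 by (simp add: fls_times_fps_to_fls)
  then show ?thesis unfolding loc_ring_def using 1 2
    by (intro bexI[of _ "F * F'"] bexI[of _ "G * G'"]) (simp_all add: ev_mult[OF d] anal_mult)
qed

lemma loc_ring_add:
  assumes "loc_ring d g" "loc_ring d h"
  shows "loc_ring d (g + h)"
proof -
  obtain F G where 1: "F \<in> anal" "G \<in> anal" "ev d G \<noteq> 0" "g = fps_to_fls F / fps_to_fls G"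
    using assms unfolding loc_ring_def by blast
  obtain F' G' where 2: "F' \<in> anal" "G' \<in> anal" "ev d G' \<noteq> 0" "h = fps_to_fls F' / fps_to_fls G'"
    using assms unfolding loc_ring_def by blast
  have "G \<noteq> 0" "G' \<noteq> 0" using 1 2 by auto
  then have "g + h = fps_to_fls (F * G' + F' * G) / fps_to_fls (G * G')"
    using 1 2 by (simp add: fls_times_fps_to_fls add_frac_eq)
  then show ?thesis unfolding loc_ring_def using 1 2
    by (intro bexI[of _ "F * G' + F' * G"] bexI[of _ "G * G'"]) (simp_all add: ev_mult[OF d] anal_mult anal_add)
qed

lemma loc_ring_anal: "F \<in> anal \<Longrightarrow> loc_ring d (fps_to_fls F)"
  unfolding loc_ring_def by (intro bexI[of _ F] bexI[of _ 1]) simp_all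

lemma loc_ring_const [simp]: "loc_ring d (fls_const e)"
  using loc_ring_anal[of "fps_const e"] by simp

lemma loc_ring_lin: "loc_ring d (lin e)"
  unfolding lin_fps by (intro loc_ring_anal) simp

lemma loc_ring_diff:
  assumes "loc_ring d g" "loc_ring d h"
  shows "loc_ring d (g - h)"
proof -
  have "loc_ring d (fls_const (-1) * h)" by (intro loc_ring_mult loc_ring_const assms)
  then show ?thesis using loc_ring_add[OF assms(1), of "- h"] by simp
qed

lemma loc_ring_power: "loc_ring d h \<Longrightarrow> loc_ring d (h ^ n)"
  using loc_ring_const[of 1] by (induction n) (auto intro: loc_ring_mult)

lemma loc_ring_deriv:
  assumes "loc_ring d h"
  shows "loc_ring d (fls_deriv h)"
proof -
  obtain F G where 1: "F \<in> anal" "G \<in> anal" "ev d G \<noteq> 0" "h = fps_to_fls F / fps_to_fls G"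
    using assms unfolding loc_ring_def by blast
  have "G \<noteq> 0" using 1 by auto
  then have "fls_deriv h = fps_to_fls (fps_deriv F * G - F * fps_deriv G) / fps_to_fls (G * G)"
    unfolding 1(4) by (subst fls_deriv_divide) (simp_all add: fls_deriv_fps_to_fls fls_times_fps_to_fls del: fps_deriv_mult)
  then show ?thesis unfolding loc_ring_def using 1
    by (intro bexI[of _ "fps_deriv F * G - F * fps_deriv G"] bexI[of _ "G * G"])
      (simp_all add: ev_mult[OF d] anal_mult anal_diff anal_deriv)
qed

text \<open>A multiple of \<open>lin d\<close> does not change the value at \<open>d\<close>.
  Uniqueness of orders and the order of a derivative both rest on this.\<close>

lemma loc_unit_add_lin:
  assumes "loc_unit d g" "loc_ring d h"
  shows "loc_unit d (g + lin d * h)"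
proof -
  obtain F G where 1: "F \<in> anal" "G \<in> anal" "ev d F \<noteq> 0" "ev d G \<noteq> 0" "g = fps_to_fls F / fps_to_fls G"
    using assms unfolding loc_unit_def by blast
  obtain F' G' where 2: "F' \<in> anal" "G' \<in> anal" "ev d G' \<noteq> 0" "h = fps_to_fls F' / fps_to_fls G'"
    using assms unfolding loc_ring_def by blast
  have "G \<noteq> 0" "G' \<noteq> 0" using 1 2 by auto
  then have "g + lin d * h = fps_to_fls (F * G' + (fps_X - fps_const d) * (F' * G)) / fps_to_fls (G * G')"
    using 1 2 by (simp add: lin_fps fls_times_fps_to_fls add_frac_eq mult.assoc)
  moreover have "ev d (F * G' + (fps_X - fps_const d) * (F' * G)) = ev d F * ev d G'"
  proof -
    have "ev d ((fps_X - fps_const d) * (F' * G)) = 0" using 1 2 by (intro ev_lin_mult[OF d] anal_mult)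
    then show ?thesis using 1 2 by (subst ev_add[OF d]) (simp_all add: anal_mult ev_mult[OF d, of F G'])
  qed
  ultimately show ?thesis unfolding loc_unit_def using 1 2
    by (intro bexI[of _ "F * G' + (fps_X - fps_const d) * (F' * G)"] bexI[of _ "G * G'"])
      (simp_all add: ev_mult[OF d, of G G'] anal_mult anal_add)
qed

lemma loc_unit_not_lin:
  assumes "loc_unit d g" "loc_ring d h"
  shows "g \<noteq> lin d * h"
proof
  assume eq: "g = lin d * h"
  have "loc_unit d (g + lin d * (- h))"
    using loc_ring_diff[OF loc_ring_const[of 0] assms(2)] by (intro loc_unit_add_lin assms) simp
  then show False using eq loc_unit_nz by fastforce
qed

lemma loc_ring_cases:
  assumes "loc_ring d h" "h \<noteq> 0"
  obtains j u where "loc_unit d u" "h = lin d ^ j * u"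
proof -
  obtain F G where 1: "F \<in> anal" "G \<in> anal" "ev d G \<noteq> 0" "h = fps_to_fls F / fps_to_fls G"
    using assms unfolding loc_ring_def by blast
  then have "F \<noteq> 0" using assms by auto
  then obtain j H where "H \<in> anal" "ev d H \<noteq> 0" "F = (fps_X - fps_const d) ^ j * H"
    using anal_factor_at[OF d 1(1)] by blast
  then show ?thesis using 1
    by (intro that[of "fps_to_fls H / fps_to_fls G" j])
      (auto simp: loc_unit_def lin_fps fls_times_fps_to_fls fps_to_fls_power)
qed

lemma mer_cases:
  assumes "h \<in> mer" "h \<noteq> 0"
  obtains m u where "loc_unit d u" "h = lin d powi m * u"
proof -
  obtain F G where 1: "F \<in> anal" "G \<in> anal" "G \<noteq> 0" "h = fps_to_fls F / fps_to_fls G" using assms merE by blast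
  then have "F \<noteq> 0" using assms by auto
  then obtain i u where u: "loc_unit d u" "fps_to_fls F = lin d ^ i * u"
    using loc_ring_cases[OF loc_ring_anal[OF 1(1)]] by (metis fps_to_fls_eq_0_iff)
  obtain j v where v: "loc_unit d v" "fps_to_fls G = lin d ^ j * v"
    using loc_ring_cases[OF loc_ring_anal[OF 1(2)]] 1(3) by (metis fps_to_fls_eq_0_iff)
  have "h = lin d powi (int i - int j) * (u * inverse v)"
    using 1(4) u(2) v(2) by (simp add: power_int_diff divide_inverse)
  moreover have "loc_unit d (u * inverse v)" using u v loc_unit_mult loc_unit_inverse by blast
  ultimately show ?thesis using that by blast
qed

lemma lin_powi_unit_unique:
  assumes "loc_unit d u" "loc_unit d v" "lin d powi m * u = lin d powi n * v"
  shows "m = n"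
proof -
  have *: "\<not> m < n" if uv: "loc_unit d u" "loc_unit d v" "lin d powi m * u = lin d powi n * v" for u v m n
  proof
    assume "m < n"
    define k where "k = nat (n - m - 1)"
    have n: "n = m + 1 + int k" using \<open>m < n\<close> by (simp add: k_def)
    have "lin d powi n = lin d powi m * (lin d * lin d ^ k)"
      unfolding n by (simp add: power_int_add)
    then have "u = lin d * (lin d ^ k * v)" using uv(3) by (simp add: mult.assoc)
    moreover have "loc_ring d (lin d ^ k * v)"
      by (intro loc_ring_mult loc_ring_power loc_ring_lin loc_unit_ring uv)
    ultimately show False using loc_unit_not_lin uv(1) by blast
  qed
  show ?thesis using *[OF assms] *[OF assms(2,1) assms(3)[symmetric]] by simp
qed

lemma ord_eqI:
  assumes "loc_unit d u" "h = lin d powi m * u"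
  shows "ord d h = m"
proof -
  have "ord d h = (THE m. \<exists>u. loc_unit d u \<and> h = lin d powi m * u)"
    unfolding ord_def loc_unit_def by (rule arg_cong[of _ _ The]) blast
  also have "\<dots> = m" using assms lin_powi_unit_unique by blast
  finally show ?thesis .
qed

lemma ordE:
  assumes "h \<in> mer" "h \<noteq> 0"
  obtains u where "loc_unit d u" "h = lin d powi (ord d h) * u"
  using mer_cases[OF assms] ord_eqI by metis

lemma ord_unit: "loc_unit d u \<Longrightarrow> ord d u = 0"
  using ord_eqI[of u u 0] by simp

lemma ord_const [simp]: "ord d (fls_const e) = 0" if "e \<noteq> 0"
  using ord_unit loc_unit_const that by blast

lemma ord_one [simp]: "ord d 1 = 0"
  using ord_const[of 1] by simp

lemma ord_mult:
  assumes "g \<in> mer" "h \<in> mer" "g \<noteq> 0" "h \<noteq> 0"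
  shows "ord d (g * h) = ord d g + ord d h"
proof -
  obtain u where u: "loc_unit d u" "g = lin d powi (ord d g) * u" using ordE assms by blast
  obtain v where v: "loc_unit d v" "h = lin d powi (ord d h) * v" using ordE assms by blast
  have "g * h = (lin d powi (ord d g) * u) * (lin d powi (ord d h) * v)"
    by (rule arg_cong2[where f = "(*)", OF u(2) v(2)])
  also have "\<dots> = lin d powi (ord d g + ord d h) * (u * v)" by (simp add: power_int_add)
  finally show ?thesis using ord_eqI loc_unit_mult u v by blast
qed

lemma ord_inverse:
  assumes "h \<in> mer" "h \<noteq> 0"
  shows "ord d (inverse h) = - ord d h"
  using ord_mult[of h "inverse h"] assms mer_inverse[of h] by simp

lemma ord_divide:
  assumes "g \<in> mer" "h \<in> mer" "g \<noteq> 0" "h \<noteq> 0"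
  shows "ord d (g / h) = ord d g - ord d h"
  using assms by (simp add: divide_inverse ord_mult ord_inverse mer_inverse)

lemma ord_power:
  assumes "h \<in> mer" "h \<noteq> 0"
  shows "ord d (h ^ n) = int n * ord d h"
  using assms by (induction n) (auto simp: ord_mult mer_power algebra_simps)

lemma ord_prod:
  assumes "\<And>i. i \<in> I \<Longrightarrow> h i \<in> mer \<and> h i \<noteq> 0"
  shows "ord d (prod h I) = (\<Sum>i\<in>I. ord d (h i))"
  using assms
proof (induction I rule: infinite_finite_induct)
  case (insert x F)
  then show ?case by (simp add: ord_mult mer_prod)
qed auto

lemma ord_uminus:
  assumes "h \<in> mer" "h \<noteq> 0"
  shows "ord d (- h) = ord d h"
  using ord_mult[OF mer_const[of "- 1"] assms(1)] ord_const[of "-1"] assms by simp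

lemma ord_loc_ring:
  assumes "loc_ring d h" "h \<noteq> 0"
  shows "0 \<le> ord d h"
proof -
  obtain j u where "loc_unit d u" "h = lin d ^ j * u" using loc_ring_cases assms by blast
  then have "ord d h = int j" using ord_eqI[of u h "int j"] by simp
  then show ?thesis by simp
qed

lemma loc_ringI:
  assumes "h \<in> mer" "h \<noteq> 0 \<Longrightarrow> 0 \<le> ord d h"
  shows "loc_ring d h"
proof (cases "h = 0")
  case True
  then show ?thesis using loc_ring_const[of 0] by simp
next
  case False
  obtain u where u: "loc_unit d u" "h = lin d powi (ord d h) * u" using ordE assms False by blast
  define j where "j = nat (ord d h)"
  have "lin d powi (ord d h) = lin d ^ j" using assms False by (simp add: j_def power_int_def)
  then have eq: "h = lin d ^ j * u" using u(2) by metis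
  have "loc_ring d (lin d ^ j * u)"
    by (intro loc_ring_mult loc_ring_power loc_ring_lin loc_unit_ring u(1))
  then show ?thesis by (subst eq)
qed

lemma ord_add_ge:
  assumes "g \<in> mer" "h \<in> mer" "g \<noteq> 0" "h \<noteq> 0" "g + h \<noteq> 0" "m \<le> ord d g" "m \<le> ord d h"
  shows "m \<le> ord d (g + h)"
proof -
  \<comment> \<open>Scaling by \<open>lin d powi (- m)\<close> turns the claim into closure of the
    local ring under addition.\<close>
  have L: "lin d powi (-m) \<in> mer" "lin d powi (-m) \<noteq> 0" "ord d (lin d powi (-m)) = -m"
  proof -
    show "lin d powi (-m) \<in> mer" by (auto simp: power_int_def intro!: mer_power mer_inverse)
    show "ord d (lin d powi (-m)) = -m" using ord_eqI[OF loc_unit_const[of 1], of _ "-m"] by simp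
  qed simp
  have "loc_ring d (lin d powi (-m) * g)" "loc_ring d (lin d powi (-m) * h)"
    using assms L by (auto intro!: loc_ringI mer_mult simp: ord_mult)
  then have "loc_ring d (lin d powi (-m) * (g + h))" by (simp add: distrib_left loc_ring_add)
  then have "0 \<le> ord d (lin d powi (-m) * (g + h))" using assms L by (intro ord_loc_ring) auto
  also have "\<dots> = - m + ord d (g + h)" using assms L by (subst ord_mult) (auto intro: mer_add)
  finally show ?thesis by simp
qed

lemma ord_add_eq:
  assumes "g \<in> mer" "h \<in> mer" "g \<noteq> 0" "h \<noteq> 0" "ord d g < ord d h"
  shows "g + h \<noteq> 0" "ord d (g + h) = ord d g"
proof -
  show nz: "g + h \<noteq> 0"
  proof
    assume "g + h = 0"
    then have "g = - h" by (simp add: eq_neg_iff_add_eq_0)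
    then show False using ord_uminus[of h] assms by simp
  qed
  have "ord d g \<le> ord d (g + h)" using assms nz by (intro ord_add_ge) auto
  moreover have "\<not> ord d g < ord d (g + h)"
  proof
    assume "ord d g < ord d (g + h)"
    \<comment> \<open>\<open>g\<close> is recovered as \<open>(g + h) - h\<close>, a sum of two
      terms of larger order.\<close>
    then have "ord d g + 1 \<le> ord d ((g + h) + (- h))"
      using assms nz by (intro ord_add_ge[of "g + h" "- h"]) (auto simp: mer_add mer_uminus ord_uminus)
    then show False by simp
  qed
  ultimately show "ord d (g + h) = ord d g" by simp
qed

lemma ord_deriv_nonneg:
  assumes "h \<in> mer" "h \<noteq> 0" "0 \<le> ord d h" "fls_deriv h \<noteq> 0"
  shows "0 \<le> ord d (fls_deriv h)"
  by (rule ord_loc_ring[OF loc_ring_deriv[OF loc_ringI[OF assms(1,3)]] assms(4)])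

end

text \<open>For \<open>h = lin d powi m * u\<close> the derivative has the cofactor
  \<open>m u + lin d * u'\<close>, and characteristic zero keeps \<open>m u\<close> a unit.\<close>

lemma ord_deriv:
  fixes d :: "'a::{ultrametric_field, complete_space, field_char_0}"
  assumes d: "abv d < R" and h: "h \<in> mer" "h \<noteq> 0" "ord d h \<noteq> 0"
  shows "fls_deriv h \<noteq> 0" "ord d (fls_deriv h) = ord d h - 1"
proof -
  define m where "m = ord d h"
  obtain u where u: "loc_unit d u" "h = lin d powi m * u" using ordE[OF d h(1,2)] by (auto simp: m_def)
  have "fls_deriv h = lin d powi m * fls_deriv u + of_int m * lin d powi (m - 1) * u"
    using u(2) by (simp add: fls_deriv_lin_powi)
  also have "lin d powi m = lin d powi (m - 1) * lin d" by (simp add: power_int_diff)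
  finally have eq: "fls_deriv h = lin d powi (m - 1) * (of_int m * u + lin d * fls_deriv u)"
    by (simp add: algebra_simps)
  have "loc_unit d (of_int m * u)"
    using loc_unit_mult[OF d loc_unit_const[OF d] u(1), of "of_int m"] h(3) by (simp add: fls_of_int m_def)
  then have "loc_unit d (of_int m * u + lin d * fls_deriv u)"
    by (rule loc_unit_add_lin[OF d]) (intro loc_ring_deriv[OF d] loc_unit_ring u)
  note * = this eq
  show "ord d (fls_deriv h) = ord d h - 1" using ord_eqI[OF d *] by (simp add: m_def)
  show "fls_deriv h \<noteq> 0" using * loc_unit_nz[OF d] by simp
qed

section \<open>Counting functions\<close>

text \<open>Zeros and poles are counted from a fixed radius \<open>\<rho> > 0\<close> instead of an origin. This changes
  the counting functions by bounded terms only, and no point has to be neither a zero nor a pole.\<close>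

definition wt :: "real \<Rightarrow> 'a::ultrametric_field \<Rightarrow> real" where
  "wt r d = ln r - ln (max (abv d) \<rho>)"

definition cnt :: "real \<Rightarrow> ('a::ultrametric_field \<Rightarrow> real) \<Rightarrow> real" where
  "cnt r D = (\<Sum>d | abv d \<le> r \<and> D d \<noteq> 0. D d * wt r d)"

text \<open>Locally finite divisors. Over an infinite support the sum in \<open>cnt\<close> would be
  0 by convention and additivity could fail.\<close>

definition lf :: "('a::ultrametric_field \<Rightarrow> real) \<Rightarrow> bool" where
  "lf D \<longleftrightarrow> (\<forall>r<R. finite {d. abv d \<le> r \<and> D d \<noteq> 0})"

lemma wt_nonneg: "\<rho> \<le> r \<Longrightarrow> abv d \<le> r \<Longrightarrow> 0 \<le> wt r d"
  using rho_pos by (simp add: wt_def)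

lemma cnt_eq_sum:
  assumes "finite S" "{d. abv d \<le> r \<and> D d \<noteq> 0} \<subseteq> S" "S \<subseteq> {d. abv d \<le> r}"
  shows "cnt r D = (\<Sum>d\<in>S. D d * wt r d)"
  unfolding cnt_def using assms by (intro sum.mono_neutral_left) auto

lemma lf_finite: "lf D \<Longrightarrow> r < R \<Longrightarrow> finite {d. abv d \<le> r \<and> D d \<noteq> 0}"
  by (simp add: lf_def)

lemma lf_subset: "lf D \<Longrightarrow> (\<And>d. abv d < R \<Longrightarrow> D d = 0 \<Longrightarrow> E d = 0) \<Longrightarrow> lf E"
  unfolding lf_def by (auto intro: finite_subset[rotated])

lemma lf_zero [simp]: "lf (\<lambda>d. 0)"
  by (simp add: lf_def)

lemma lf_add:
  assumes "lf D" "lf E"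
  shows "lf (\<lambda>d. D d + E d)"
  unfolding lf_def
proof (intro allI impI)
  fix r assume "r < R"
  then have "finite ({d. abv d \<le> r \<and> D d \<noteq> 0} \<union> {d. abv d \<le> r \<and> E d \<noteq> 0})"
    using assms lf_finite by blast
  then show "finite {d. abv d \<le> r \<and> D d + E d \<noteq> 0}" by (rule finite_subset[rotated]) auto
qed

lemma lf_cmult: "lf D \<Longrightarrow> lf (\<lambda>d. c * D d)"
  by (erule lf_subset) auto

lemma lf_diff: "lf D \<Longrightarrow> lf E \<Longrightarrow> lf (\<lambda>d. D d - E d)"
  using lf_add[of D "\<lambda>d. (-1) * E d"] lf_cmult[of E "-1"] by simp

lemma lf_sum: "(\<And>i. i \<in> I \<Longrightarrow> lf (D i)) \<Longrightarrow> lf (\<lambda>d. \<Sum>i\<in>I. D i d)"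
  by (induction I rule: infinite_finite_induct) (auto intro: lf_add)

lemma cnt_add:
  assumes "lf D" "lf E" "r < R"
  shows "cnt r (\<lambda>d. D d + E d) = cnt r D + cnt r E"
proof -
  let ?S = "{d. abv d \<le> r \<and> D d \<noteq> 0} \<union> {d. abv d \<le> r \<and> E d \<noteq> 0}"
  have S: "finite ?S" using assms lf_finite by blast
  have "cnt r D = (\<Sum>d\<in>?S. D d * wt r d)" "cnt r E = (\<Sum>d\<in>?S. E d * wt r d)"
    "cnt r (\<lambda>d. D d + E d) = (\<Sum>d\<in>?S. (D d + E d) * wt r d)"
    by (rule cnt_eq_sum[OF S]; auto)+
  then show ?thesis by (simp add: distrib_right sum.distrib)
qed

lemma cnt_zero [simp]: "cnt r (\<lambda>d. 0) = 0"
  by (simp add: cnt_def)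

lemma cnt_cmult: "cnt r (\<lambda>d. c * D d) = c * cnt r D"
  by (cases "c = 0") (simp_all add: cnt_def sum_distrib_left mult.assoc)

lemma cnt_diff:
  assumes "lf D" "lf E" "r < R"
  shows "cnt r (\<lambda>d. D d - E d) = cnt r D - cnt r E"
  using cnt_add[OF assms(1) lf_cmult[OF assms(2), of "-1"] assms(3)] cnt_cmult[of r "-1" E] by simp

lemma cnt_sum:
  assumes "\<And>i. i \<in> I \<Longrightarrow> lf (D i)" "r < R"
  shows "cnt r (\<lambda>d. \<Sum>i\<in>I. D i d) = (\<Sum>i\<in>I. cnt r (D i))"
  using assms
proof (induction I rule: infinite_finite_induct)
  case (insert x F)
  then show ?case by (simp add: cnt_add lf_sum)
qed auto

lemma cnt_mono:
  assumes "lf D" "lf E" "\<rho> \<le> r" "r < R" and le: "\<And>d. abv d < R \<Longrightarrow> D d \<le> E d"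
  shows "cnt r D \<le> cnt r E"
proof -
  \<comment> \<open>\<open>D\<close> may be negative and the supports may differ, so the nonnegative
    difference is counted instead of comparing two sums.\<close>
  have "cnt r (\<lambda>d. E d - D d) \<ge> 0"
    unfolding cnt_def using assms by (intro sum_nonneg mult_nonneg_nonneg wt_nonneg) auto
  then show ?thesis using assms by (simp add: cnt_diff)
qed

lemma cnt_nonneg: "(\<And>d. abv d < R \<Longrightarrow> 0 \<le> D d) \<Longrightarrow> \<rho> \<le> r \<Longrightarrow> r < R \<Longrightarrow> 0 \<le> cnt r D"
  unfolding cnt_def by (intro sum_nonneg mult_nonneg_nonneg wt_nonneg) auto

lemma cnt_mono_r:
  assumes "lf D" "\<And>d. abv d < R \<Longrightarrow> 0 \<le> D d" "\<rho> \<le> r" "r \<le> s" "s < R"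
  shows "cnt r D \<le> cnt s D"
proof -
  have "cnt r D \<le> (\<Sum>d | abv d \<le> r \<and> D d \<noteq> 0. D d * wt s d)"
    unfolding cnt_def using assms rho_pos by (intro sum_mono mult_left_mono) (auto simp: wt_def)
  also have "\<dots> \<le> cnt s D"
    unfolding cnt_def using assms by (intro sum_mono2 lf_finite mult_nonneg_nonneg wt_nonneg) auto
  finally show ?thesis .
qed

lemma ord_lin:
  fixes d e :: "'a::{ultrametric_field, complete_space}"
  assumes "abv d < R"
  shows "ord d (lin e) = (if d = e then 1 else 0)"
proof (cases "d = e")
  case True
  then show ?thesis using ord_eqI[OF assms loc_unit_const[OF assms, of 1], of "lin e" 1] by simp
next
  case False
  have "lin e = fls_const (d - e) + lin d * 1" by (simp add: lin_def flip: fls_minus_const)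
  also have "loc_unit d \<dots>"
    using False loc_ring_const[OF assms, of 1] by (intro loc_unit_add_lin[OF assms] loc_unit_const[OF assms]) auto
  finally show ?thesis using False ord_unit[OF assms] by simp
qed

subsection \<open>Jensen formula\<close>

text \<open>Finiteness of the divisor is part of the predicate because it is proved along the same
  factorization; \<open>lf_ord\<close> extracts it.\<close>

definition jensen :: "real \<Rightarrow> 'a::ultrametric_field fls \<Rightarrow> bool" where
  "jensen r h \<longleftrightarrow> h \<in> mer \<and> h \<noteq> 0 \<and> finite {d. abv d \<le> r \<and> ord d h \<noteq> 0} \<and>
     (\<Sum>d | abv d \<le> r \<and> ord d h \<noteq> 0. of_int (ord d h) * wt r d) = ln (gm r h) - ln (gm \<rho> h)"

context
  fixes r :: real
  assumes r: "\<rho> \<le> r" "r < R"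
begin

lemma radius_pos: "0 < r" using r rho_pos by simp

lemma jensen_mult:
  fixes g h :: "'a::{ultrametric_field, complete_space} fls"
  assumes "jensen r g" "jensen r h"
  shows "jensen r (g * h)"
proof -
  have m: "g \<in> mer" "h \<in> mer" "g \<noteq> 0" "h \<noteq> 0" using assms by (auto simp: jensen_def)
  let ?S = "{d. abv d \<le> r \<and> ord d g \<noteq> 0} \<union> {d. abv d \<le> r \<and> ord d h \<noteq> 0}"
  have S: "finite ?S" using assms by (simp add: jensen_def)
  have o: "ord d (g * h) = ord d g + ord d h" if "abv d \<le> r" for d
    using ord_mult[of d g h] that r m by simp
  have sub: "{d. abv d \<le> r \<and> ord d (g * h) \<noteq> 0} \<subseteq> ?S" using o by auto
  have "(\<Sum>d | abv d \<le> r \<and> ord d (g * h) \<noteq> 0. of_int (ord d (g * h)) * wt r d)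
    = (\<Sum>d\<in>?S. of_int (ord d (g * h)) * wt r d)"
    using S sub by (intro sum.mono_neutral_left) auto
  also have "\<dots> = (\<Sum>d\<in>?S. of_int (ord d g) * wt r d + of_int (ord d h) * wt r d)"
    using o by (intro sum.cong) (auto simp: distrib_right)
  also have "\<dots> = (\<Sum>d\<in>?S. of_int (ord d g) * wt r d) + (\<Sum>d\<in>?S. of_int (ord d h) * wt r d)"
    by (rule sum.distrib)
  also have "(\<Sum>d\<in>?S. of_int (ord d g) * wt r d) = (\<Sum>d | abv d \<le> r \<and> ord d g \<noteq> 0. of_int (ord d g) * wt r d)"
    using S by (intro sum.mono_neutral_right) auto
  also have "(\<Sum>d\<in>?S. of_int (ord d h) * wt r d) = (\<Sum>d | abv d \<le> r \<and> ord d h \<noteq> 0. of_int (ord d h) * wt r d)"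
    using S by (intro sum.mono_neutral_right) auto
  finally have "(\<Sum>d | abv d \<le> r \<and> ord d (g * h) \<noteq> 0. of_int (ord d (g * h)) * wt r d)
    = (ln (gm r g) - ln (gm \<rho> g)) + (ln (gm r h) - ln (gm \<rho> h))"
    using assms by (simp add: jensen_def)
  moreover have "ln (gm s (g * h)) = ln (gm s g) + ln (gm s h)" if "0 < s" "s < R" for s
    using gm_mult[OF that m(1,2)] gm_pos[OF that m(1,3)] gm_pos[OF that m(2,4)] by (simp add: ln_mult)
  ultimately show ?thesis
    unfolding jensen_def using m mer_mult finite_subset[OF sub S] r radius_pos rho_pos rho_less by simp
qed

lemma jensen_inverse:
  fixes h :: "'a::{ultrametric_field, complete_space} fls"
  assumes "jensen r h"
  shows "jensen r (inverse h)"
proof -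
  have m: "h \<in> mer" "h \<noteq> 0" using assms by (auto simp: jensen_def)
  have o: "ord d (inverse h) = - ord d h" if "abv d \<le> r" for d
    using ord_inverse[of d h] that r m by simp
  have S: "{d. abv d \<le> r \<and> ord d (inverse h) \<noteq> 0} = {d. abv d \<le> r \<and> ord d h \<noteq> 0}" using o by auto
  have "(\<Sum>d | abv d \<le> r \<and> ord d (inverse h) \<noteq> 0. of_int (ord d (inverse h)) * wt r d)
    = - (\<Sum>d | abv d \<le> r \<and> ord d h \<noteq> 0. of_int (ord d h) * wt r d)"
    unfolding S using o by (simp add: sum_negf[symmetric])
  moreover have "ln (gm s (inverse h)) = - ln (gm s h)" if "0 < s" "s < R" for s
  proof -
    have "gm s (inverse h) = 1 / gm s h"
      using gm_divide[OF that mer_1 m] gm_const[OF that, of "1::'a"] by (simp add: divide_inverse)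
    then show ?thesis using gm_pos[OF that m] by (simp add: ln_div)
  qed
  ultimately show ?thesis using assms S m r radius_pos rho_pos rho_less
    unfolding jensen_def by (simp add: mer_inverse)
qed

text \<open>The Gauss norm of \<open>lin e\<close> at radius \<open>s\<close> is
  \<open>max s (abv e)\<close>, so its logarithm grows from \<open>\<rho>\<close> to
  \<open>r\<close> by exactly \<open>wt r e\<close>. This is the reason for the maximum in
  \<open>wt\<close>.\<close>

lemma jensen_lin:
  fixes e :: "'a::{ultrametric_field, complete_space}"
  assumes "abv e \<le> r"
  shows "jensen r (lin e)"
proof -
  have "{d. abv d \<le> r \<and> ord d (lin e) \<noteq> 0} = {e}" using assms r by (auto simp: ord_lin split: if_splits)
  then show ?thesis using assms r radius_pos rho_pos rho_less
    by (simp add: jensen_def ord_lin gm_lin wt_def max.commute max.absorb1)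
qed

lemma ord_gauss_dom_0:
  fixes u :: "'a::{ultrametric_field, complete_space} fps"
  assumes "u \<in> anal" "gauss_dom r u 0" "abv d \<le> r"
  shows "ord d (fps_to_fls u) = 0"
proof -
  have d: "abv d < R" using assms r by simp
  have "ev d u \<noteq> 0"
  proof
    assume "ev d u = 0"
    then have eq: "u = (fps_X - fps_const d) * quo d u" using ev_quo[OF assms(1) d] by simp
    have "u \<noteq> 0" using assms(2) by (auto simp: gauss_dom_def)
    then have "quo d u \<noteq> 0" using eq by (metis mult_zero_right)
    then obtain j where j: "gauss_dom r (quo d u) j" using ex_dom[OF anal_quo[OF assms(1) d]] r radius_pos by blast
    have "gauss_dom r ((fps_X - fps_const d) * quo d u) (1 + j)"
      using gauss_dom_mult[OF gauss_dom_lin[of r d] j] radius_pos assms(3) by simp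
    then have "gauss_dom r u (1 + j)" using eq by simp
    from gauss_dom_unique[OF assms(2) this] show False by simp
  qed
  then have "loc_unit d (fps_to_fls u)"
    unfolding loc_unit_def using assms(1) ev_1[OF d] by (intro bexI[of _ u] bexI[of _ 1]) auto
  then show ?thesis by (rule ord_unit[OF d])
qed

text \<open>The constant term dominates at every smaller radius too, so the Gauss norm is constant
  up to \<open>r\<close> and there is nothing to count.\<close>

lemma jensen_unit:
  fixes u :: "'a::{ultrametric_field, complete_space} fps"
  assumes u: "u \<in> anal" "gauss_dom r u 0"
  shows "jensen r (fps_to_fls u)"
proof -
  have "gm s (fps_to_fls u) = abv (fps_nth u 0)" if "0 < s" "s \<le> r" for s
    using gm_anal[of s u] gauss_dom_eq[OF gauss_dom_0_mono[OF u(2) that]] that r u by simp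
  moreover have "u \<noteq> 0" using u(2) by (auto simp: gauss_dom_def)
  ultimately show ?thesis
    using r radius_pos rho_pos by (simp add: jensen_def mer_anal u ord_gauss_dom_0[OF u] cong: conj_cong)
qed

lemma jensen_prod_lin:
  fixes A :: "'a::{ultrametric_field, complete_space} multiset"
  assumes "\<forall>x\<in>#A. abv x \<le> r"
  shows "jensen r (fps_to_fls (\<Prod>x\<in>#A. fps_X - fps_const x))"
  using assms
proof (induction A)
  case empty
  have "gauss_dom r (1 :: 'a fps) 0" using gauss_dom_const[of "1::'a" r] radius_pos by simp
  then show ?case using jensen_unit[of 1] by simp
next
  case (add x A)
  then show ?case using jensen_mult[OF jensen_lin[of x]] by (simp add: fls_times_fps_to_fls lin_fps)
qed

lemma jensen_mer:
  fixes h :: "'a::{ultrametric_field, complete_space, alg_closed_field} fls"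
  assumes "h \<in> mer" "h \<noteq> 0"
  shows "jensen r h"
proof -
  have an: "jensen r (fps_to_fls F)" if F: "F \<in> anal" "F \<noteq> 0" for F :: "'a fps"
  proof -
    obtain A u where "u \<in> anal" "gauss_dom r u 0" "\<forall>x\<in>#A. abv x \<le> r"
      and F: "F = (\<Prod>x\<in>#A. fps_X - fps_const x) * u"
      using zeros_factorization[OF radius_pos r(2) F] by blast
    then show ?thesis unfolding F fls_times_fps_to_fls
      by (intro jensen_mult jensen_prod_lin jensen_unit)
  qed
  obtain F G where 1: "F \<in> anal" "G \<in> anal" "G \<noteq> 0" "h = fps_to_fls F / fps_to_fls G" using assms merE by blast
  then have "F \<noteq> 0" using assms by auto
  then show ?thesis unfolding 1(4) divide_inverse using 1 an by (intro jensen_mult jensen_inverse)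
qed

end

lemma lf_ord:
  fixes h :: "'a::{ultrametric_field, complete_space, alg_closed_field} fls"
  assumes "h \<in> mer" "h \<noteq> 0"
  shows "lf (\<lambda>d. of_int (ord d h))"
  unfolding lf_def
proof (intro allI impI)
  fix r assume "r < R"
  then have "jensen (max r \<rho>) h" using assms rho_less by (intro jensen_mer) auto
  then have "finite {d. abv d \<le> max r \<rho> \<and> ord d h \<noteq> 0}" by (simp add: jensen_def)
  then show "finite {d. abv d \<le> r \<and> real_of_int (ord d h) \<noteq> 0}" by (rule finite_subset[rotated]) auto
qed

lemma jensen_formula:
  fixes h :: "'a::{ultrametric_field, complete_space, alg_closed_field} fls"
  assumes "h \<in> mer" "h \<noteq> 0" "\<rho> \<le> r" "r < R"
  shows "cnt r (\<lambda>d. of_int (ord d h)) = ln (gm r h) - ln (gm \<rho> h)"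
  using jensen_mer[OF assms(3,4,1,2)] by (simp add: jensen_def cnt_def)

section \<open>Characteristic function\<close>

text \<open>The divisors \<open>zp\<close> of zeros and \<open>pl\<close> of poles. Below, \<open>pb\<close> counts poles without
  multiplicity, and \<open>z2\<close> counts zeros and poles with multiplicity truncated at \<open>2\<close>.\<close>

definition zp :: "'a::ultrametric_field fls \<Rightarrow> 'a \<Rightarrow> real" where
  "zp h d = of_int (max 0 (ord d h))"

definition pl :: "'a::ultrametric_field fls \<Rightarrow> 'a \<Rightarrow> real" where
  "pl h d = of_int (max 0 (- ord d h))"

definition psi :: "real \<Rightarrow> 'a::ultrametric_field fls \<Rightarrow> real" where
  "psi r h = ln (gm r h)"

text \<open>By Jensen's formula this is, up to a bounded function, the count of poles plus
  \<open>max 0 (psi r h)\<close>, that is, the usual sum of counting and proximity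
  functions.\<close>

definition T :: "real \<Rightarrow> 'a::ultrametric_field fls \<Rightarrow> real" where
  "T r h = max (cnt r (zp h)) (cnt r (pl h))"

text \<open>Inequality up to \<open>O(1)\<close>. The constant is uniform as the radius approaches
  \<open>R\<close>, where the growth takes place.\<close>

definition bdle :: "(real \<Rightarrow> real) \<Rightarrow> (real \<Rightarrow> real) \<Rightarrow> bool" (infix "\<preceq>" 50) where
  "X \<preceq> Y \<longleftrightarrow> (\<exists>C. \<forall>r. \<rho> \<le> r \<longrightarrow> r < R \<longrightarrow> X r \<le> Y r + C)"

lemma bdleI: "(\<And>r. \<rho> \<le> r \<Longrightarrow> r < R \<Longrightarrow> X r \<le> Y r + C) \<Longrightarrow> X \<preceq> Y"
  unfolding bdle_def by blast

lemma bdleE: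
  assumes "X \<preceq> Y"
  obtains C where "\<And>r. \<rho> \<le> r \<Longrightarrow> r < R \<Longrightarrow> X r \<le> Y r + C"
  using assms unfolding bdle_def by blast

lemma bdle_le: "(\<And>r. \<rho> \<le> r \<Longrightarrow> r < R \<Longrightarrow> X r \<le> Y r) \<Longrightarrow> X \<preceq> Y"
  by (rule bdleI[where C = 0]) simp

lemma bdle_trans [trans]:
  assumes "X \<preceq> Y" "Y \<preceq> Z"
  shows "X \<preceq> Z"
proof -
  obtain C where C: "\<And>r. \<rho> \<le> r \<Longrightarrow> r < R \<Longrightarrow> X r \<le> Y r + C" using assms bdleE by blast
  obtain C' where C': "\<And>r. \<rho> \<le> r \<Longrightarrow> r < R \<Longrightarrow> Y r \<le> Z r + C'" using assms bdleE by blast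
  show ?thesis
    by (rule bdleI[where C = "C + C'"]) (use C C' in fastforce)
qed

lemma bdle_add:
  assumes "X \<preceq> Y" "X' \<preceq> Y'"
  shows "(\<lambda>r. X r + X' r) \<preceq> (\<lambda>r. Y r + Y' r)"
proof -
  obtain C where C: "\<And>r. \<rho> \<le> r \<Longrightarrow> r < R \<Longrightarrow> X r \<le> Y r + C" using assms bdleE by blast
  obtain C' where C': "\<And>r. \<rho> \<le> r \<Longrightarrow> r < R \<Longrightarrow> X' r \<le> Y' r + C'" using assms bdleE by blast
  show ?thesis
    by (rule bdleI[where C = "C + C'"]) (use C C' in fastforce)
qed

lemma bdle_cmult:
  assumes "X \<preceq> Y" "0 \<le> c"
  shows "(\<lambda>r. c * X r) \<preceq> (\<lambda>r. c * Y r)"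
proof -
  obtain C where C: "\<And>r. \<rho> \<le> r \<Longrightarrow> r < R \<Longrightarrow> X r \<le> Y r + C" using assms bdleE by blast
  show ?thesis
    by (rule bdleI[where C = "c * C"]) (use C assms in \<open>auto simp flip: distrib_left intro!: mult_left_mono\<close>)
qed

lemma bdle_sum:
  assumes "\<And>i. i \<in> I \<Longrightarrow> X i \<preceq> Y i"
  shows "(\<lambda>r. \<Sum>i\<in>I. X i r) \<preceq> (\<lambda>r. \<Sum>i\<in>I. Y i r)"
  using assms
  by (induction I rule: infinite_finite_induct) (auto intro: bdle_add bdle_le)

lemma zp_nonneg [simp]: "0 \<le> zp h d" and pl_nonneg [simp]: "0 \<le> pl h d"
  by (simp_all add: zp_def pl_def)

lemma T_zp: "cnt r (zp h) \<le> T r h" and T_pl: "cnt r (pl h) \<le> T r h"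
  by (simp_all add: T_def)

section \<open>First main theorem: counting and proximity functions\<close>

context
  fixes h :: "'a::{ultrametric_field, complete_space, alg_closed_field} fls"
  assumes h: "h \<in> mer" "h \<noteq> 0"
begin

lemma lf_zp: "lf (zp h)" and lf_pl: "lf (pl h)"
  by (rule lf_subset[OF lf_ord[OF h]]; simp add: zp_def pl_def)+

lemma zp_minus_pl: "zp h d - pl h d = of_int (ord d h)"
  by (simp add: zp_def pl_def max_def)

lemma cnt_zp_pl: "\<rho> \<le> r \<Longrightarrow> r < R \<Longrightarrow> cnt r (zp h) - cnt r (pl h) = psi r h - psi \<rho> h"
  using jensen_formula[OF h, of r] cnt_diff[OF lf_zp lf_pl, of r] by (simp add: zp_minus_pl psi_def)

lemma T_nonneg: "\<rho> \<le> r \<Longrightarrow> r < R \<Longrightarrow> 0 \<le> T r h"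
  using T_zp[of r h] cnt_nonneg[of "zp h" r] by (simp add: zp_def)

lemma T_mono: "\<rho> \<le> r \<Longrightarrow> r \<le> s \<Longrightarrow> s < R \<Longrightarrow> T r h \<le> T s h"
  unfolding T_def by (intro max.mono cnt_mono_r lf_zp lf_pl) auto

lemma T_le_pl: "(\<lambda>r. T r h) \<preceq> (\<lambda>r. cnt r (pl h) + max 0 (psi r h))"
  by (rule bdleI[where C = "\<bar>psi \<rho> h\<bar>"]) (use cnt_zp_pl in \<open>fastforce simp: T_def\<close>)

lemma pl_le_T: "(\<lambda>r. cnt r (pl h) + max 0 (psi r h)) \<preceq> (\<lambda>r. T r h)"
  by (rule bdleI[where C = "\<bar>psi \<rho> h\<bar>"]) (use cnt_zp_pl in \<open>fastforce simp: T_def\<close>)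

lemma T_le_zp: "(\<lambda>r. T r h) \<preceq> (\<lambda>r. cnt r (zp h) + max 0 (- psi r h))"
  by (rule bdleI[where C = "\<bar>psi \<rho> h\<bar>"]) (use cnt_zp_pl in \<open>fastforce simp: T_def\<close>)

lemma zp_le_T: "(\<lambda>r. cnt r (zp h) + max 0 (- psi r h)) \<preceq> (\<lambda>r. T r h)"
  by (rule bdleI[where C = "\<bar>psi \<rho> h\<bar>"]) (use cnt_zp_pl in \<open>fastforce simp: T_def\<close>)

end

end

section \<open>Functions with bounded characteristic\<close>

text \<open>The factors are congruent to \<open>1\<close> modulo growing powers of \<open>X\<close>, so that the infinite
  product converges coefficientwise.\<close>

lemma fps_prod_limit:
  fixes W :: "nat \<Rightarrow> 'a::comm_ring_1 fps"
  assumes W: "\<And>j n. n \<le> j \<Longrightarrow> fps_nth (W j) n = (if n = 0 then 1 else 0)"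
  shows "\<exists>L. \<forall>m n. n \<le> m \<longrightarrow> fps_nth (\<Prod>j<m. W j) n = fps_nth L n"
proof -
  have st: "fps_nth (\<Prod>j<n + k. W j) n = fps_nth (\<Prod>j<n. W j) n" for n k
  proof (induction k)
    case (Suc k)
    have "fps_nth (\<Prod>j<n + Suc k. W j) n = (\<Sum>i=0..n. fps_nth (\<Prod>j<n + k. W j) i * fps_nth (W (n + k)) (n - i))"
      by (simp add: fps_mult_nth)
    also have "\<dots> = (\<Sum>i=0..n. if i = n then fps_nth (\<Prod>j<n + k. W j) i else 0)"
      by (intro sum.cong) (auto simp: W)
    finally show ?case using Suc by simp
  qed simp
  show ?thesis
  proof (intro exI[of _ "Abs_fps (\<lambda>n. fps_nth (\<Prod>j<n. W j) n)"] allI impI)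
    fix m n :: nat assume "n \<le> m"
    then show "fps_nth (\<Prod>j<m. W j) n = fps_nth (Abs_fps (\<lambda>n. fps_nth (\<Prod>j<n. W j) n)) n"
      using st[of n "m - n"] by simp
  qed
qed

text \<open>Lets the factor with a prescribed zero be isolated in the infinite product; the
  remaining tail is a limit of the same kind.\<close>

lemma fps_prod_limit_split:
  fixes W :: "nat \<Rightarrow> 'a::comm_ring_1 fps"
  assumes L: "\<And>m n. n \<le> m \<Longrightarrow> fps_nth (\<Prod>j<m. W j) n = fps_nth L n"
    and L': "\<And>m n. n \<le> m \<Longrightarrow> fps_nth (\<Prod>j<m. W (k + j)) n = fps_nth L' n"
  shows "L = (\<Prod>j<k. W j) * L'"
proof (rule fps_ext)
  fix n
  have "fps_nth L n = fps_nth (\<Prod>j<k + n. W j) n" by (simp add: L)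
  also have "(\<Prod>j<k + n. W j) = (\<Prod>j<k. W j) * (\<Prod>j<n. W (k + j))"
    by (induction n) (simp_all add: mult.assoc)
  also have "fps_nth \<dots> n = fps_nth ((\<Prod>j<k. W j) * L') n"
    unfolding fps_mult_nth by (intro sum.cong) (simp_all add: L')
  finally show "fps_nth L n = fps_nth ((\<Prod>j<k. W j) * L') n" .
qed

lemma prod_lin_nz: "(\<Prod>x\<in>#A. fps_X - fps_const x :: 'a::field fps) \<noteq> 0"
proof (induction A)
  case (add x A)
  have "fps_X - fps_const x \<noteq> 0" using lin_nz[of x] unfolding lin_fps by fastforce
  then show ?case using add by simp
qed simp

section \<open>Bounded analytic functions, and meromorphic functions without poles\<close>

context disc
begin

definition analb :: "'a::ultrametric_field fps set" where
  "analb = {F \<in> anal. bdd_above (range (\<lambda>n. abv (fps_nth F n) * R ^ n))}"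

text \<open>The bound is explicit because the infinite product below needs one that does not depend
  on the number of factors.\<close>

definition bnd :: "'a::ultrametric_field fps \<Rightarrow> real \<Rightarrow> bool" where
  "bnd F B \<longleftrightarrow> (\<forall>n. abv (fps_nth F n) * R ^ n \<le> B)"

lemma bnd_nonneg: "bnd F B \<Longrightarrow> 0 \<le> B"
  unfolding bnd_def using order_trans[OF abv_nonneg, of "fps_nth F 0" B] by (metis mult.right_neutral power_0)

lemma bnd_gauss: "bnd F B \<Longrightarrow> 0 < r \<Longrightarrow> r \<le> R \<Longrightarrow> gauss r F \<le> B"
proof (rule gauss_least)
  fix n assume "bnd F B" "0 < r" "r \<le> R"
  then have "abv (fps_nth F n) * r ^ n \<le> abv (fps_nth F n) * R ^ n" by (intro mult_left_mono power_mono) auto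
  then show "abv (fps_nth F n) * r ^ n \<le> B" using \<open>bnd F B\<close> unfolding bnd_def by (metis order_trans)
qed

lemma bnd_analb:
  assumes "bnd F B"
  shows "F \<in> analb"
proof -
  have "F \<in> anal"
  proof (rule analI)
    fix r :: real assume r: "0 < r" "r < R"
    have "abv (fps_nth F n) * r ^ n \<le> B" for n
    proof -
      have "abv (fps_nth F n) * r ^ n \<le> abv (fps_nth F n) * R ^ n" using r by (intro mult_left_mono power_mono) auto
      then show ?thesis using assms unfolding bnd_def by (metis order_trans)
    qed
    then show "\<exists>B. \<forall>n. abv (fps_nth F n) * r ^ n \<le> B" by blast
  qed
  then show ?thesis using assms by (auto simp: analb_def bnd_def bdd_above_def)
qed

lemma bnd_mult:
  assumes "bnd F A" "bnd G B"
  shows "bnd (F * G) (A * B)"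
  unfolding bnd_def
proof
  fix n
  have nn: "0 \<le> A" "0 \<le> B" using assms bnd_nonneg by auto
  have "abv (fps_nth (F * G) n) \<le> A * B / R ^ n"
    unfolding fps_mult_nth
  proof (rule abv_sum_le)
    fix i assume i: "i \<in> {0..n}"
    have "abv (fps_nth F i * fps_nth G (n - i)) * R ^ n
        = (abv (fps_nth F i) * R ^ i) * (abv (fps_nth G (n - i)) * R ^ (n - i))"
      using i by (simp add: abv_mult mult_ac flip: power_add)
    also have "\<dots> \<le> A * B" using assms R_pos nn by (intro mult_mono) (auto simp: bnd_def)
    finally show "abv (fps_nth F i * fps_nth G (n - i)) \<le> A * B / R ^ n"
      using R_pos by (simp add: pos_le_divide_eq)
  qed (use nn R_pos in auto)
  then show "abv (fps_nth (F * G) n) * R ^ n \<le> A * B"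
    using R_pos by (simp add: pos_le_divide_eq)
qed

lemma bnd_one: "bnd 1 1"
  by (simp add: bnd_def)

lemma bnd_power: "bnd F A \<Longrightarrow> bnd (F ^ n) (A ^ n)"
  by (induction n) (auto intro: bnd_one bnd_mult)

lemma bnd_prod: "(\<And>i. i \<in> I \<Longrightarrow> bnd (F i) (A i)) \<Longrightarrow> bnd (prod F I) (prod A I)"
  by (induction I rule: infinite_finite_induct) (auto intro: bnd_one bnd_mult)

lemma bnd_lin: "abv d \<le> R \<Longrightarrow> bnd (fps_X - fps_const d) R"
  using R_pos by (auto simp: bnd_def fps_X_def)

lemma ord_fps_to_fls_ge_1:
  fixes d :: "'a::{ultrametric_field, complete_space}"
  assumes d: "abv d < R" and F: "F \<in> anal" "F \<noteq> 0" "ev d F = 0"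
  shows "1 \<le> ord d (fps_to_fls F)"
proof -
  have q: "quo d F \<in> anal" using anal_quo F d by blast
  have eq: "F = (fps_X - fps_const d) * quo d F" using ev_quo[OF F(1) d] F by simp
  have "quo d F \<noteq> 0" using eq F(2) by (metis mult_zero_right)
  then have "ord d (lin d * fps_to_fls (quo d F)) = ord d (lin d) + ord d (fps_to_fls (quo d F))"
    using q by (intro ord_mult[OF d]) (auto intro: mer_anal)
  also have "\<dots> \<ge> 1"
    using ord_loc_ring[OF d loc_ring_anal[OF d q]] \<open>quo d F \<noteq> 0\<close> ord_lin[OF d, of d] by simp
  also have "lin d * fps_to_fls (quo d F) = fps_to_fls F"
    by (subst eq) (simp only: lin_fps fls_times_fps_to_fls)
  finally show ?thesis .
qed

text \<open>The order condition refers to the whole product, so it forces \<open>F\<close> to vanish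
  at the point split off. Dividing numerator and denominator by that factor leaves their quotient
  unchanged, which carries the condition through the induction.\<close>

lemma anal_divide_lin:
  fixes F :: "'a::{ultrametric_field, complete_space} fps"
  assumes "F \<in> anal" "F \<noteq> 0" "\<forall>x\<in>#A. abv x < R"
    "\<And>d. d \<in># A \<Longrightarrow> 0 \<le> ord d (fps_to_fls F / fps_to_fls (\<Prod>x\<in>#A. fps_X - fps_const x))"
  shows "\<exists>H\<in>anal. F = (\<Prod>x\<in>#A. fps_X - fps_const x) * H"
  using assms
proof (induction A arbitrary: F)
  case (add x A)
  let ?P = "\<Prod>x\<in>#A. fps_X - fps_const x"
  have x: "abv x < R" using add.prems by simp
  have P0: "?P \<noteq> 0" by (rule prod_lin_nz)
  have mult: "fps_to_fls (\<Prod>x\<in>#add_mset x A. fps_X - fps_const x) = lin x * fps_to_fls ?P"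
    by (simp add: fls_times_fps_to_fls lin_fps)
  have "ev x F = 0"
  proof (rule ccontr)
    assume "ev x F \<noteq> 0"
    then have "loc_unit x (fps_to_fls F)"
      unfolding loc_unit_def using add.prems(1) ev_1[OF x] by (intro bexI[of _ F] bexI[of _ 1]) auto
    then have "ord x (fps_to_fls F) = 0" by (rule ord_unit[OF x])
    moreover have "ord x (fps_to_fls F / (lin x * fps_to_fls ?P)) =
        ord x (fps_to_fls F) - (1 + ord x (fps_to_fls ?P))"
      using add.prems P0 ord_lin[OF x, of x]
      by (simp add: ord_divide[OF x] ord_mult[OF x] mer_anal mer_mult)
    moreover have "0 \<le> ord x (fps_to_fls ?P)" using P0 by (intro ord_loc_ring[OF x] loc_ring_anal[OF x]) auto
    ultimately show False using add.prems(4)[of x] unfolding mult by simp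
  qed
  then have eq: "F = (fps_X - fps_const x) * quo x F" using ev_quo[OF add.prems(1) x] by simp
  have q: "quo x F \<in> anal" "quo x F \<noteq> 0" using anal_quo[OF add.prems(1) x] eq add.prems(2) by (blast, metis mult_zero_right)
  have "fps_to_fls F / (lin x * fps_to_fls ?P) = fps_to_fls (quo x F) / fps_to_fls ?P"
    by (subst eq) (simp add: fls_times_fps_to_fls lin_fps del: fps_to_fls_minus)
  then have "\<And>d. d \<in># A \<Longrightarrow> 0 \<le> ord d (fps_to_fls (quo x F) / fps_to_fls ?P)"
    using add.prems(4) unfolding mult by simp
  then obtain H where "H \<in> anal" "quo x F = ?P * H" using add.IH[of "quo x F"] q add.prems by auto
  then show ?case using eq by (intro bexI[of _ H]) (simp_all add: mult.assoc)
qed simp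

text \<open>Regularity at 0 makes the formal quotient \<open>H\<close> of \<open>F\<close> by
  \<open>G\<close> a power series, and only its growth has to be bounded. At each radius the zeros
  of \<open>G\<close> divide \<open>F\<close>, which leaves \<open>H * u = F2\<close> with
  \<open>u\<close> dominated by its constant term.\<close>

lemma mer_analytic:
  fixes h :: "'a::{ultrametric_field, complete_space, alg_closed_field} fls"
  assumes h: "h \<in> mer" "h \<noteq> 0" and pos: "\<And>d. abv d < R \<Longrightarrow> 0 \<le> ord d h"
  shows "\<exists>H\<in>anal. h = fps_to_fls H"
proof -
  have z: "abv (0::'a) < R" using R_pos by simp
  have "loc_ring 0 h" using loc_ringI[OF z h(1)] pos[OF z] by blast
  then obtain F G where FG: "F \<in> anal" "G \<in> anal" "ev 0 G \<noteq> 0" and hFG: "h = fps_to_fls F / fps_to_fls G"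
    unfolding loc_ring_def by blast
  have G0: "fps_nth G 0 \<noteq> 0"
  proof
    assume "fps_nth G 0 = 0"
    then have "fps_nth G n * 0 ^ n = 0" for n by (cases n) auto
    then have "ev 0 G = (\<Sum>n. 0)" unfolding ev_def by presburger
    then show False using FG(3) by simp
  qed
  then have Gnz: "G \<noteq> 0" by auto
  have Fnz: "F \<noteq> 0" using h hFG by auto
  define H where "H = F * inverse G"
  have "fps_to_fls H * fps_to_fls G = fps_to_fls F"
    using G0 by (simp add: H_def mult.assoc inverse_mult_eq_1 flip: fls_times_fps_to_fls)
  then have hH: "h = fps_to_fls H"
    unfolding hFG using Gnz by (metis nonzero_mult_div_cancel_right fps_to_fls_eq_0_iff)
  have HG: "H * G = F" using \<open>fps_to_fls H * fps_to_fls G = fps_to_fls F\<close> by (simp flip: fls_times_fps_to_fls)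
  have "H \<in> anal"
  proof (rule analI)
    fix r :: real assume r: "0 < r" "r < R"
    define s where "s = max r \<rho>"
    have s: "\<rho> \<le> s" "s < R" "0 < s" "r \<le> s" using r rho_less rho_pos by (auto simp: s_def)
    obtain A u where u: "u \<in> anal" "gauss_dom s u 0" and A: "\<forall>x\<in>#A. abv x \<le> s"
      and Geq: "G = (\<Prod>x\<in>#A. fps_X - fps_const x) * u"
      using zeros_factorization[OF s(3,2) FG(2) Gnz] by blast
    let ?P = "\<Prod>x\<in>#A. fps_X - fps_const x"
    have nz: "?P \<noteq> 0" "u \<noteq> 0" using Gnz Geq by auto
    have "0 \<le> ord d (fps_to_fls F / fps_to_fls ?P)" if "d \<in># A" for d
    proof -
      have ds: "abv d \<le> s" and d: "abv d < R" using that A s by auto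
      have "fps_to_fls F / fps_to_fls ?P = h * fps_to_fls u"
        using nz by (simp add: hFG Geq fls_times_fps_to_fls)
      moreover have "ord d (h * fps_to_fls u) = ord d h"
        using ord_mult[OF d h(1) mer_anal[OF u(1)]] h nz ord_gauss_dom_0[OF s(1,2) u ds] by simp
      ultimately show ?thesis using pos[OF d] by simp
    qed
    then obtain F2 where F2: "F2 \<in> anal" "F = ?P * F2"
      using anal_divide_lin[OF FG(1) Fnz, of A] A s by fastforce
    have Hu: "H * u = F2"
    proof -
      have "?P * (H * u) = ?P * F2" using HG F2(2) Geq by (simp add: mult_ac)
      then show ?thesis using nz by simp
    qed
    obtain B where B: "0 \<le> B" "\<And>n. abv (fps_nth F2 n) * s ^ n \<le> B" using anal_bound[OF F2(1) s(3,2)] by blast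
    define c where "c = abv (fps_nth u 0)"
    have c: "c > 0" "\<And>n. abv (fps_nth u n) * s ^ n \<le> c" using u(2) by (auto simp: gauss_dom_def c_def)
    \<comment> \<open>No weighted coefficient of \<open>u\<close> exceeds the constant term, so the
      recursion for the coefficients of \<open>H\<close> never amplifies the bound.\<close>
    have main: "abv (fps_nth H n) * s ^ n \<le> B / c" for n
    proof (induction n rule: less_induct)
      case (less n)
      have "fps_nth F2 n = (\<Sum>i=0..n. fps_nth H i * fps_nth u (n - i))"
        using Hu by (simp add: fps_mult_nth flip: Hu)
      also have "\<dots> = (\<Sum>i\<in>{0..<n}. fps_nth H i * fps_nth u (n - i)) + fps_nth H n * fps_nth u 0"
        by (simp add: atLeastLessThanSuc_atLeastAtMost[symmetric] del: atLeastLessThanSuc_atLeastAtMost)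
      finally have eq: "fps_nth H n * fps_nth u 0 = fps_nth F2 n - (\<Sum>i\<in>{0..<n}. fps_nth H i * fps_nth u (n - i))"
        by simp
      have "abv (\<Sum>i\<in>{0..<n}. fps_nth H i * fps_nth u (n - i)) \<le> B / s ^ n"
      proof (rule abv_sum_le)
        fix i assume i: "i \<in> {0..<n}"
        have "abv (fps_nth H i * fps_nth u (n - i)) * s ^ n
            = (abv (fps_nth H i) * s ^ i) * (abv (fps_nth u (n - i)) * s ^ (n - i))"
          using i by (simp add: abv_mult mult_ac flip: power_add)
        also have "\<dots> \<le> B / c * c" using less i c s B by (intro mult_mono) auto
        finally show "abv (fps_nth H i * fps_nth u (n - i)) \<le> B / s ^ n"
          using s c by (simp add: pos_le_divide_eq)
      qed (use B s in auto)
      moreover have "abv (fps_nth F2 n) \<le> B / s ^ n" using B(2)[of n] s by (simp add: pos_le_divide_eq)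
      ultimately have "abv (fps_nth H n * fps_nth u 0) \<le> B / s ^ n"
        unfolding eq using abv_diff_le order_trans max.boundedI by blast
      then have "abv (fps_nth H n) * c \<le> B / s ^ n" by (simp add: abv_mult c_def)
      then show ?case using s c by (simp add: pos_le_divide_eq mult_ac)
    qed
    have "abv (fps_nth H n) * r ^ n \<le> B / c" for n
    proof -
      have "abv (fps_nth H n) * r ^ n \<le> abv (fps_nth H n) * s ^ n" using s r by (intro mult_left_mono power_mono) auto
      then show ?thesis using main[of n] by linarith
    qed
    then show "\<exists>B. \<forall>n. abv (fps_nth H n) * r ^ n \<le> B" by blast
  qed
  then show ?thesis using hH by blast
qed

end

lemma fps_one_mod_mult:
  fixes F G :: "'a::comm_ring_1 fps"
  assumes "\<And>n. n < N \<Longrightarrow> fps_nth F n = (if n = 0 then 1 else 0)" "\<And>n. n < N \<Longrightarrow> fps_nth G n = (if n = 0 then 1 else 0)" "n < N"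
  shows "fps_nth (F * G) n = (if n = 0 then 1 else 0)"
proof -
  have "fps_nth (F * G) n = (\<Sum>i=0..n. if i = 0 then (if n = 0 then 1 else 0) else 0)"
    unfolding fps_mult_nth by (intro sum.cong) (use assms in auto)
  then show ?thesis by simp
qed

lemma fps_one_mod_power:
  fixes F :: "'a::comm_ring_1 fps"
  assumes "\<And>n. n < N \<Longrightarrow> fps_nth F n = (if n = 0 then 1 else 0)" "n < N"
  shows "fps_nth (F ^ k) n = (if n = 0 then 1 else 0)"
  using assms(2) by (induction k arbitrary: n) (auto intro!: fps_one_mod_mult[where N = N] assms(1) split del: if_split)

lemma fps_one_mod_prod:
  fixes F :: "'b \<Rightarrow> 'a::comm_ring_1 fps"
  assumes "\<And>i n. i \<in> I \<Longrightarrow> n < N \<Longrightarrow> fps_nth (F i) n = (if n = 0 then 1 else 0)" "n < N"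
  shows "fps_nth (prod F I) n = (if n = 0 then 1 else 0)"
  using assms
proof (induction I arbitrary: n rule: infinite_finite_induct)
  case (insert x I)
  have "fps_nth (F x * prod F I) n = (if n = 0 then 1 else 0)"
    by (rule fps_one_mod_mult[where N = N]) (use insert in blast)+
  then show ?case using insert.hyps by simp
qed auto

section \<open>A bounded analytic function with prescribed zeros\<close>

context disc
begin

lemma prod_anal: "(\<And>i. i \<in> I \<Longrightarrow> F i \<in> anal) \<Longrightarrow> prod F I \<in> anal"
  by (induction I rule: infinite_finite_induct) (auto intro: anal_mult)

lemma bnd_anal: "bnd F B \<Longrightarrow> F \<in> anal"
  using bnd_analb by (auto simp: analb_def)

text \<open>The factor \<open>1 - (x / d)\<^sup>N\<close> vanishes at \<open>d\<close>. Large exponents \<open>N\<close> make the product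
  converge even though \<open>\<Sum> (ln R - ln \<bar>d\<bar>) < \<infinity>\<close> does not make \<open>1 - x / d\<close> tend to \<open>1\<close>.\<close>

definition zfac :: "nat \<Rightarrow> 'a::ultrametric_field \<Rightarrow> 'a fps" where
  "zfac N d = 1 - fps_const (inverse d ^ N) * fps_X ^ N"

lemma zfac_nth: "fps_nth (zfac N d) n = (if n = 0 then 1 else 0) - (if n = N then inverse d ^ N else 0)"
  by (simp add: zfac_def)

lemma bnd_zfac:
  fixes d :: "'a::ultrametric_field"
  assumes "d \<noteq> 0" "abv d < R" "N > 0"
  shows "bnd (zfac N d) ((R / abv d) ^ N)"
proof -
  have "1 \<le> (R / abv d) ^ N" using assms by (intro one_le_power) simp
  then show ?thesis
    using assms R_pos by (auto simp: bnd_def zfac_nth abv_power abv_inverse power_divide power_inverse divide_inverse power_mult_distrib mult.commute)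
qed

lemma ev_zfac:
  fixes d :: "'a::{ultrametric_field, complete_space}"
  assumes "d \<noteq> 0" "abv d < R"
  shows "ev d (zfac N d) = 0"
proof -
  have X: "ev d fps_X = d"
    using ev_eqI[of 1 d fps_X d] assms by simp
  have "ev d (zfac N d) = ev d (1 + fps_const (- (inverse d ^ N)) * fps_X ^ N)"
    by (simp add: zfac_def flip: fps_const_neg)
  also have "\<dots> = 1 + (- (inverse d ^ N)) * d ^ N"
    using assms by (simp only: ev_add ev_mult ev_power ev_const ev_1 X anal_1 anal_const anal_X anal_power anal_mult)
  also have "\<dots> = 0" using assms by (simp add: power_inverse)
  finally show ?thesis .
qed

lemma anal_zfac: "zfac N d \<in> anal"
  unfolding zfac_def by (intro anal_diff anal_mult anal_power) auto

text \<open>The points are cut into annuli \<open>Y j\<close> whose masses, measured by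
  \<open>g\<close>, decay like the powers of 1/4. The exponent \<open>2 ^ j\<close> on
  \<open>Y j\<close> makes this block congruent to 1 modulo \<open>X ^ (2 ^ j)\<close>, hence the
  product converges; it also multiplies the logarithmic bound by \<open>2 ^ j\<close>, which the
  decay keeps summable.\<close>

lemma ex_bounded_multiple:
  fixes S :: "'a::{ultrametric_field, complete_space} set" and \<delta> :: "'a \<Rightarrow> nat"
  assumes S: "\<And>d. d \<in> S \<Longrightarrow> \<rho> < abv d \<and> abv d < R"
    and fin: "\<And>r. r < R \<Longrightarrow> finite {d \<in> S. abv d \<le> r}"
    and C: "\<And>X. finite X \<Longrightarrow> X \<subseteq> S \<Longrightarrow> (\<Sum>d\<in>X. real (\<delta> d) * (ln R - ln (abv d))) \<le> C"
  shows "\<exists>L B. bnd L B \<and> L \<noteq> 0 \<and> (\<forall>d\<in>S. int (\<delta> d) \<le> ord d (fps_to_fls L))"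
proof -
  define g where "g d = real (\<delta> d) * (ln R - ln (abv d))" for d
  have Snz: "d \<noteq> 0" if "d \<in> S" for d using S[OF that] rho_pos by auto
  have g: "0 \<le> g d" if "d \<in> S" for d
    using S[OF that] Snz[OF that] R_pos by (auto simp: g_def intro!: mult_nonneg_nonneg)
  define \<F> where "\<F> = {X. finite X \<and> X \<subseteq> S}"
  have bdd: "bdd_above (sum g ` \<F>)" using C by (auto simp: bdd_above_def \<F>_def g_def)
  have ne: "sum g ` \<F> \<noteq> {}" by (auto simp: \<F>_def)
  define s where "s = Sup (sum g ` \<F>)"
  \<comment> \<open>A finite set nearly exhausts the supremum \<open>s\<close> of all masses;
    whatever lies beyond its points has mass at most the defect.\<close>
  have "\<exists>q<R. \<forall>X. finite X \<longrightarrow> X \<subseteq> S \<longrightarrow> (\<forall>d\<in>X. q < abv d) \<longrightarrow> sum g X \<le> (1/4) ^ j" for j :: nat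
  proof -
    have "s - (1/4) ^ j < Sup (sum g ` \<F>)" by (simp add: s_def)
    then obtain X0 where X0: "finite X0" "X0 \<subseteq> S" "s - (1/4) ^ j < sum g X0"
      using less_cSup_iff[OF ne bdd] by (auto simp: \<F>_def)
    define q where "q = Max (insert \<rho> (abv ` X0))"
    have "q < R" using X0 S rho_less by (auto simp: q_def)
    moreover have "sum g X \<le> (1/4) ^ j" if X: "finite X" "X \<subseteq> S" "\<forall>d\<in>X. q < abv d" for X
    proof -
      have "abv d \<le> q" if "d \<in> X0" for d using X0 that by (auto simp: q_def)
      then have "X \<inter> X0 = {}" using X(3) by fastforce
      then have "sum g X + sum g X0 = sum g (X \<union> X0)" using X X0 by (simp add: sum.union_disjoint)
      also have "\<dots> \<le> s" unfolding s_def using X X0 by (intro cSup_upper bdd) (auto simp: \<F>_def)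
      finally show ?thesis using X0 by simp
    qed
    ultimately show ?thesis by blast
  qed
  then obtain q where q: "\<And>j. q j < R"
    "\<And>j X. finite X \<Longrightarrow> X \<subseteq> S \<Longrightarrow> (\<forall>d\<in>X. q j < abv d) \<Longrightarrow> sum g X \<le> (1/4) ^ j" by metis
  \<comment> \<open>The entries \<open>R - (R - \<rho>) / 2 ^ i\<close> force \<open>r j\<close> to
    approach \<open>R\<close>, so that the annuli cover \<open>S\<close>; the maximum over
    \<open>i \<le> j\<close> makes the radii increase.\<close>
  define r where "r j = Max ((\<lambda>i. max (q i) (R - (R - \<rho>) / 2 ^ i)) ` {..j})" for j :: nat
  have rR: "r j < R" for j using q(1) rho_less by (auto simp: r_def)
  have rq: "q j \<le> r j" for j
    unfolding r_def by (rule order_trans[OF max.cobounded1 Max_ge]) auto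
  have rR2: "R - (R - \<rho>) / 2 ^ j \<le> r j" for j
    unfolding r_def by (rule order_trans[OF max.cobounded2 Max_ge]) auto
  define Y where "Y j = (case j of 0 \<Rightarrow> {d \<in> S. abv d \<le> r 0} | Suc i \<Rightarrow> {d \<in> S. r i < abv d \<and> abv d \<le> r (Suc i)})" for j
  have Yfin: "finite (Y j)" and YS: "Y j \<subseteq> S" for j
    using fin[OF rR[of j]] by (auto simp: Y_def split: nat.split elim: finite_subset[rotated])
  have Ycov: "\<exists>j. d \<in> Y j" if d: "d \<in> S" for d
  proof -
    have "\<exists>j. abv d \<le> r j"
    proof -
      have "0 < (R - abv d) / (R - \<rho>)" using S[OF d] rho_less by simp
      then obtain j where "(1/2) ^ j < (R - abv d) / (R - \<rho>)" using real_arch_pow_inv[of _ "1/2 :: real"] by auto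
      then have "(R - \<rho>) / 2 ^ j < R - abv d" using rho_less by (simp add: field_simps)
      then show ?thesis using rR2[of j] by (intro exI[of _ j]) linarith
    qed
    define k where "k = (LEAST j. abv d \<le> r j)"
    have "abv d \<le> r k" "\<And>i. i < k \<Longrightarrow> \<not> abv d \<le> r i"
      using LeastI_ex[OF \<open>\<exists>j. abv d \<le> r j\<close>] not_less_Least unfolding k_def by blast+
    then have "d \<in> Y k" using d by (cases k) (simp_all add: Y_def not_le)
    then show ?thesis by blast
  qed
  \<comment> \<open>Block 0 has no tail estimate and is charged the whole mass \<open>C\<close>; a
    later block \<open>j\<close> lies beyond \<open>q (j - 1)\<close>, hence the shifted
    exponent.\<close>
  have gY: "2 ^ j * sum g (Y j) \<le> (if j = 0 then C else 2 * (1/2) ^ (j - 1))" for j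
  proof (cases j)
    case 0
    then show ?thesis using C[OF Yfin YS] by (simp add: g_def)
  next
    case (Suc i)
    have "sum g (Y (Suc i)) \<le> (1/4) ^ i"
    proof (rule q(2)[OF Yfin YS])
      show "\<forall>d\<in>Y (Suc i). q i < abv d" using rq[of i] by (auto simp: Y_def)
    qed
    then have "2 ^ j * sum g (Y j) \<le> 2 ^ Suc i * (1/4) ^ i" using Suc by (simp del: power_Suc)
    also have "(1/4::real) ^ i = (1/2) ^ i * (1/2) ^ i" by (simp flip: power_mult_distrib)
    also have "2 ^ Suc i * ((1/2::real) ^ i * (1/2) ^ i) = 2 * (1/2) ^ i" by (simp add: power_one_over)
    finally show ?thesis using Suc by simp
  qed
  define W where "W j = (\<Prod>d\<in>Y j. zfac (2 ^ j) d ^ \<delta> d)" for j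
  have W1: "fps_nth (W j) n = (if n = 0 then 1 else 0)" if "n \<le> j" for n j
  proof -
    have "n < 2 ^ j" using that less_exp[of j] by (meson le_less_trans)
    then show ?thesis
      unfolding W_def by (intro fps_one_mod_prod[where N = "2 ^ j"] fps_one_mod_power[where N = "2 ^ j"]) (simp_all add: zfac_nth)
  qed
  have bW: "bnd (W j) (exp (2 ^ j * sum g (Y j)))" for j
  proof -
    have "bnd (W j) (\<Prod>d\<in>Y j. ((R / abv d) ^ 2 ^ j) ^ \<delta> d)"
      unfolding W_def using YS Snz S by (intro bnd_prod bnd_power bnd_zfac) auto
    also have "(\<Prod>d\<in>Y j. ((R / abv d) ^ 2 ^ j) ^ \<delta> d) = (\<Prod>d\<in>Y j. exp (2 ^ j * g d))"
    proof (rule prod.cong)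
      fix d assume "d \<in> Y j"
      then have "d \<in> S" using YS by blast
      then have "R / abv d = exp (ln R - ln (abv d))" using Snz R_pos by (simp add: exp_diff)
      then have "((R / abv d) ^ 2 ^ j) ^ \<delta> d = exp (real (2 ^ j * \<delta> d) * (ln R - ln (abv d)))"
        by (simp only: exp_of_nat_mult power_mult)
      then show "((R / abv d) ^ 2 ^ j) ^ \<delta> d = exp (2 ^ j * g d)" by (simp add: g_def mult_ac)
    qed simp
    also have "\<dots> = exp (2 ^ j * sum g (Y j))" by (simp add: exp_sum Yfin sum_distrib_left)
    finally show ?thesis .
  qed
  \<comment> \<open>The 4 is the sum of 2, 1, 1/2 and so on. The offset \<open>k\<close> is there
    because tails of the product must obey the same bound.\<close>
  have sumW: "(\<Sum>j<m. 2 ^ (k + j) * sum g (Y (k + j))) \<le> \<bar>C\<bar> + 4" for m k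
  proof -
    have "(\<Sum>j<m. 2 ^ (k + j) * sum g (Y (k + j))) \<le> (\<Sum>j<k + m. 2 ^ j * sum g (Y j))"
    proof -
      have "(\<Sum>j<m. 2 ^ (k + j) * sum g (Y (k + j))) = (\<Sum>j\<in>(+) k ` {..<m}. 2 ^ j * sum g (Y j))"
        by (subst sum.reindex) (auto simp: inj_on_def)
      also have "\<dots> \<le> (\<Sum>j<k + m. 2 ^ j * sum g (Y j))"
        using g YS by (intro sum_mono2) (auto intro!: mult_nonneg_nonneg sum_nonneg)
      finally show ?thesis .
    qed
    also have "\<dots> \<le> (\<Sum>j<k + m. if j = 0 then C else 2 * (1/2) ^ (j - 1))" by (intro sum_mono gY)
    also have "\<dots> \<le> \<bar>C\<bar> + 4"
    proof -
      have *: "(\<Sum>j<Suc n. if j = 0 then C else 2 * (1/2) ^ (j - 1)) = C + 4 - 4 * (1/2) ^ n" for n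
        by (induction n) auto
      show ?thesis
      proof (cases "k + m")
        case (Suc n)
        have "0 \<le> (1/2::real) ^ n" by simp
        then have "C + 4 - 4 * (1/2) ^ n \<le> \<bar>C\<bar> + 4" by linarith
        then show ?thesis unfolding Suc * .
      qed simp
    qed
    finally show ?thesis .
  qed
  have bP: "bnd (\<Prod>j<m. W (k + j)) (exp (\<bar>C\<bar> + 4))" for m k
  proof -
    have "bnd (\<Prod>j<m. W (k + j)) (\<Prod>j<m. exp (2 ^ (k + j) * sum g (Y (k + j))))" by (intro bnd_prod bW)
    moreover have "(\<Prod>j<m. exp (2 ^ (k + j) * sum g (Y (k + j)))) \<le> exp (\<bar>C\<bar> + 4)"
      unfolding exp_sum[OF finite_lessThan, symmetric] exp_le_cancel_iff by (rule sumW)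
    ultimately show ?thesis unfolding bnd_def using order_trans by blast
  qed
  have ex_L: "\<exists>L. (\<forall>m n. n \<le> m \<longrightarrow> fps_nth (\<Prod>j<m. W (k + j)) n = fps_nth L n)" for k
    by (rule fps_prod_limit) (simp add: W1)
  have bL: "bnd L (exp (\<bar>C\<bar> + 4))" if L: "\<forall>m n. n \<le> m \<longrightarrow> fps_nth (\<Prod>j<m. W (k + j)) n = fps_nth L n" for L k
  proof -
    have "abv (fps_nth L n) * R ^ n \<le> exp (\<bar>C\<bar> + 4)" for n
    proof -
      have "fps_nth L n = fps_nth (\<Prod>j<n. W (k + j)) n" using L by (metis order_refl)
      then show ?thesis using bP[of k n] by (simp add: bnd_def)
    qed
    then show ?thesis by (simp add: bnd_def)
  qed
  obtain L where L: "\<forall>m n. n \<le> m \<longrightarrow> fps_nth (\<Prod>j<m. W (0 + j)) n = fps_nth L n" using ex_L by blast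
  have L0: "L \<noteq> 0"
  proof
    assume "L = 0"
    then show False using L[rule_format, of 0 0] by simp
  qed
  have "int (\<delta> d) \<le> ord d (fps_to_fls L)" if d: "d \<in> S" for d
  proof -
    have dR: "abv d < R" using S[OF d] by simp
    obtain j where j: "d \<in> Y j" using Ycov[OF d] by blast
    obtain L' where L': "\<forall>m n. n \<le> m \<longrightarrow> fps_nth (\<Prod>i<m. W (Suc j + i)) n = fps_nth L' n" using ex_L by blast
    have "L = (\<Prod>i<Suc j. W i) * L'"
      by (rule fps_prod_limit_split) (use L L' in auto)
    also have "(\<Prod>i<Suc j. W i) = (\<Prod>i<j. W i) * W j" by simp
    also have "W j = zfac (2 ^ j) d ^ \<delta> d * (\<Prod>d\<in>Y j - {d}. zfac (2 ^ j) d ^ \<delta> d)"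
      unfolding W_def using prod.remove[OF Yfin j] by blast
    finally have eq: "L = zfac (2 ^ j) d ^ \<delta> d * ((\<Prod>i<j. W i) * (\<Prod>d\<in>Y j - {d}. zfac (2 ^ j) d ^ \<delta> d) * L')"
      by (simp add: mult_ac)
    let ?Q = "(\<Prod>i<j. W i) * (\<Prod>d\<in>Y j - {d}. zfac (2 ^ j) d ^ \<delta> d) * L'"
    have Q: "?Q \<in> anal"
      using bnd_anal[OF bL[OF L']] by (intro anal_mult prod_anal anal_power anal_zfac) (auto simp: W_def intro!: prod_anal anal_power anal_zfac)
    have nz: "?Q \<noteq> 0" "zfac (2 ^ j) d ^ \<delta> d \<noteq> 0" using L0 eq by auto
    have z: "zfac (2 ^ j) d \<noteq> 0"
    proof
      assume "zfac (2 ^ j) d = 0"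
      then have "fps_nth (zfac (2 ^ j) d) 0 = 0" by simp
      then show False by (simp add: zfac_nth)
    qed
    have "ord d (fps_to_fls L) = ord d (fps_to_fls (zfac (2 ^ j) d) ^ \<delta> d * fps_to_fls ?Q)"
      by (subst eq) (simp add: fls_times_fps_to_fls fps_to_fls_power)
    also have "\<dots> = int (\<delta> d) * ord d (fps_to_fls (zfac (2 ^ j) d)) + ord d (fps_to_fls ?Q)"
      using nz z Q by (subst ord_mult[OF dR]) (auto simp: ord_power[OF dR] mer_anal anal_zfac mer_power)
    finally have "ord d (fps_to_fls L) = int (\<delta> d) * ord d (fps_to_fls (zfac (2 ^ j) d)) + ord d (fps_to_fls ?Q)" .
    moreover have "0 \<le> ord d (fps_to_fls ?Q)" using nz Q by (intro ord_loc_ring[OF dR] loc_ring_anal[OF dR]) auto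
    moreover have "1 \<le> ord d (fps_to_fls (zfac (2 ^ j) d))"
      using ord_fps_to_fls_ge_1[OF dR anal_zfac z ev_zfac[OF Snz[OF d] dR]] .
    then have "int (\<delta> d) * 1 \<le> int (\<delta> d) * ord d (fps_to_fls (zfac (2 ^ j) d))" by (intro mult_left_mono) auto
    ultimately show ?thesis by linarith
  qed
  then show ?thesis using L0 bL[OF L] by blast
qed

text \<open>A bounded \<open>G\<close> is built that cancels all poles of \<open>f\<close>. Then
  \<open>f G\<close> is analytic, and its Gauss norms are bounded because Jensen's formula turns a
  bound for \<open>T\<close> into one for the Gauss norms of \<open>f\<close>.\<close>

theorem bounded_T_imp_bounded:
  fixes f :: "'a::{ultrametric_field, complete_space, alg_closed_field} fls"
  assumes f: "f \<in> mer" "f \<noteq> 0" and C: "\<And>r. \<rho> \<le> r \<Longrightarrow> r < R \<Longrightarrow> T r f \<le> C"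
  shows "f \<in> fraction_field_of analb"
proof -
  define \<delta> where "\<delta> d = nat (- ord d f)" for d
  have fin0: "finite {d. abv d \<le> r \<and> pl f d \<noteq> 0}" if "r < R" for r
    using lf_finite[OF lf_pl[OF f] that] .
  have pl_\<delta>: "pl f d = real (\<delta> d)" for d by (simp add: pl_def \<delta>_def)
  define S where "S = {d. \<rho> < abv d \<and> abv d < R \<and> \<delta> d > 0}"
  have finS: "finite {d \<in> S. abv d \<le> r}" if "r < R" for r
    using fin0[OF that] by (rule finite_subset[rotated]) (auto simp: S_def pl_\<delta>)
  \<comment> \<open>Letting \<open>r\<close> tend to \<open>R\<close> in a finite part of the count
    of poles gives the mass bound that the infinite product requires.\<close>
  have bound: "(\<Sum>d\<in>X. real (\<delta> d) * (ln R - ln (abv d))) \<le> C" if X: "finite X" "X \<subseteq> S" for X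
  proof (rule tendsto_upperbound)
    show "((\<lambda>r. \<Sum>d\<in>X. real (\<delta> d) * (ln r - ln (abv d))) \<longlongrightarrow> (\<Sum>d\<in>X. real (\<delta> d) * (ln R - ln (abv d)))) (at_left R)"
      using R_pos by (intro tendsto_intros) auto
    define m where "m = Max (insert \<rho> (abv ` X))"
    have m: "m < R" "\<rho> \<le> m" "\<And>d. d \<in> X \<Longrightarrow> abv d \<le> m" using X rho_less by (auto simp: m_def S_def)
    have "(\<Sum>d\<in>X. real (\<delta> d) * (ln r - ln (abv d))) \<le> C" if r: "m < r" "r < R" for r
    proof -
      have "(\<Sum>d\<in>X. real (\<delta> d) * (ln r - ln (abv d))) = (\<Sum>d\<in>X. pl f d * wt r d)"
        using X by (intro sum.cong) (auto simp: pl_\<delta> wt_def S_def max_def)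
      also have "\<dots> \<le> cnt r (pl f)"
        unfolding cnt_def using X r m fin0[OF r(2)]
        by (intro sum_mono2 mult_nonneg_nonneg wt_nonneg) (force simp: S_def pl_\<delta>)+
      also have "\<dots> \<le> C" using C[of r] T_pl[of r f] r m by linarith
      finally show ?thesis .
    qed
    then show "\<forall>\<^sub>F r in at_left R. (\<Sum>d\<in>X. real (\<delta> d) * (ln r - ln (abv d))) \<le> C"
      using m(1) by (auto simp: eventually_at_left)
  qed simp
  obtain L B where L: "bnd L B" "L \<noteq> 0" "\<And>d. d \<in> S \<Longrightarrow> int (\<delta> d) \<le> ord d (fps_to_fls L)"
    using ex_bounded_multiple[of S \<delta> C] finS bound by (auto simp: S_def)
  \<comment> \<open>The finitely many poles within radius \<open>\<rho>\<close> are removed by a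
    polynomial; a pole at 0 would be out of reach of \<open>zfac\<close>.\<close>
  define S0 where "S0 = {d. abv d \<le> \<rho> \<and> pl f d \<noteq> 0}"
  have S0: "finite S0" using fin0[OF rho_less] by (simp add: S0_def)
  define P where "P = (\<Prod>d\<in>S0. (fps_X - fps_const d) ^ \<delta> d)"
  have bP: "bnd P (\<Prod>d\<in>S0. R ^ \<delta> d)"
    unfolding P_def by (intro bnd_prod bnd_power bnd_lin) (use rho_less in \<open>auto simp: S0_def\<close>)
  have lnz: "fps_X - fps_const d \<noteq> 0" for d :: 'a using prod_lin_nz[of "{#d#}"] by simp
  have P0: "P \<noteq> 0" unfolding P_def using S0 lnz by simp
  define G where "G = P * L"
  obtain A where bG: "bnd G A" using bnd_mult[OF bP L(1)] by (auto simp: G_def)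
  have G: "G \<in> anal" "G \<noteq> 0" using bnd_anal[OF bG] P0 L(2) by (auto simp: G_def)
  have PL: "P \<in> anal" "L \<in> anal" using bnd_anal bP L(1) by auto
  have ordG: "int (\<delta> d) \<le> ord d (fps_to_fls G)" if d: "abv d < R" for d
  proof -
    have o: "ord d (fps_to_fls G) = ord d (fps_to_fls P) + ord d (fps_to_fls L)"
      unfolding G_def fls_times_fps_to_fls using PL P0 L(2) by (intro ord_mult[OF d]) (auto intro: mer_anal)
    have nn: "0 \<le> ord d (fps_to_fls P)" "0 \<le> ord d (fps_to_fls L)"
      using PL P0 L(2) by (auto intro!: ord_loc_ring[OF d] loc_ring_anal[OF d])
    consider "\<delta> d = 0" | "d \<in> S" | "d \<in> S0" using d by (fastforce simp: S_def S0_def pl_\<delta>)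
    then show ?thesis
    proof cases
      case 3
      have "fps_to_fls P = (\<Prod>x\<in>S0. lin x ^ \<delta> x)"
        unfolding P_def by (induction S0 rule: infinite_finite_induct) (simp_all add: fls_times_fps_to_fls fps_to_fls_power lin_fps)
      then have "ord d (fps_to_fls P) = (\<Sum>x\<in>S0. int (\<delta> x) * ord d (lin x))"
        by (simp add: ord_prod[OF d] ord_power[OF d] mer_power)
      also have "\<dots> = (\<Sum>x\<in>S0. if d = x then int (\<delta> d) else 0)" by (intro sum.cong) (auto simp: ord_lin[OF d])
      also have "\<dots> = int (\<delta> d)" using 3 S0 by simp
      finally show ?thesis using o nn by simp
    qed (use o nn L(3) in force)+
  qed
  define h where "h = f * fps_to_fls G"
  have h: "h \<in> mer" "h \<noteq> 0" using f G by (auto simp: h_def mer_mult mer_anal)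
  have "0 \<le> ord d h" if d: "abv d < R" for d
  proof -
    have "ord d h = ord d f + ord d (fps_to_fls G)"
      unfolding h_def using f G by (intro ord_mult[OF d]) (auto intro: mer_anal)
    then show ?thesis using ordG[OF d] unfolding \<delta>_def by linarith
  qed
  then obtain H where H: "H \<in> anal" "h = fps_to_fls H" using mer_analytic[OF h] by blast
  define M where "M = exp (C + psi \<rho> f) * A"
  have gH: "gauss r H \<le> M" if r: "\<rho> \<le> r" "r < R" for r
  proof -
    have r0: "0 < r" using r rho_pos by simp
    have "gauss r H = gm r f * gauss r G"
      using gm_anal[OF r0 r(2) H(1)] gm_anal[OF r0 r(2) G(1)] gm_mult[OF r0 r(2) f(1) mer_anal[OF G(1)]] H(2) by (simp add: h_def)
    moreover have "gm r f \<le> exp (C + psi \<rho> f)"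
    proof -
      have "psi r f \<le> C + psi \<rho> f"
        using cnt_zp_pl[OF f r] T_zp[of r f] C[OF r] cnt_nonneg[of "pl f", OF _ r] by (simp add: pl_def)
      then show ?thesis using gm_pos[OF r0 r(2) f] by (metis exp_le_cancel_iff exp_ln psi_def)
    qed
    moreover have "gauss r G \<le> A" using bnd_gauss[OF bG r0] r by simp
    ultimately show ?thesis unfolding M_def
      using gauss_nonneg[OF G(1) r0 r(2)] by (simp add: mult_mono)
  qed
  have "bnd H M"
    unfolding bnd_def
  proof
    fix n
    show "abv (fps_nth H n) * R ^ n \<le> M"
    proof (rule tendsto_upperbound)
      show "((\<lambda>r. abv (fps_nth H n) * r ^ n) \<longlongrightarrow> abv (fps_nth H n) * R ^ n) (at_left R)"
        by (intro tendsto_intros)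
      have "abv (fps_nth H n) * r ^ n \<le> M" if "\<rho> < r" "r < R" for r
        using gauss_ge[OF H(1), of r n] gH[of r] that rho_pos by simp
      then show "\<forall>\<^sub>F r in at_left R. abv (fps_nth H n) * r ^ n \<le> M"
        using rho_less by (auto simp: eventually_at_left)
    qed simp
  qed
  then have "H \<in> analb" "G \<in> analb" using bnd_analb bG by auto
  moreover have "f = fps_to_fls H / fps_to_fls G" using H(2) G(2) by (simp add: h_def flip: H(2))
  ultimately show ?thesis unfolding fraction_field_of_def using G(2) by blast
qed

end

section \<open>Second main theorem\<close>

text \<open>A nonzero derivative is the form in which nonconstancy is assumed from here on.\<close>

lemma fls_nonconst:
  fixes f :: "'a::field_char_0 fls"
  assumes "fls_deriv f \<noteq> 0"
  shows "f - fls_const b \<noteq> 0" "f \<noteq> 0"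
proof -
  show "f - fls_const b \<noteq> 0"
  proof
    assume "f - fls_const b = 0"
    then have "f = fls_const b" by simp
    then show False using assms by simp
  qed
  show "f \<noteq> 0" using assms by auto
qed

context disc
begin

lemma cnt_cong:
  assumes "r < R" "\<And>d. abv d < R \<Longrightarrow> D d = E d"
  shows "cnt r D = cnt r E"
  unfolding cnt_def using assms by (intro sum.cong) auto

definition pb :: "'a::ultrametric_field fls \<Rightarrow> 'a \<Rightarrow> real" where
  "pb h d = of_bool (ord d h < 0)"

lemma lf_pb:
  fixes h :: "'a::{ultrametric_field, complete_space, alg_closed_field} fls"
  shows "h \<in> mer \<Longrightarrow> h \<noteq> 0 \<Longrightarrow> lf (pb h)"
  by (rule lf_subset[OF lf_ord]) (auto simp: pb_def)

lemma pole_shift: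
  fixes d :: "'a::{ultrametric_field, complete_space}"
  assumes d: "abv d < R" and f: "f \<in> mer" "f \<noteq> 0" "f - fls_const b \<noteq> 0"
  shows "ord d f < 0 \<Longrightarrow> ord d (f - fls_const b) = ord d f"
    and "0 \<le> ord d f \<Longrightarrow> 0 \<le> ord d (f - fls_const b)"
proof -
  assume *: "ord d f < 0"
  show "ord d (f - fls_const b) = ord d f"
  proof (cases "b = 0")
    case False
    then show ?thesis
      using ord_add_eq(2)[OF d f(1) mer_const[of "- b"] f(2)] * ord_const[OF d, of "- b"] by (simp del: fls_const_uminus add: fls_const_uminus[symmetric] fls_plus_const) (simp add: fls_const_uminus)
  qed simp
next
  assume "0 \<le> ord d f"
  then have "loc_ring d (f - fls_const b)"
    using f by (intro loc_ring_diff[OF d] loc_ringI[OF d] loc_ring_const[OF d]) auto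
  then show "0 \<le> ord d (f - fls_const b)" using f by (intro ord_loc_ring[OF d])
qed

lemma pl_shift:
  fixes d :: "'a::{ultrametric_field, complete_space}"
  assumes d: "abv d < R" and f: "f \<in> mer" "f \<noteq> 0" "f - fls_const b \<noteq> 0"
  shows "pl (f - fls_const b) d = pl f d"
  using pole_shift[OF assms] unfolding pl_def by (cases "ord d f < 0") auto

lemma psi_mult:
  assumes "g \<in> mer" "h \<in> mer" "g \<noteq> 0" "h \<noteq> 0" "\<rho> \<le> r" "r < R"
  shows "psi r (g * h) = psi r g + psi r h"
  using assms gm_mult[of r g h] gm_pos[of r g] gm_pos[of r h] rho_pos by (simp add: psi_def ln_mult)

lemma psi_deriv_le:
  assumes "h \<in> mer" "fls_deriv h \<noteq> 0" "\<rho> \<le> r" "r < R"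
  shows "psi r (fls_deriv h) \<le> psi r h - ln \<rho>"
proof -
  have r: "0 < r" using assms rho_pos by simp
  have nz: "h \<noteq> 0" using assms by auto
  have "gm r (fls_deriv h) \<le> gm r h / r" using gm_deriv_le[OF r assms(4,1)] .
  also have "\<dots> \<le> gm r h / \<rho>" using assms rho_pos gm_pos[OF r assms(4,1) nz] by (intro divide_left_mono) auto
  finally have "ln (gm r (fls_deriv h)) \<le> ln (gm r h / \<rho>)"
    using gm_pos[OF r assms(4) mer_deriv[OF assms(1)] assms(2)] by simp
  then show ?thesis using gm_pos[OF r assms(4,1) nz] rho_pos by (simp add: psi_def ln_div)
qed

lemma psi_shift_le:
  assumes "f \<in> mer" "f \<noteq> 0" "f - fls_const b \<noteq> 0" "\<rho> \<le> r" "r < R"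
  shows "psi r (f - fls_const b) \<le> max 0 (psi r f) + \<bar>ln (abv b)\<bar>"
proof -
  have r: "0 < r" using assms rho_pos by simp
  have p: "0 < gm r f" "0 < gm r (f - fls_const b)"
    using gm_pos[OF r assms(5) assms(1,2)] gm_pos[OF r assms(5) mer_diff[OF assms(1) mer_const] assms(3)] by auto
  have le: "gm r (f - fls_const b) \<le> max (gm r f) (abv b)"
    using gm_diff_le[OF r assms(5,1) mer_const, of b] gm_const[OF r assms(5), of b] by simp
  show ?thesis
  proof (cases "gm r (f - fls_const b) \<le> gm r f")
    case True
    then have "psi r (f - fls_const b) \<le> psi r f" using p by (simp add: psi_def)
    then show ?thesis by linarith
  next
    case False
    then have "gm r (f - fls_const b) \<le> abv b" using le by (simp add: max_def split: if_splits)
    then have "psi r (f - fls_const b) \<le> ln (abv b)" using p unfolding psi_def by (intro ln_mono) linarith+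
    then show ?thesis by linarith
  qed
qed

lemma T_shift:
  fixes f :: "'a::{ultrametric_field, complete_space, alg_closed_field} fls"
  assumes f: "f \<in> mer" "f \<noteq> 0" "f - fls_const b \<noteq> 0"
  shows "(\<lambda>r. T r (f - fls_const b)) \<preceq> (\<lambda>r. T r f)"
proof -
  have "(\<lambda>r. T r (f - fls_const b)) \<preceq> (\<lambda>r. cnt r (pl (f - fls_const b)) + max 0 (psi r (f - fls_const b)))"
    using f by (intro T_le_pl mer_diff) auto
  also have "\<dots> \<preceq> (\<lambda>r. cnt r (pl f) + max 0 (psi r f))"
  proof (rule bdleI)
    fix r assume r: "\<rho> \<le> r" "r < R"
    have "cnt r (pl (f - fls_const b)) = cnt r (pl f)" using r f by (intro cnt_cong pl_shift)
    then show "cnt r (pl (f - fls_const b)) + max 0 (psi r (f - fls_const b))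
      \<le> cnt r (pl f) + max 0 (psi r f) + \<bar>ln (abv b)\<bar>"
      using psi_shift_le[OF f r] by simp
  qed
  also have "\<dots> \<preceq> (\<lambda>r. T r f)" using f by (intro pl_le_T)
  finally show ?thesis .
qed

lemma T_shift':
  fixes f :: "'a::{ultrametric_field, complete_space, alg_closed_field} fls"
  assumes f: "f \<in> mer" "f \<noteq> 0" "f - fls_const b \<noteq> 0"
  shows "(\<lambda>r. T r f) \<preceq> (\<lambda>r. T r (f - fls_const b))"
  using T_shift[of "f - fls_const b" "- b"] f by (simp add: mer_diff)

lemma T_mult:
  fixes g h :: "'a::{ultrametric_field, complete_space, alg_closed_field} fls"
  assumes "g \<in> mer" "h \<in> mer" "g \<noteq> 0" "h \<noteq> 0" "\<rho> \<le> r" "r < R"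
  shows "T r (g * h) \<le> T r g + T r h"
proof -
  have gh: "g * h \<in> mer" "g * h \<noteq> 0" using assms mer_mult by auto
  have "cnt r (zp (g * h)) \<le> cnt r (\<lambda>d. zp g d + zp h d)" "cnt r (pl (g * h)) \<le> cnt r (\<lambda>d. pl g d + pl h d)"
    by (intro cnt_mono lf_add lf_zp lf_pl; use assms gh in \<open>simp add: zp_def pl_def ord_mult\<close>)+
  then have "cnt r (zp (g * h)) \<le> cnt r (zp g) + cnt r (zp h)" "cnt r (pl (g * h)) \<le> cnt r (pl g) + cnt r (pl h)"
    using assms by (simp_all add: cnt_add lf_zp lf_pl)
  then show ?thesis using T_zp[of r g] T_zp[of r h] T_pl[of r g] T_pl[of r h] unfolding T_def by linarith
qed

text \<open>A pole of order \<open>q\<close> becomes one of order \<open>q + 1\<close>, which adds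
  one unit per pole regardless of multiplicity; the proximity part grows by at most a
  constant.\<close>

lemma T_deriv:
  fixes f :: "'a::{ultrametric_field, complete_space, alg_closed_field, field_char_0} fls"
  assumes f: "f \<in> mer" "fls_deriv f \<noteq> 0"
  shows "(\<lambda>r. T r (fls_deriv f)) \<preceq> (\<lambda>r. T r f + cnt r (pb f))"
proof -
  have nz: "f \<noteq> 0" using f by auto
  have "(\<lambda>r. T r (fls_deriv f)) \<preceq> (\<lambda>r. cnt r (pl (fls_deriv f)) + max 0 (psi r (fls_deriv f)))"
    using f by (intro T_le_pl mer_deriv)
  also have "\<dots> \<preceq> (\<lambda>r. cnt r (pl f) + max 0 (psi r f) + cnt r (pb f))"
  proof (rule bdleI)
    fix r assume r: "\<rho> \<le> r" "r < R"
    have "cnt r (pl (fls_deriv f)) = cnt r (\<lambda>d. pl f d + pb f d)"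
    proof (rule cnt_cong[OF r(2)])
      fix d :: 'a assume d: "abv d < R"
      show "pl (fls_deriv f) d = pl f d + pb f d"
        using ord_deriv(2)[OF d f(1) nz] ord_deriv_nonneg[OF d f(1) nz _ f(2)]
        by (cases "ord d f < 0") (auto simp: pl_def pb_def)
    qed
    also have "\<dots> = cnt r (pl f) + cnt r (pb f)" using f nz r by (intro cnt_add lf_pl lf_pb)
    finally show "cnt r (pl (fls_deriv f)) + max 0 (psi r (fls_deriv f))
        \<le> cnt r (pl f) + max 0 (psi r f) + cnt r (pb f) + \<bar>ln \<rho>\<bar>"
      using psi_deriv_le[OF f r] by simp
  qed
  also have "\<dots> \<preceq> (\<lambda>r. T r f + cnt r (pb f))"
    using bdle_add[OF pl_le_T[OF f(1) nz] bdle_le[of "\<lambda>r. cnt r (pb f)"]] by simp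
  finally show ?thesis .
qed

text \<open>At a given radius \<open>f\<close> can be close to at most one of the values \<open>b \<in> S\<close>, and there
  \<open>f'\<close> is at least as small as \<open>f - b\<close>.\<close>

lemma proximity_deriv:
  fixes f :: "'a::{ultrametric_field, complete_space, alg_closed_field, field_char_0} fls"
  assumes f: "f \<in> mer" "fls_deriv f \<noteq> 0" and S: "finite S"
  shows "(\<lambda>r. \<Sum>b\<in>S. max 0 (- psi r (f - fls_const b))) \<preceq> (\<lambda>r. max 0 (- psi r (fls_deriv f)))"
proof -
  \<comment> \<open>\<open>C\<close> dominates the logarithmic size of all differences: once
    \<open>psi r (f - b) < - C\<close>, the norm of \<open>f - b\<close> is below that of
    \<open>b - b'\<close>, so \<open>f - b'\<close> has the norm of \<open>b - b'\<close>.\<close>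
  define C where "C = (\<Sum>(b, b')\<in>S \<times> S. \<bar>ln (abv (b - b'))\<bar>)"
  have C: "\<bar>ln (abv (b - b'))\<bar> \<le> C" if "b \<in> S" "b' \<in> S" for b b'
    unfolding C_def using member_le_sum[of "(b, b')" "S \<times> S" "\<lambda>(b, b'). \<bar>ln (abv (b - b'))\<bar>"] S that by auto
  have C0: "0 \<le> C" unfolding C_def by (intro sum_nonneg) auto
  show ?thesis
  proof (rule bdleI)
    fix r assume r: "\<rho> \<le> r" "r < R"
    have r0: "0 < r" using r rho_pos by simp
    have p: "0 < gm r (f - fls_const b)" for b
      using gm_pos[OF r0 r(2) mer_diff[OF f(1) mer_const]] fls_nonconst(1)[OF f(2)] by blast
    let ?m = "\<lambda>b. max 0 (- psi r (f - fls_const b))"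
    show "(\<Sum>b\<in>S. ?m b) \<le> max 0 (- psi r (fls_deriv f)) + (real (card S) * C + \<bar>ln \<rho>\<bar>)"
    proof (cases "\<exists>b\<in>S. psi r (f - fls_const b) < - C")
      case True
      then obtain b where b: "b \<in> S" "psi r (f - fls_const b) < - C" by blast
      have "?m b' \<le> C" if b': "b' \<in> S - {b}" for b'
      proof -
        have nz: "b - b' \<noteq> 0" using b' by auto
        have "ln (gm r (f - fls_const b)) < ln (abv (b - b'))"
          using b C[of b b'] b' by (auto simp: psi_def)
        then have lt: "gm r (f - fls_const b) < abv (b - b')" using p[of b] nz by (subst (asm) ln_less_cancel_iff) auto
        have "f - fls_const b' = - (fls_const (b' - b) - (f - fls_const b))" by (simp flip: fls_minus_const)
        then have "gm r (f - fls_const b') = gm r (- (fls_const (b' - b) - (f - fls_const b)))"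
          by (rule arg_cong)
        also have "\<dots> = gm r (fls_const (b' - b) - (f - fls_const b))"
          by (intro gm_uminus[OF r0 r(2)] mer_diff mer_const f)
        also have "\<dots> = abv (b' - b)"
          using gm_diff_eq[OF r0 r(2) mer_const[of "b' - b"] mer_diff[OF f(1) mer_const[of b]]] lt
          by (simp add: gm_const[OF r0 r(2)] abv_minus_commute)
        finally have "psi r (f - fls_const b') = ln (abv (b' - b))" by (simp add: psi_def)
        then show ?thesis using C[of b' b] b b' C0 by auto
      qed
      then have "(\<Sum>b'\<in>S - {b}. ?m b') \<le> real (card (S - {b})) * C" by (intro sum_bounded_above)
      also have "\<dots> \<le> real (card S) * C" using C0 S by (intro mult_right_mono) (auto intro: card_mono)
      finally have "(\<Sum>b'\<in>S. ?m b') \<le> ?m b + real (card S) * C" using sum.remove[OF S b(1), of ?m] by simp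
      moreover have "psi r (fls_deriv f) \<le> psi r (f - fls_const b) - ln \<rho>"
        using psi_deriv_le[of "f - fls_const b" r] f r by (simp add: mer_diff)
      ultimately show ?thesis by linarith
    next
      case False
      then have "(\<Sum>b\<in>S. ?m b) \<le> real (card S) * C" using C0 by (intro sum_bounded_above) (auto simp: not_less)
      then show ?thesis by linarith
    qed
  qed
qed

text \<open>Summing \<open>T\<close> over the shifts gives their zeros plus proximities. All
  proximities together are at most that of \<open>f'\<close>, which is at most the characteristic of
  \<open>f'\<close> minus the zeros of \<open>f'\<close>; bounding that characteristic by
  \<open>T_deriv\<close> uses up one \<open>T r f\<close>.\<close>

theorem second_main:
  fixes f :: "'a::{ultrametric_field, complete_space, alg_closed_field, field_char_0} fls"
  assumes f: "f \<in> mer" "fls_deriv f \<noteq> 0" and S: "finite S"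
  shows "(\<lambda>r. (real (card S) - 1) * T r f) \<preceq>
    (\<lambda>r. cnt r (\<lambda>d. (\<Sum>b\<in>S. zp (f - fls_const b) d) - zp (fls_deriv f) d + pb f d))"
proof -
  note nc = fls_nonconst[OF f(2)]
  have fb: "f - fls_const b \<in> mer" for b using f by (intro mer_diff) auto
  have "(\<lambda>r. \<Sum>b\<in>S. T r f) \<preceq> (\<lambda>r. \<Sum>b\<in>S. cnt r (zp (f - fls_const b)) + max 0 (- psi r (f - fls_const b)))"
    by (intro bdle_sum bdle_trans[OF T_shift' T_le_zp] f nc fb)
  then have "(\<lambda>r. real (card S) * T r f) \<preceq> (\<lambda>r. (\<Sum>b\<in>S. cnt r (zp (f - fls_const b))) + (\<Sum>b\<in>S. max 0 (- psi r (f - fls_const b))))"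
    by (simp add: sum.distrib)
  then obtain C1 where C1: "\<And>r. \<rho> \<le> r \<Longrightarrow> r < R \<Longrightarrow> real (card S) * T r f \<le>
      (\<Sum>b\<in>S. cnt r (zp (f - fls_const b))) + (\<Sum>b\<in>S. max 0 (- psi r (f - fls_const b))) + C1"
    unfolding bdle_def by blast
  obtain C2 where C2: "\<And>r. \<rho> \<le> r \<Longrightarrow> r < R \<Longrightarrow>
      (\<Sum>b\<in>S. max 0 (- psi r (f - fls_const b))) \<le> max 0 (- psi r (fls_deriv f)) + C2"
    using proximity_deriv[OF assms] unfolding bdle_def by blast
  obtain C3 where C3: "\<And>r. \<rho> \<le> r \<Longrightarrow> r < R \<Longrightarrow>
      cnt r (zp (fls_deriv f)) + max 0 (- psi r (fls_deriv f)) \<le> T r (fls_deriv f) + C3"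
    using zp_le_T[OF mer_deriv[OF f(1)] f(2)] unfolding bdle_def by blast
  obtain C4 where C4: "\<And>r. \<rho> \<le> r \<Longrightarrow> r < R \<Longrightarrow> T r (fls_deriv f) \<le> T r f + cnt r (pb f) + C4"
    using T_deriv[OF f] unfolding bdle_def by blast
  show ?thesis
  proof (rule bdleI)
    fix r assume r: "\<rho> \<le> r" "r < R"
    have "cnt r (\<lambda>d. (\<Sum>b\<in>S. zp (f - fls_const b) d) - zp (fls_deriv f) d + pb f d)
      = (\<Sum>b\<in>S. cnt r (zp (f - fls_const b))) - cnt r (zp (fls_deriv f)) + cnt r (pb f)"
      using f nc fb r
      by (simp add: cnt_add cnt_diff cnt_sum lf_diff lf_sum lf_zp lf_pb mer_deriv)
    then show "(real (card S) - 1) * T r f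
      \<le> cnt r (\<lambda>d. (\<Sum>b\<in>S. zp (f - fls_const b) d) - zp (fls_deriv f) d + pb f d) + (C1 + C2 + C3 + C4)"
      using C1[OF r] C2[OF r] C3[OF r] C4[OF r] by (simp add: left_diff_distrib)
  qed
qed

subsection \<open>Polynomials in a meromorphic function\<close>

lemma fls_poly_pCons [simp]: "fls_poly (pCons c p) f = fls_const c + f * fls_poly p f"
  by (simp add: fls_poly_def map_poly_pCons)

lemma fls_poly_0 [simp]: "fls_poly 0 f = 0"
  by (simp add: fls_poly_def)

lemma fls_poly_add: "fls_poly (p + q) f = fls_poly p f + fls_poly q f"
  by (induction p q rule: poly_induct2) (simp_all add: algebra_simps flip: fls_plus_const)

lemma fls_poly_smult: "fls_poly (smult c p) f = fls_const c * fls_poly p f"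
  by (induction p) (simp_all add: algebra_simps flip: fls_const_mult_const)

lemma fls_poly_mult: "fls_poly (p * q) f = fls_poly p f * fls_poly q f"
  by (induction p) (simp_all add: algebra_simps fls_poly_add fls_poly_smult)

lemma fls_poly_1 [simp]: "fls_poly 1 f = 1"
  unfolding one_pCons by simp

lemma fls_poly_power: "fls_poly (p ^ n) f = fls_poly p f ^ n"
  by (induction n) (simp_all add: fls_poly_mult)

lemma fls_poly_prod: "fls_poly (prod p I) f = (\<Prod>i\<in>I. fls_poly (p i) f)"
  by (induction I rule: infinite_finite_induct) (simp_all add: fls_poly_mult)

lemma fls_poly_prod_mset: "fls_poly (\<Prod>x\<in>#A. p x) f = (\<Prod>x\<in>#A. fls_poly (p x) f)"
  by (induction A) (simp_all add: fls_poly_mult)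

lemma fls_poly_lin [simp]: "fls_poly [:- x, 1:] f = f - fls_const x"
  by simp

lemma fls_deriv_poly: "fls_deriv (fls_poly p f) = fls_deriv f * fls_poly (pderiv p) f"
  by (induction p) (simp_all add: pderiv_pCons fls_poly_add algebra_simps)

lemma mer_poly: "f \<in> mer \<Longrightarrow> fls_poly p f \<in> mer"
  by (induction p) (auto intro: mer_add mer_mult)

lemma fls_poly_linear_factors:
  fixes Q :: "'a::alg_closed_field poly"
  assumes "Q \<noteq> 0"
  obtains A where "size A = degree Q" "Q = smult (lead_coeff Q) (\<Prod>x\<in>#A. [:- x, 1:])"
    "\<And>f. fls_poly Q f = fls_const (lead_coeff Q) * (\<Prod>x\<in>#A. f - fls_const x)"
proof -
  obtain A where A: "size A = degree Q" "Q = smult (lead_coeff Q) (\<Prod>x\<in>#A. [:- x, 1:])"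
    using alg_closed_imp_factorization[OF assms] by auto
  have "fls_poly Q f = fls_const (lead_coeff Q) * (\<Prod>x\<in>#A. f - fls_const x)" for f
    by (subst A(2)) (simp add: fls_poly_smult fls_poly_prod_mset)
  then show ?thesis using that A by blast
qed

context
  fixes f :: "'a::{ultrametric_field, complete_space, alg_closed_field, field_char_0} fls"
  assumes f: "f \<in> mer" "fls_deriv f \<noteq> 0"
begin

lemma mer_prod_mset [simp]: "(\<Prod>x\<in>#A. f - fls_const x) \<in> mer"
  by (induction A) (auto intro!: mer_mult mer_diff f)

lemma prod_mset_shift_nz [simp]: "(\<Prod>x\<in>#A. f - fls_const x) \<noteq> 0"
  using fls_nonconst(1)[OF f(2)] by (induction A) auto

lemma fls_poly_nz: "Q \<noteq> 0 \<Longrightarrow> fls_poly Q f \<noteq> 0"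
  by (metis fls_const_eq_0_iff fls_poly_linear_factors leading_coeff_0_iff mult_eq_0_iff prod_mset_shift_nz)

lemma ord_prod_mset_shift:
  "abv d < R \<Longrightarrow> ord d (\<Prod>x\<in>#A. f - fls_const x) = (\<Sum>x\<in>#A. ord d (f - fls_const x))"
proof (induction A)
  case (add x A)
  then show ?case
    using ord_mult[OF _ mer_diff[OF f(1) mer_const] mer_prod_mset fls_nonconst(1)[OF f(2)] prod_mset_shift_nz, of d x A] by simp
qed simp

lemma ord_poly_pole:
  assumes d: "abv d < R" and Q: "Q \<noteq> 0" and p: "ord d f < 0"
  shows "ord d (fls_poly Q f) = int (degree Q) * ord d f"
proof -
  obtain A where A: "size A = degree Q" "fls_poly Q f = fls_const (lead_coeff Q) * (\<Prod>x\<in>#A. f - fls_const x)"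
    using fls_poly_linear_factors[OF Q] by metis
  have "ord d (fls_poly Q f) = (\<Sum>x\<in>#A. ord d (f - fls_const x))"
    unfolding A(2) using ord_mult[OF d mer_const mer_prod_mset _ prod_mset_shift_nz] Q
    by (simp add: ord_const[OF d] ord_prod_mset_shift[OF d])
  also have "\<dots> = (\<Sum>x\<in>#A. ord d f)"
    using pole_shift(1)[OF d f(1) fls_nonconst(2)[OF f(2)] fls_nonconst(1)[OF f(2)] p] by simp
  finally show ?thesis using A(1) by simp
qed

lemma ord_poly_nonneg:
  assumes d: "abv d < R" and Q: "Q \<noteq> 0" and p: "0 \<le> ord d f"
  shows "0 \<le> ord d (fls_poly Q f)"
proof -
  have "loc_ring d f" using p f by (intro loc_ringI[OF d])
  then have "loc_ring d (fls_poly Q f)"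
    using loc_ring_const[OF d, of 0] by (induction Q) (auto intro!: loc_ring_add[OF d] loc_ring_mult[OF d] simp: loc_ring_const[OF d])
  then show ?thesis using ord_loc_ring[OF d] fls_poly_nz[OF Q] by blast
qed

lemma pl_poly:
  assumes "abv d < R" "Q \<noteq> 0"
  shows "pl (fls_poly Q f) d = real (degree Q) * pl f d"
proof (cases "ord d f < 0")
  case True
  then have "degree Q * ord d f \<le> 0" by (simp add: mult_le_0_iff)
  then show ?thesis using ord_poly_pole[OF assms True] True by (simp add: pl_def max_def)
next
  case False
  then show ?thesis using ord_poly_nonneg[OF assms] by (simp add: pl_def)
qed

text \<open>\<open>C\<close> bounds all roots of \<open>Q\<close>. Above it every linear factor has
  exactly the norm of \<open>f\<close>; below it cancellation is possible, and only an upper bound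
  survives.\<close>

lemma gm_poly:
  assumes Q: "Q \<noteq> 0"
  obtains C where "1 \<le> C" "\<And>r. \<rho> \<le> r \<Longrightarrow> r < R \<Longrightarrow> C < gm r f \<Longrightarrow> psi r (fls_poly Q f) = ln (abv (lead_coeff Q)) + degree Q * psi r f"
    "\<And>r. \<rho> \<le> r \<Longrightarrow> r < R \<Longrightarrow> gm r f \<le> C \<Longrightarrow> psi r (fls_poly Q f) \<le> ln (abv (lead_coeff Q)) + degree Q * ln C"
proof -
  obtain A where A: "size A = degree Q" "fls_poly Q f = fls_const (lead_coeff Q) * (\<Prod>x\<in>#A. f - fls_const x)"
    using fls_poly_linear_factors[OF Q] by metis
  define C where "C = Max (insert 1 (abv ` set_mset A))"
  have C: "1 \<le> C" "\<And>x. x \<in># A \<Longrightarrow> abv x \<le> C" by (auto simp: C_def)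
  have psi: "psi r (fls_poly Q f) = ln (abv (lead_coeff Q)) + psi r (\<Prod>x\<in>#A. f - fls_const x)"
    if r: "\<rho> \<le> r" "r < R" for r
    unfolding A(2) using psi_mult[OF mer_const mer_prod_mset _ prod_mset_shift_nz r] gm_const[of r] r rho_pos Q
    by (simp add: psi_def)
  show ?thesis
  proof (rule that[OF C(1)])
    fix r assume r: "\<rho> \<le> r" "r < R" and gt: "C < gm r f"
    have r0: "0 < r" using r rho_pos by simp
    have "psi r (\<Prod>x\<in>#B. f - fls_const x) = size B * psi r f" if "B \<subseteq># A" for B
      using that
    proof (induction B)
      case empty
      then show ?case using gm_const[OF r0 r(2), of "1::'a"] by (simp add: psi_def)
    next
      case (add x B)
      have "abv x \<le> C" using C(2) add.prems by (meson mset_subset_eqD union_single_eq_member)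
      then have "gm r (f - fls_const x) = gm r f"
        using gm_diff_eq[OF r0 r(2) f(1) mer_const[of x]] gt by (simp add: gm_const[OF r0 r(2)])
      moreover have "B \<subseteq># A" by (rule subset_mset.order_trans[OF _ add.prems]) simp
      ultimately show ?case
        using add.IH psi_mult[OF mer_diff[OF f(1) mer_const] mer_prod_mset fls_nonconst(1)[OF f(2)] prod_mset_shift_nz r, of x B]
        by (simp add: psi_def algebra_simps)
    qed
    then show "psi r (fls_poly Q f) = ln (abv (lead_coeff Q)) + degree Q * psi r f"
      using psi[OF r] A(1) by simp
  next
    fix r assume r: "\<rho> \<le> r" "r < R" and le: "gm r f \<le> C"
    have r0: "0 < r" using r rho_pos by simp
    have "psi r (\<Prod>x\<in>#B. f - fls_const x) \<le> size B * ln C" if "B \<subseteq># A" for B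
      using that
    proof (induction B)
      case empty
      then show ?case using gm_const[OF r0 r(2), of "1::'a"] by (simp add: psi_def)
    next
      case (add x B)
      have "abv x \<le> C" using C(2) add.prems by (meson mset_subset_eqD union_single_eq_member)
      then have "gm r (f - fls_const x) \<le> C"
        using gm_diff_le[OF r0 r(2) f(1) mer_const[of x]] le by (simp add: gm_const[OF r0 r(2)])
      then have "psi r (f - fls_const x) \<le> ln C"
        unfolding psi_def using gm_pos[OF r0 r(2) mer_diff[OF f(1) mer_const] fls_nonconst(1)[OF f(2)]] by (intro ln_mono) auto
      moreover have "B \<subseteq># A" by (rule subset_mset.order_trans[OF _ add.prems]) simp
      ultimately show ?case
        using add.IH psi_mult[OF mer_diff[OF f(1) mer_const] mer_prod_mset fls_nonconst(1)[OF f(2)] prod_mset_shift_nz r, of x B]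
        by (simp add: algebra_simps)
    qed
    then show "psi r (fls_poly Q f) \<le> ln (abv (lead_coeff Q)) + degree Q * ln C"
      using psi[OF r] A(1) by force
  qed
qed

lemma T_poly:
  assumes Q: "Q \<noteq> 0"
  shows "(\<lambda>r. T r (fls_poly Q f)) \<preceq> (\<lambda>r. degree Q * T r f)" "(\<lambda>r. degree Q * T r f) \<preceq> (\<lambda>r. T r (fls_poly Q f))"
proof -
  note nc = fls_nonconst[OF f(2)]
  obtain C where C: "1 \<le> C" "\<And>r. \<rho> \<le> r \<Longrightarrow> r < R \<Longrightarrow> C < gm r f \<Longrightarrow> psi r (fls_poly Q f) = ln (abv (lead_coeff Q)) + degree Q * psi r f"
    "\<And>r. \<rho> \<le> r \<Longrightarrow> r < R \<Longrightarrow> gm r f \<le> C \<Longrightarrow> psi r (fls_poly Q f) \<le> ln (abv (lead_coeff Q)) + degree Q * ln C"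
    using gm_poly[OF Q] by blast
  define K where "K = \<bar>ln (abv (lead_coeff Q))\<bar> + degree Q * ln C"
  have lnC: "0 \<le> ln C" "0 \<le> real (degree Q) * ln C" using C(1) by auto
  have K: "\<bar>max 0 (psi r (fls_poly Q f)) - degree Q * max 0 (psi r f)\<bar> \<le> K" if r: "\<rho> \<le> r" "r < R" for r
  proof (cases "C < gm r f")
    case True
    then have "0 \<le> psi r f" using C(1) by (simp add: psi_def)
    moreover from this have "0 \<le> degree Q * psi r f" by simp
    ultimately show ?thesis using C(2)[OF r True] lnC unfolding K_def by linarith
  next
    case False
    then have "psi r f \<le> ln C" unfolding psi_def
      using gm_pos[of r f] f nc r rho_pos by (intro ln_mono) auto
    then have "degree Q * max 0 (psi r f) \<le> degree Q * ln C" using lnC by (intro mult_left_mono) auto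
    moreover have "0 \<le> degree Q * max 0 (psi r f)" by simp
    ultimately show ?thesis using C(3)[OF r] False lnC unfolding K_def by linarith
  qed
  have pl: "cnt r (pl (fls_poly Q f)) = degree Q * cnt r (pl f)" if r: "\<rho> \<le> r" "r < R" for r
    using cnt_cong[OF r(2), of "pl (fls_poly Q f)" "\<lambda>d. degree Q * pl f d"] pl_poly Q by (simp add: cnt_cmult)
  have PQ: "fls_poly Q f \<in> mer" "fls_poly Q f \<noteq> 0" using mer_poly[OF f(1)] fls_poly_nz[OF Q] by auto
  have "(\<lambda>r. T r (fls_poly Q f)) \<preceq> (\<lambda>r. cnt r (pl (fls_poly Q f)) + max 0 (psi r (fls_poly Q f)))" by (rule T_le_pl[OF PQ])
  also have "\<dots> \<preceq> (\<lambda>r. degree Q * (cnt r (pl f) + max 0 (psi r f)))"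
    by (rule bdleI[where C = K]) (use K pl in \<open>fastforce simp: distrib_left\<close>)
  also have "\<dots> \<preceq> (\<lambda>r. degree Q * T r f)" by (intro bdle_cmult pl_le_T f nc) auto
  finally show "(\<lambda>r. T r (fls_poly Q f)) \<preceq> (\<lambda>r. degree Q * T r f)" .
  have "(\<lambda>r. degree Q * T r f) \<preceq> (\<lambda>r. degree Q * (cnt r (pl f) + max 0 (psi r f)))" by (intro bdle_cmult T_le_pl f nc) auto
  also have "\<dots> \<preceq> (\<lambda>r. cnt r (pl (fls_poly Q f)) + max 0 (psi r (fls_poly Q f)))"
    by (rule bdleI[where C = K]) (use K pl in \<open>fastforce simp: distrib_left\<close>)
  also have "\<dots> \<preceq> (\<lambda>r. T r (fls_poly Q f))" by (rule pl_le_T[OF PQ])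
  finally show "(\<lambda>r. degree Q * T r f) \<preceq> (\<lambda>r. T r (fls_poly Q f))" .
qed

end

section \<open>Functions sharing the value 1\<close>

definition z2 :: "'a::ultrametric_field fls \<Rightarrow> 'a \<Rightarrow> real" where
  "z2 h d = of_int (min 2 \<bar>ord d h\<bar>)"

lemma lf_z2:
  fixes h :: "'a::{ultrametric_field, complete_space, alg_closed_field} fls"
  shows "h \<in> mer \<Longrightarrow> h \<noteq> 0 \<Longrightarrow> lf (z2 h)"
  by (rule lf_subset[OF lf_ord]) (auto simp: z2_def)

lemma ord_log_deriv:
  fixes w :: "'a::{ultrametric_field, complete_space, field_char_0} fls"
  assumes d: "abv d < R" and w: "w \<in> mer" "fls_deriv w \<noteq> 0"
  shows "ord d (fls_deriv w / w) = ord d (fls_deriv w) - ord d w"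
    and "- 1 \<le> ord d (fls_deriv w / w)" and "ord d w = 0 \<Longrightarrow> 0 \<le> ord d (fls_deriv w / w)"
proof -
  have nz: "w \<noteq> 0" using w by auto
  show eq: "ord d (fls_deriv w / w) = ord d (fls_deriv w) - ord d w"
    using w nz by (intro ord_divide[OF d] mer_deriv)
  show "- 1 \<le> ord d (fls_deriv w / w)"
    using ord_deriv(2)[OF d w(1) nz] ord_deriv_nonneg[OF d w(1) nz _ w(2)] eq by (cases "ord d w = 0") auto
  show "ord d w = 0 \<Longrightarrow> 0 \<le> ord d (fls_deriv w / w)"
    using ord_deriv_nonneg[OF d w(1) nz _ w(2)] eq by simp
qed

text \<open>By Jensen's formula the count is the growth of the Gauss norm of \<open>w' / w\<close>,
  and this norm never exceeds \<open>1 / \<rho>\<close>.\<close>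

lemma cnt_log_deriv:
  fixes w :: "'a::{ultrametric_field, complete_space, alg_closed_field, field_char_0} fls"
  assumes w: "w \<in> mer" "fls_deriv w \<noteq> 0"
  shows "(\<lambda>r. cnt r (\<lambda>d. of_int (ord d (fls_deriv w / w)))) \<preceq> (\<lambda>r. 0)"
proof (rule bdleI)
  fix r assume r: "\<rho> \<le> r" "r < R"
  have nz: "w \<noteq> 0" using w by auto
  have m: "fls_deriv w / w \<in> mer" "fls_deriv w / w \<noteq> 0" using w nz by (auto intro: mer_divide mer_deriv)
  have "cnt r (\<lambda>d. of_int (ord d (fls_deriv w / w))) = psi r (fls_deriv w / w) - psi \<rho> (fls_deriv w / w)"
    using jensen_formula[OF m r] by (simp add: psi_def)
  moreover have "psi r (fls_deriv w) = psi r (fls_deriv w / w) + psi r w"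
    using psi_mult[OF m(1) w(1) m(2) nz r] nz by simp
  ultimately show "cnt r (\<lambda>d. of_int (ord d (fls_deriv w / w))) \<le> 0 + (- ln \<rho> - psi \<rho> (fls_deriv w / w))"
    using psi_deriv_le[OF w r] by simp
qed

text \<open>The contribution of \<open>d\<close> to the right-hand side of the second main theorem for the
  values \<open>0\<close>, \<open>e\<close> and \<open>\<infinity>\<close>.\<close>

definition smt_term :: "'a::ultrametric_field \<Rightarrow> 'a fls \<Rightarrow> 'a \<Rightarrow> real" where
  "smt_term e F d = zp F d + zp (F - fls_const e) d - zp (fls_deriv F) d + pb F d"

lemma second_main_two:
  fixes F :: "'a::{ultrametric_field, complete_space, alg_closed_field, field_char_0} fls"
  assumes F: "F \<in> mer" "fls_deriv F \<noteq> 0" and e: "e \<noteq> 0"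
  shows "(\<lambda>r. T r F) \<preceq> (\<lambda>r. cnt r (smt_term e F))"
  using second_main[OF F, of "{0, e}"] e by (simp add: smt_term_def[abs_def])

lemma lf_smt_term:
  fixes F :: "'a::{ultrametric_field, complete_space, alg_closed_field, field_char_0} fls"
  assumes F: "F \<in> mer" "fls_deriv F \<noteq> 0"
  shows "lf (smt_term e F)"
  unfolding smt_term_def[abs_def]
  by (intro lf_add lf_diff lf_zp lf_pb mer_deriv mer_diff mer_const F fls_nonconst[OF F(2)])

context
  fixes d e :: "'a::{ultrametric_field, complete_space, field_char_0}" and F :: "'a fls"
  assumes d: "abv d < R" and F: "F \<in> mer" "fls_deriv F \<noteq> 0" and e: "e \<noteq> 0"
begin

lemma local_orders:
  obtains "ord d F < 0" "ord d (F - fls_const e) = ord d F" "ord d (fls_deriv F) = ord d F - 1"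
  | "0 < ord d F" "ord d (F - fls_const e) = 0" "ord d (fls_deriv F) = ord d F - 1"
  | "ord d F = 0" "0 < ord d (F - fls_const e)" "ord d (fls_deriv F) = ord d (F - fls_const e) - 1"
  | "ord d F = 0" "ord d (F - fls_const e) = 0" "0 \<le> ord d (fls_deriv F)"
proof -
  note nc = fls_nonconst[OF F(2)]
  have Fe: "F - fls_const e \<in> mer" using F by (intro mer_diff) auto
  have dF: "fls_deriv (F - fls_const e) = fls_deriv F" by simp
  consider "ord d F < 0" | "0 < ord d F" | "ord d F = 0" by linarith
  then show ?thesis
  proof cases
    case 1
    then show ?thesis using that(1) pole_shift(1)[OF d F(1) nc(2) nc(1)] ord_deriv(2)[OF d F(1) nc(2)] by simp
  next
    case 2
    have "ord d (fls_const (- e) + F) = ord d (fls_const (- e))"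
      using 2 e F nc by (intro ord_add_eq(2)[OF d]) (simp_all add: ord_const[OF d] del: fls_const_uminus)
    then have "ord d (F - fls_const e) = 0" using e ord_const[OF d, of "- e"] by simp
    then show ?thesis using 2 that(2) ord_deriv(2)[OF d F(1) nc(2)] by simp
  next
    case 3
    then have "0 \<le> ord d (F - fls_const e)" using pole_shift(2)[OF d F(1) nc(2) nc(1)] by simp
    then consider "0 < ord d (F - fls_const e)" | "ord d (F - fls_const e) = 0" by linarith
    then show ?thesis
    proof cases
      case 1
      then have "ord d (fls_deriv F) = ord d (F - fls_const e) - 1"
        using ord_deriv(2)[OF d Fe nc(1)] unfolding dF by simp
      then show ?thesis using 1 3 that(3) by simp
    next
      case 2
      then show ?thesis using 3 that(4) ord_deriv_nonneg[OF d F(1) nc(2) _ F(2)] by simp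
    qed
  qed
qed

text \<open>An \<open>e\<close>-point of order \<open>m\<close> contributes \<open>m\<close> and
  loses \<open>m - 1\<close> to the zero of \<open>F'\<close>, hence 1 whatever its multiplicity;
  the same cancellation occurs at zeros of \<open>F\<close>.\<close>

lemma smt_term_le:
  shows "0 < ord d (F - fls_const e) \<Longrightarrow> smt_term e F d = 1"
    and "ord d (F - fls_const e) \<le> 0 \<Longrightarrow> smt_term e F d \<le> z2 F d"
  by (cases rule: local_orders; simp add: smt_term_def zp_def pb_def z2_def)+

lemma ord_deriv_inverse_shift:
  "ord d (fls_deriv (inverse (F - fls_const e))) = ord d (fls_deriv F) - 2 * ord d (F - fls_const e)"
  "fls_deriv (inverse (F - fls_const e)) \<noteq> 0"
proof -
  note nc = fls_nonconst[OF F(2)]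
  have Fe: "F - fls_const e \<in> mer" using F by (intro mer_diff) auto
  have eq: "fls_deriv (inverse (F - fls_const e)) = - (fls_deriv F / ((F - fls_const e) * (F - fls_const e)))"
    using fls_deriv_divide[of "F - fls_const e" 1] nc(1) by (simp add: inverse_eq_divide)
  have m: "fls_deriv F / ((F - fls_const e) * (F - fls_const e)) \<in> mer" using F Fe by (intro mer_divide mer_mult mer_deriv)
  have "fls_deriv F / ((F - fls_const e) * (F - fls_const e)) \<noteq> 0" using F nc(1)[of e] by simp
  then show "fls_deriv (inverse (F - fls_const e)) \<noteq> 0" unfolding eq by simp
  have "ord d (fls_deriv (inverse (F - fls_const e))) = ord d (fls_deriv F / ((F - fls_const e) * (F - fls_const e)))"
    unfolding eq using m by (rule ord_uminus[OF d]) fact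
  also have "\<dots> = ord d (fls_deriv F) - (ord d (F - fls_const e) + ord d (F - fls_const e))"
    using ord_divide[OF d mer_deriv[OF F(1)] mer_mult[OF Fe Fe] F(2)] ord_mult[OF d Fe Fe] nc(1)[of e] by simp
  finally show "ord d (fls_deriv (inverse (F - fls_const e))) = ord d (fls_deriv F) - 2 * ord d (F - fls_const e)" by simp
qed

text \<open>A zero or pole of \<open>F\<close> contributes only 1. The second unit allowed by
  \<open>z2\<close> is available at multiplicity at least 2, exactly where the derivative of
  \<open>1 / (F - e)\<close> vanishes; at other zeros of \<open>F'\<close> the negative term
  provides it. This unit will pay for a pole of \<open>w' / w\<close>.\<close>

lemma smt_term_inverse_le:
  "ord d (F - fls_const e) \<le> 0 \<Longrightarrow>
    smt_term e F d + of_bool (ord d (fls_deriv (inverse (F - fls_const e))) \<noteq> 0) \<le> z2 F d"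
  unfolding ord_deriv_inverse_shift
  by (cases rule: local_orders; simp add: smt_term_def zp_def pb_def z2_def)

end

text \<open>For \<open>u = U / L\<close> with \<open>L = x - d\<close> the derivative \<open>u' = (L U' - U) / L\<^sup>2\<close> has no residue at
  \<open>d\<close>, hence the quotient of two such derivatives is stationary at \<open>d\<close>.\<close>

lemma ord_deriv_quotient_simple:
  fixes d :: "'a::{ultrametric_field, complete_space, field_char_0}"
  assumes d: "abv d < R" and u: "u \<in> mer" "u \<noteq> 0" "ord d u = - 1" and v: "v \<in> mer" "v \<noteq> 0" "ord d v = - 1"
    and w: "fls_deriv (fls_deriv u / fls_deriv v) \<noteq> 0"
  shows "1 \<le> ord d (fls_deriv (fls_deriv u / fls_deriv v))"
proof -
  let ?L = "lin d"
  have rep: "\<exists>A A2. loc_unit d A \<and> loc_ring d A2 \<and> fls_deriv h = A / (?L * ?L) \<and> fls_deriv A = ?L * A2"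
    if h: "h \<in> mer" "h \<noteq> 0" "ord d h = - 1" for h
  proof -
    obtain U where U: "loc_unit d U" "h = ?L powi (- 1) * U" using ordE[OF d h(1,2)] h(3) by metis
    have hU: "h = U / ?L" using U(2) by (simp add: divide_inverse mult.commute)
    let ?A = "?L * fls_deriv U - U"
    have "loc_unit d ?A"
    proof -
      have "loc_unit d (fls_const (- 1) * U + ?L * fls_deriv U)"
        using loc_unit_mult[OF d loc_unit_const[OF d, of "- 1"] U(1)] loc_ring_deriv[OF d loc_unit_ring[OF U(1)]]
        by (intro loc_unit_add_lin[OF d]) auto
      then show ?thesis by (simp add: algebra_simps)
    qed
    moreover have "fls_deriv h = ?A / (?L * ?L)"
      unfolding hU by (subst fls_deriv_divide) (simp_all add: mult.commute)
    moreover have "fls_deriv ?A = ?L * fls_deriv (fls_deriv U)" by simp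
    ultimately show ?thesis using loc_ring_deriv[OF d loc_ring_deriv[OF d loc_unit_ring[OF U(1)]]] by blast
  qed
  obtain A A2 where A: "loc_unit d A" "loc_ring d A2" "fls_deriv u = A / (?L * ?L)" "fls_deriv A = ?L * A2" using rep[OF u] by blast
  obtain B B2 where B: "loc_unit d B" "loc_ring d B2" "fls_deriv v = B / (?L * ?L)" "fls_deriv B = ?L * B2" using rep[OF v] by blast
  have nz: "B \<noteq> 0" using loc_unit_nz[OF d B(1)] .
  have AB: "fls_deriv u / fls_deriv v = A / B" using A(3) B(3) by simp
  have eq: "fls_deriv (fls_deriv u / fls_deriv v) = ?L * ((A2 * B - A * B2) * (inverse B * inverse B))"
    unfolding AB fls_deriv_divide[OF nz] A(4) B(4) using nz by (simp add: field_simps)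
  have r: "loc_ring d ((A2 * B - A * B2) * (inverse B * inverse B))"
    using A(2) B(2) loc_unit_ring[OF A(1)] loc_unit_ring[OF B(1)] loc_unit_ring[OF loc_unit_inverse[OF B(1)]]
    by (intro loc_ring_mult[OF d] loc_ring_diff[OF d])
  have n0: "(A2 * B - A * B2) * (inverse B * inverse B) \<noteq> 0" using w eq by (metis mult_zero_right)
  have "ord d (fls_deriv (fls_deriv u / fls_deriv v)) = 1 + ord d ((A2 * B - A * B2) * (inverse B * inverse B))"
    unfolding eq using ord_mult[OF d mer_lin loc_ring_mer[OF d r] lin_nz n0] ord_lin[OF d, of d] by simp
  then show ?thesis using ord_loc_ring[OF d r n0] by simp
qed

context
  fixes F G :: "'a::{ultrametric_field, complete_space, alg_closed_field, field_char_0} fls" and E :: "'a \<Rightarrow> real"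
  assumes F: "F \<in> mer" "fls_deriv F \<noteq> 0" and G: "G \<in> mer" "fls_deriv G \<noteq> 0"
    and E: "lf E" "\<And>d. E d = 0 \<or> E d = 1"
    and share: "\<And>d. abv d < R \<Longrightarrow> E d = 0 \<Longrightarrow> max 0 (ord d (F - 1)) = max 0 (ord d (G - 1))"
begin

text \<open>The second main theorems for \<open>F\<close> and \<open>G\<close> are added, and
  \<open>T r F\<close> is spent on the zeros of \<open>F - 1\<close>. A shared 1-point costs 2: a
  multiple one is paid by its multiplicity in \<open>zp (F - 1)\<close>, a simple one by
  \<open>zp (F - 1)\<close> and the zero of \<open>w' / w\<close> together. Elsewhere the simple
  poles of \<open>w' / w\<close> lie at zeros or poles of \<open>u'\<close> or \<open>v'\<close>,
  where \<open>smt_term_inverse_le\<close> pays.\<close>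

lemma sharing_generic:
  assumes w': "fls_deriv (fls_deriv (inverse (F - 1)) / fls_deriv (inverse (G - 1))) \<noteq> 0"
  shows "(\<lambda>r. T r G) \<preceq> (\<lambda>r. cnt r (\<lambda>d. z2 F d + z2 G d + 2 * E d))"
proof -
  define u where "u = inverse (F - 1)"
  define v where "v = inverse (G - 1)"
  define w where "w = fls_deriv u / fls_deriv v"
  have w'0: "fls_deriv w \<noteq> 0" using w' by (simp add: w_def u_def v_def)
  note ncF = fls_nonconst[OF F(2)] and ncG = fls_nonconst[OF G(2)]
  have F1: "F - 1 \<in> mer" "F - 1 \<noteq> 0" using mer_diff[OF F(1) mer_1] ncF(1)[of 1] by simp_all
  have G1: "G - 1 \<in> mer" "G - 1 \<noteq> 0" using mer_diff[OF G(1) mer_1] ncG(1)[of 1] by simp_all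
  have u: "u \<in> mer" "u \<noteq> 0" and v: "v \<in> mer" "v \<noteq> 0" using F1 G1 by (auto simp: u_def v_def mer_inverse)
  have z: "abv (0::'a) < R" using R_pos by simp
  have u'0: "fls_deriv u \<noteq> 0" using ord_deriv_inverse_shift(2)[OF z F, of 1] by (simp add: u_def)
  have v'0: "fls_deriv v \<noteq> 0" using ord_deriv_inverse_shift(2)[OF z G, of 1] by (simp add: v_def)
  have w: "w \<in> mer" unfolding w_def using u v by (intro mer_divide mer_deriv)
  have ordw: "ord d w = ord d (fls_deriv u) - ord d (fls_deriv v)" if "abv d < R" for d
    unfolding w_def using u v u'0 v'0 by (intro ord_divide[OF that] mer_deriv)
  have pointwise: "smt_term 1 F d + smt_term 1 G d - zp (F - 1) d - of_int (ord d (fls_deriv w / w)) \<le> z2 F d + z2 G d + 2 * E d"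
    if d: "abv d < R" for d
  proof -
    note sF = smt_term_le[OF d F, of 1, simplified] smt_term_inverse_le[OF d F, of 1, simplified, folded u_def]
    note sG = smt_term_le[OF d G, of 1, simplified] smt_term_inverse_le[OF d G, of 1, simplified, folded v_def]
    note ld = ord_log_deriv[OF d w w'0]
    have nn: "0 \<le> z2 F d" "0 \<le> z2 G d" by (simp_all add: z2_def)
    have z: "0 < ord d (F - 1) \<Longrightarrow> 1 \<le> zp (F - 1) d" "0 \<le> zp (F - 1) d" by (simp_all add: zp_def)
    have ld2: "- 1 \<le> real_of_int (ord d (fls_deriv w / w))" "ord d w = 0 \<Longrightarrow> 0 \<le> real_of_int (ord d (fls_deriv w / w))"
      using ld(2,3) by simp_all
    show ?thesis
    proof (cases "E d = 0")
      \<comment> \<open>At an exceptional point \<open>2 * E d\<close> absorbs a 1-point of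
        \<open>G\<close> and a simple pole of \<open>w' / w\<close>; a 1-point of \<open>F\<close>
        is absorbed by \<open>zp (F - 1)\<close>.\<close>
      case False
      then have "E d = 1" using E(2) by blast
      moreover have "smt_term 1 F d \<le> zp (F - 1) d + z2 F d"
      proof (cases "0 < ord d (F - 1)")
        case False
        then have "smt_term 1 F d \<le> z2 F d" using sF(2) by simp
        then show ?thesis using z(2) by linarith
      qed (use sF(1) nn z(1) in simp)
      moreover have "smt_term 1 G d \<le> 1 + z2 G d"
        using sG(1,2) nn(2) by (cases "0 < ord d (G - 1)") (force simp: not_less)+
      ultimately show ?thesis using ld2(1) by linarith
    next
      case True
      note sh = share[OF d True]
      show ?thesis
      proof (cases "0 < ord d (F - 1)")
        case True
        then have eq: "ord d (G - 1) = ord d (F - 1)" "0 < ord d (G - 1)" using sh by (auto simp: max_def split: if_splits)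
        have ou: "ord d u = - ord d (F - 1)" "ord d v = - ord d (F - 1)"
          using ord_inverse[OF d F1] ord_inverse[OF d G1] eq by (simp_all add: u_def v_def)
        \<comment> \<open>\<open>u\<close> and \<open>v\<close> have poles of equal order here, so
          the poles of \<open>u'\<close> and \<open>v'\<close> cancel in \<open>w\<close>.\<close>
        have w0: "ord d w = 0" using ordw[OF d] ord_deriv(2)[OF d u] ord_deriv(2)[OF d v] ou True by simp
        have "1 \<le> real_of_int (ord d (fls_deriv w / w))" if "ord d (F - 1) = 1"
        proof -
          have "1 \<le> ord d (fls_deriv w)"
            unfolding w_def using ou that w'0 by (intro ord_deriv_quotient_simple[OF d u _ v]) (simp_all add: w_def)
          then show ?thesis using ld(1) w0 by simp
        qed
        moreover have "2 \<le> zp (F - 1) d" if "ord d (F - 1) \<noteq> 1" using that True by (simp add: zp_def)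
        ultimately show ?thesis
          using sF(1) sG(1) True eq ld2(2)[OF w0] nn z(1) \<open>E d = 0\<close> by (cases "ord d (F - 1) = 1") auto
      next
        case False
        then have "ord d (G - 1) \<le> 0" using sh by (auto simp: max_def split: if_splits)
        moreover have "ord d w \<noteq> 0 \<Longrightarrow> ord d (fls_deriv u) \<noteq> 0 \<or> ord d (fls_deriv v) \<noteq> 0" using ordw[OF d] by auto
        ultimately have "- real_of_int (ord d (fls_deriv w / w))
            \<le> of_bool (ord d (fls_deriv u) \<noteq> 0) + of_bool (ord d (fls_deriv v) \<noteq> 0)"
          and "smt_term 1 G d + of_bool (ord d (fls_deriv v) \<noteq> 0) \<le> z2 G d"
          using sG(3) ld2 by (cases "ord d w = 0"; auto)+
        moreover have "smt_term 1 F d + of_bool (ord d (fls_deriv u) \<noteq> 0) \<le> z2 F d" using sF(3) False by simp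
        ultimately show ?thesis using z(2) \<open>E d = 0\<close> by linarith
      qed
    qed
  qed
  have m: "fls_deriv w / w \<in> mer" "fls_deriv w / w \<noteq> 0"
    using w w'0 by (auto intro: mer_divide mer_deriv)
  note lfs = lf_smt_term[OF F, of 1] lf_smt_term[OF G, of 1] lf_zp[OF F1] lf_ord[OF m]
  obtain C1 where C1: "\<And>r. \<rho> \<le> r \<Longrightarrow> r < R \<Longrightarrow> T r F \<le> cnt r (smt_term 1 F) + C1"
    using second_main_two[OF F, of 1] unfolding bdle_def by auto
  obtain C2 where C2: "\<And>r. \<rho> \<le> r \<Longrightarrow> r < R \<Longrightarrow> T r G \<le> cnt r (smt_term 1 G) + C2"
    using second_main_two[OF G, of 1] unfolding bdle_def by auto
  obtain C3 where C3: "\<And>r. \<rho> \<le> r \<Longrightarrow> r < R \<Longrightarrow> T r (F - 1) \<le> T r F + C3"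
    using T_shift[OF F(1) ncF(2) ncF(1), of 1] unfolding bdle_def by auto
  obtain C4 where C4: "\<And>r. \<rho> \<le> r \<Longrightarrow> r < R \<Longrightarrow> cnt r (\<lambda>d. of_int (ord d (fls_deriv w / w))) \<le> 0 + C4"
    using cnt_log_deriv[OF w w'0] unfolding bdle_def by blast
  show ?thesis
  proof (rule bdleI)
    fix r assume r: "\<rho> \<le> r" "r < R"
    have "cnt r (\<lambda>d. smt_term 1 F d + smt_term 1 G d - zp (F - 1) d - of_int (ord d (fls_deriv w / w)))
      \<le> cnt r (\<lambda>d. z2 F d + z2 G d + 2 * E d)"
      by (intro cnt_mono lf_add lf_diff lfs lf_cmult lf_z2 F G E ncF ncG r pointwise)
    moreover have "cnt r (\<lambda>d. smt_term 1 F d + smt_term 1 G d - zp (F - 1) d - of_int (ord d (fls_deriv w / w)))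
      = cnt r (smt_term 1 F) + cnt r (smt_term 1 G) - cnt r (zp (F - 1)) - cnt r (\<lambda>d. of_int (ord d (fls_deriv w / w)))"
      using lfs r by (simp add: cnt_diff cnt_add lf_add lf_diff)
    ultimately show "T r G \<le> cnt r (\<lambda>d. z2 F d + z2 G d + 2 * E d) + (C1 + C2 + C3 + C4)"
      using C1[OF r] C2[OF r] C3[OF r] C4[OF r] T_zp[of r "F - 1"] by linarith
  qed
qed

text \<open>Constant \<open>w\<close> means \<open>u = A v + B\<close>, and the values 0 and -1 of
  \<open>u\<close> or \<open>v\<close> correspond to infinity and 0 of \<open>F\<close> or
  \<open>G\<close>. If another value \<open>p\<close> of \<open>v\<close> is sent to 0 or -1, the
  corresponding points of \<open>G\<close> are poles or zeros of \<open>F\<close>, and the second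
  main theorem for \<open>G\<close> applies. Otherwise the affine map permutes 0 and -1, which
  leaves \<open>F = G\<close> and \<open>F * G = 1\<close>.\<close>

lemma sharing_degenerate:
  assumes w': "fls_deriv (fls_deriv (inverse (F - 1)) / fls_deriv (inverse (G - 1))) = 0"
  shows "F = G \<or> F * G = 1 \<or> (\<lambda>r. T r G) \<preceq> (\<lambda>r. cnt r (\<lambda>d. z2 F d + z2 G d + 2 * E d))"
proof -
  define u where "u = inverse (F - 1)"
  define v where "v = inverse (G - 1)"
  note ncF = fls_nonconst[OF F(2)] and ncG = fls_nonconst[OF G(2)]
  have F1: "F - 1 \<in> mer" "F - 1 \<noteq> 0" using mer_diff[OF F(1) mer_1] ncF(1)[of 1] by simp_all
  have G1: "G - 1 \<in> mer" "G - 1 \<noteq> 0" using mer_diff[OF G(1) mer_1] ncG(1)[of 1] by simp_all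
  have u: "u \<in> mer" "u \<noteq> 0" and v: "v \<in> mer" "v \<noteq> 0" using F1 G1 by (auto simp: u_def v_def mer_inverse)
  have z: "abv (0::'a) < R" using R_pos by simp
  have u'0: "fls_deriv u \<noteq> 0" using ord_deriv_inverse_shift(2)[OF z F, of 1] by (simp add: u_def)
  have v'0: "fls_deriv v \<noteq> 0" using ord_deriv_inverse_shift(2)[OF z G, of 1] by (simp add: v_def)
  obtain A where A: "fls_deriv u / fls_deriv v = fls_const A"
    using w' fls_deriv_eq_0_iff unfolding u_def v_def by blast
  have A0: "A \<noteq> 0" using A u'0 v'0 by auto
  have "fls_deriv u = fls_const A * fls_deriv v" using A v'0 by (simp add: field_simps)
  then have "fls_deriv u = fls_deriv (fls_const A * v)" by simp
  then have "\<exists>c. u = fls_const c + fls_const A * v" by (simp only: fls_deriv_eq_iff_ex)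
  then obtain B where B: "u = fls_const A * v + fls_const B" by (metis add.commute)
  have third: "(\<lambda>r. T r G) \<preceq> (\<lambda>r. cnt r (\<lambda>d. z2 F d + z2 G d + 2 * E d))"
    if p: "p \<noteq> 0" "p \<noteq> - 1" "A * p + B = 0 \<or> A * p + B = - 1" for p
  proof -
    \<comment> \<open>The value of \<open>G\<close> at which \<open>1 / (G - 1)\<close> equals
      \<open>p\<close>; \<open>p \<noteq> - 1\<close> gives \<open>e \<noteq> 0\<close>.\<close>
    define e where "e = 1 + 1 / p"
    have e: "e \<noteq> 0" "e \<noteq> 1" using p by (auto simp: e_def field_simps add_eq_0_iff)
    have pw: "smt_term e G d \<le> z2 F d + z2 G d + 2 * E d" if d: "abv d < R" for d
    proof (cases "0 < ord d (G - fls_const e)")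
      case True
      have nz: "G - fls_const e \<noteq> 0" using ncG(1) .
      have Ge: "G - fls_const e \<in> mer" using G by (intro mer_diff) auto
      have vp: "v - fls_const p = fls_const (- p) * ((G - fls_const e) * v)"
      proof -
        have "fls_const p * fls_const (1 / p) = 1" using p by simp
        then have "fls_const p * fls_const e = fls_const p + 1" unfolding e_def by (simp add: fls_plus_const[symmetric] distrib_left del: fls_const_mult_const)
        moreover have "v * (G - 1) = 1" using G1 by (simp add: v_def)
        then have "G * v = 1 + v" by (simp add: algebra_simps)
        ultimately show ?thesis by (simp add: algebra_simps del: fls_const_mult_const)
      qed
      have "ord d (fls_const (e - 1) + (G - fls_const e)) = ord d (fls_const (e - 1))"
        using True e Ge nz by (intro ord_add_eq(2)[OF d]) (simp_all add: ord_const[OF d])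
      moreover have "fls_const (e - 1) + (G - fls_const e) = G - 1" by (simp flip: fls_minus_const)
      ultimately have "ord d (G - 1) = 0" using ord_const[OF d, of "e - 1"] e by simp
      then have ov: "ord d v = 0" using ord_inverse[OF d G1] by (simp add: v_def)
      have "u - fls_const (A * p + B) = fls_const A * (v - fls_const p)"
        unfolding B by (simp add: algebra_simps flip: fls_plus_const)
      also have "\<dots> = fls_const (- (A * p)) * ((G - fls_const e) * v)" unfolding vp by (simp add: mult.assoc[symmetric])
      finally have up: "u - fls_const (A * p + B) = fls_const (- (A * p)) * ((G - fls_const e) * v)" .
      have upn: "u - fls_const (A * p + B) \<noteq> 0" "u - fls_const (A * p + B) \<in> mer"
        unfolding up using A0 p nz v Ge by (auto intro!: mer_mult mer_uminus)
      have "ord d (u - fls_const (A * p + B)) = ord d (G - fls_const e)"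
        unfolding up using A0 p nz v Ge ov
        by (subst ord_mult[OF d mer_const]) (auto simp: ord_mult[OF d] ord_const[OF d] mer_mult simp del: fls_const_uminus)
      then have pos: "0 < ord d (u - fls_const (A * p + B))" using True by simp
      have "ord d F \<noteq> 0"
        using p(3)
      proof
        assume "A * p + B = 0"
        then have "0 < ord d u" using pos by simp
        then have "ord d (F - 1) < 0" using ord_inverse[OF d F1] by (simp add: u_def)
        then show ?thesis using pole_shift(2)[OF d F(1) ncF(2) ncF(1), of 1] by auto
      next
        assume *: "A * p + B = - 1"
        then have pos': "0 < ord d (u + 1)" "u + 1 \<in> mer" "u + 1 \<noteq> 0" using pos upn by (simp_all add: fls_const_uminus)
        have "ord d (- 1 + (u + 1)) = ord d (- 1)"
          using pos' ord_const[OF d, of "- 1"] mer_const[of "- 1"] by (intro ord_add_eq(2)[OF d]) simp_all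
        then have "ord d u = 0" using ord_const[OF d, of "- 1"] by simp
        then have "ord d (F - 1) = 0" using ord_inverse[OF d F1] by (simp add: u_def)
        moreover have "F = (u + 1) * (F - 1)" using F1(2) by (simp add: u_def field_simps)
        then have "ord d F = ord d (u + 1) + ord d (F - 1)" using ord_mult[OF d pos'(2) F1(1) pos'(3) F1(2)] by metis
        ultimately show ?thesis using pos' by simp
      qed
      then have "1 \<le> z2 F d" by (simp add: z2_def)
      moreover have "0 \<le> z2 G d" "0 \<le> E d" using E(2)[of d] by (auto simp: z2_def)
      ultimately show ?thesis using smt_term_le(1)[OF d G e(1) True] by simp
    next
      case False
      have "0 \<le> z2 F d" "0 \<le> E d" using E(2)[of d] by (auto simp: z2_def)
      then show ?thesis using smt_term_le(2)[OF d G e(1)] False by simp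
    qed
    have "(\<lambda>r. T r G) \<preceq> (\<lambda>r. cnt r (smt_term e G))" by (rule second_main_two[OF G e(1)])
    also have "\<dots> \<preceq> (\<lambda>r. cnt r (\<lambda>d. z2 F d + z2 G d + 2 * E d))"
      by (intro bdle_le cnt_mono lf_smt_term lf_add lf_cmult lf_z2 F G E ncF ncG pw)
    finally show ?thesis .
  qed
  show ?thesis
  proof (cases "\<exists>p. p \<noteq> 0 \<and> p \<noteq> - 1 \<and> (A * p + B = 0 \<or> A * p + B = - 1)")
    case True
    then show ?thesis using third by blast
  next
    case False
    \<comment> \<open>The preimages of 0 and -1 under the affine map must now themselves be 0 or
      -1.\<close>
    moreover have "A * (- B / A) + B = 0" "A * ((- 1 - B) / A) + B = - 1" using A0 by simp_all
    ultimately have 1: "- B / A = 0 \<or> - B / A = - 1" "(- 1 - B) / A = 0 \<or> (- 1 - B) / A = - 1"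
      by blast+
    have "B = 0 \<and> A = 1 \<or> B = - 1 \<and> A = - 1"
      using 1 A0 by (auto simp: field_simps)
    then show ?thesis
    proof
      assume "B = 0 \<and> A = 1"
      then have "u = v" using B by simp
      then show ?thesis by (simp add: u_def v_def)
    next
      assume "B = - 1 \<and> A = - 1"
      then have "u = - v - 1" using B by (simp add: fls_const_uminus)
      then have uv: "u + v = - 1" by simp
      have "u * (F - 1) = 1" "v * (G - 1) = 1" using F1 G1 by (simp_all add: u_def v_def)
      then have "(u * (F - 1)) * (G - 1) + (v * (G - 1)) * (F - 1) = (G - 1) + (F - 1)" by simp
      moreover have "(u * (F - 1)) * (G - 1) + (v * (G - 1)) * (F - 1) = (u + v) * ((F - 1) * (G - 1))"
        by (simp add: algebra_simps)
      ultimately have "- ((F - 1) * (G - 1)) = (G - 1) + (F - 1)" by (simp add: uv)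
      then have "F * G = 1" by (simp add: algebra_simps)
      then show ?thesis by simp
    qed
  qed
qed

theorem sharing_one:
  "F = G \<or> F * G = 1 \<or> (\<lambda>r. T r G) \<preceq> (\<lambda>r. cnt r (\<lambda>d. z2 F d + z2 G d + 2 * E d))"
  using sharing_generic sharing_degenerate by blast

end

end

section \<open>Differential polynomials \<open>f' P'(f)\<close>\<close>

lemma size_proots_alg_closed:
  fixes p :: "'a::alg_closed_field poly"
  shows "size (proots p) = degree p"
proof (cases "p = 0")
  case False
  obtain A where A: "size A = degree p" "p = smult (lead_coeff p) (\<Prod>x\<in>#A. [:- x, 1:])"
    using alg_closed_imp_factorization[OF False] by auto
  have "proots (\<Prod>x\<in>#A. [:- x, 1:]) = A"
  proof (induction A)
    case (add x A)
    have "(\<Prod>x\<in>#A. [:- x, 1:]) \<noteq> 0" by (auto simp: prod_mset_zero_iff)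
    then show ?case using add by (simp add: proots_mult del: mult_pCons_left)
  qed simp
  then have "proots p = A" using False by (subst A(2)) simp
  then show ?thesis using A(1) by simp
qed simp

lemma sum_order_roots:
  fixes p :: "'a::alg_closed_field poly"
  assumes "p \<noteq> 0"
  shows "(\<Sum>x | poly p x = 0. order x p) = degree p"
proof -
  have "(\<Sum>x\<in>set_mset (proots p). count (proots p) x) = degree p"
    by (simp only: size_multiset_overloaded_eq[symmetric] size_proots_alg_closed)
  then show ?thesis using assms by (simp add: set_count_proots)
qed

context
  fixes P :: "'a::{alg_closed_field, field_char_0} poly" and b :: 'a and a :: "nat \<Rightarrow> 'a" and I :: "nat set" and K :: "nat \<Rightarrow> nat"
  assumes dP: "pderiv P = smult b (\<Prod>i\<in>I. [:- a i, 1:] ^ K i)" and b: "b \<noteq> 0"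
    and I: "finite I" "inj_on a I" and K: "\<And>i. i \<in> I \<Longrightarrow> 0 < K i"
begin

lemma prod_lin_power_nz: "(\<Prod>i\<in>I. [:- a i, 1:] ^ K i) \<noteq> 0"
  using I by simp

lemma pderiv_nz: "pderiv P \<noteq> 0"
  using dP b prod_lin_power_nz by simp

lemma order_pderiv_P: "order x (pderiv P) = (\<Sum>i\<in>I. if x = a i then K i else 0)"
proof -
  have "order x (pderiv P) = order x (\<Prod>i\<in>I. [:- a i, 1:] ^ K i)" using b by (simp add: dP order_smult)
  also have "\<dots> = (\<Sum>i\<in>I. order x ([:- a i, 1:] ^ K i))"
    using I(1)
  proof (induction I rule: finite_induct)
    case (insert i I)
    then show ?case by (simp add: order_mult)
  qed (simp add: order_0I)
  also have "\<dots> = (\<Sum>i\<in>I. if x = a i then K i else 0)"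
    by (intro sum.cong) (auto simp: order_power_n_n intro!: order_0I)
  finally show ?thesis .
qed

lemma degree_pderiv_P: "degree (pderiv P) = (\<Sum>i\<in>I. K i)"
  using b by (simp add: dP degree_prod_eq_sum_degree degree_power_eq)

text \<open>A root of \<open>P - e\<close> has order one more than in \<open>P'\<close>, so the
  number of distinct roots is \<open>N + 1\<close>, with \<open>N\<close> the degree of
  \<open>P'\<close>, minus the orders of \<open>P'\<close> at these roots. The exponent
  \<open>K j\<close> is subtracted precisely when \<open>a j\<close> is a root.\<close>

lemma roots_shift:
  assumes j: "j \<in> I"
  shows "poly P (a j) \<noteq> e \<Longrightarrow> K j < card {x. poly (P - [:e:]) x = 0}"
    and "card {x. poly (P - [:poly P (a j):]) x = 0} \<le> Suc ((\<Sum>i\<in>I. K i) - K j)"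
    and "P - [:e:] \<noteq> 0"
proof -
  let ?N = "\<Sum>i\<in>I. K i"
  have KN: "K j \<le> ?N" "0 < K j" using I j K by (auto intro: member_le_sum)
  have d: "pderiv (P - [:e:]) = pderiv P" for e by (simp add: pderiv_diff pderiv_pCons)
  have nz: "P - [:e:] \<noteq> 0" for e using pderiv_nz d[of e] by auto
  then show "P - [:e:] \<noteq> 0" .
  have deg: "degree (P - [:e:]) = Suc ?N" for e
  proof -
    have "degree (P - [:e:]) - 1 = ?N" using degree_pderiv[of "P - [:e:]"] by (simp add: d degree_pderiv_P)
    then show ?thesis using KN by simp
  qed
  have fin: "finite {x. poly (P - [:e:]) x = 0}" for e using poly_roots_finite[OF nz] .
  have ord: "order x (P - [:e:]) = Suc (order x (pderiv P))" if "poly (P - [:e:]) x = 0" for x e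
    using order_pderiv[OF nz that] unfolding d .
  have sum: "Suc ?N = card {x. poly (P - [:e:]) x = 0} + (\<Sum>x | poly (P - [:e:]) x = 0. order x (pderiv P))" for e
  proof -
    have "Suc ?N = (\<Sum>x | poly (P - [:e:]) x = 0. order x (P - [:e:]))" using sum_order_roots[OF nz] deg by simp
    also have "\<dots> = (\<Sum>x | poly (P - [:e:]) x = 0. 1 + order x (pderiv P))" using ord by (intro sum.cong) auto
    finally show ?thesis by (simp only: sum.distrib) simp
  qed
  show "K j < card {x. poly (P - [:e:]) x = 0}" if "poly P (a j) \<noteq> e"
  proof -
    let ?B = "{x. poly (P - [:e:]) x = 0}"
    have "(\<Sum>x\<in>?B. order x (pderiv P)) = (\<Sum>i\<in>I. \<Sum>x\<in>?B. if x = a i then K i else 0)"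
      unfolding order_pderiv_P by (rule sum.swap)
    also have "\<dots> = (\<Sum>i\<in>I. if a i \<in> ?B then K i else 0)"
      using fin by (intro sum.cong sum.delta') auto
    also have "\<dots> = (\<Sum>i\<in>I - {j}. if a i \<in> ?B then K i else 0)"
      using I that j by (subst sum.remove[OF I(1) j]) auto
    also have "\<dots> \<le> (\<Sum>i\<in>I - {j}. K i)" by (intro sum_mono) auto
    also have "\<dots> = ?N - K j" using sum.remove[OF I(1) j, of K] by simp
    finally show ?thesis using sum[of e] KN by simp
  qed
  show "card {x. poly (P - [:poly P (a j):]) x = 0} \<le> Suc (?N - K j)"
  proof -
    let ?B = "{x. poly (P - [:poly P (a j):]) x = 0}"
    have "a j \<in> ?B" by simp
    then have "order (a j) (pderiv P) \<le> (\<Sum>x\<in>?B. order x (pderiv P))" using fin by (intro member_le_sum) auto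
    moreover have "K j \<le> order (a j) (pderiv P)"
      unfolding order_pderiv_P using I j by (subst sum.remove[OF I(1) j]) simp
    ultimately show ?thesis using sum[of "poly P (a j)"] by simp
  qed
qed

end

text \<open>All zeros of \<open>P'\<close> are indexed alike; the distinguished large exponent
  enters only as the index \<open>j\<close> in \<open>equal_dp\<close> and through the weights in
  \<open>product_dp\<close>.\<close>

locale diff_poly = disc R \<rho> for R \<rho> :: real +
  fixes P :: "'a::{ultrametric_field, complete_space, alg_closed_field, field_char_0} poly"
    and b :: 'a and a :: "nat \<Rightarrow> 'a" and I :: "nat set" and K :: "nat \<Rightarrow> nat"
  assumes dP: "pderiv P = smult b (\<Prod>i\<in>I. [:- a i, 1:] ^ K i)" and b: "b \<noteq> 0"
    and I: "finite I" "inj_on a I" and K: "\<And>i. i \<in> I \<Longrightarrow> 0 < K i"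
begin

abbreviation "N \<equiv> \<Sum>i\<in>I. K i"

definition dp :: "'a fls \<Rightarrow> 'a fls" where
  "dp f = fls_deriv f * fls_poly (pderiv P) f"

lemma pderiv_P_nz: "pderiv P \<noteq> 0"
  by (rule pderiv_nz[OF dP b I K])

lemma degree_pderiv_N: "degree (pderiv P) = N"
  by (rule degree_pderiv_P[OF dP b I K])

context
  fixes f :: "'a fls"
  assumes f: "f \<in> mer" "fls_deriv f \<noteq> 0"
begin

lemma fls_poly_pderiv: "fls_poly (pderiv P) f = fls_const b * (\<Prod>i\<in>I. (f - fls_const (a i)) ^ K i)"
  by (simp only: dP fls_poly_smult fls_poly_prod fls_poly_power fls_poly_lin)

lemma shift_mer: "f - fls_const e \<in> mer" "f - fls_const e \<noteq> 0"
  using f fls_nonconst(1)[OF f(2)] by (auto intro: mer_diff)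

lemma dp_mer: "dp f \<in> mer" "dp f \<noteq> 0"
  using f fls_poly_nz[OF f pderiv_P_nz] by (auto simp: dp_def intro!: mer_mult mer_deriv mer_poly)

lemma ord_poly_pderiv:
  assumes d: "abv d < R"
  shows "ord d (fls_poly (pderiv P) f) = (\<Sum>i\<in>I. int (K i) * ord d (f - fls_const (a i)))"
proof -
  have "(\<Prod>i\<in>I. (f - fls_const (a i)) ^ K i) \<in> mer" "(\<Prod>i\<in>I. (f - fls_const (a i)) ^ K i) \<noteq> 0"
    using I shift_mer(2) by (auto intro!: mer_prod mer_power shift_mer(1))
  then have "ord d (fls_poly (pderiv P) f) = ord d (fls_const b) + ord d (\<Prod>i\<in>I. (f - fls_const (a i)) ^ K i)"
    unfolding fls_poly_pderiv using b by (intro ord_mult[OF d]) auto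
  also have "\<dots> = (\<Sum>i\<in>I. ord d ((f - fls_const (a i)) ^ K i))"
    using b shift_mer(2) by (subst ord_prod[OF d]) (auto simp: ord_const[OF d] intro!: mer_power shift_mer(1))
  finally show ?thesis using ord_power[OF d shift_mer] by simp
qed

lemma ord_dp:
  assumes d: "abv d < R"
  shows "ord d (dp f) = ord d (fls_deriv f) + ord d (fls_poly (pderiv P) f)"
  unfolding dp_def using f fls_poly_nz[OF f pderiv_P_nz] by (intro ord_mult[OF d] mer_deriv mer_poly)

text \<open>The dictionary between \<open>f\<close> and \<open>dp f\<close> on which all pointwise
  estimates below rest. In the second case the index is unique because the \<open>a i\<close> are
  distinct.\<close>

lemma dp_cases [consumes 1, case_names pole val other]:
  assumes d: "abv d < R"
  obtains (pole) q where "0 < q" "ord d f = - q" "\<And>i. i \<in> I \<Longrightarrow> ord d (f - fls_const (a i)) = - q"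
      "ord d (fls_deriv f) = - q - 1" "ord d (dp f) = - (q * (int N + 1) + 1)"
  | (val) i m where "i \<in> I" "0 < m" "ord d (f - fls_const (a i)) = m" "\<And>j. j \<in> I - {i} \<Longrightarrow> ord d (f - fls_const (a j)) = 0"
      "0 \<le> ord d f" "ord d (fls_deriv f) = m - 1" "ord d (dp f) = m * (int (K i) + 1) - 1"
  | (other) "0 \<le> ord d f" "\<And>i. i \<in> I \<Longrightarrow> ord d (f - fls_const (a i)) = 0" "0 \<le> ord d (fls_deriv f)"
      "ord d (dp f) = ord d (fls_deriv f)"
proof -
  note nc = fls_nonconst[OF f(2)]
  show ?thesis
  proof (cases "ord d f < 0")
    case True
    define q where "q = - ord d f"
    have i: "ord d (f - fls_const (a i)) = - q" for i
      using pole_shift(1)[OF d f(1) nc(2) nc(1) True] by (simp add: q_def)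
    have f': "ord d (fls_deriv f) = - q - 1" using ord_deriv(2)[OF d f(1) nc(2)] True by (simp add: q_def)
    show ?thesis
    proof (rule pole[of q])
      show "ord d (dp f) = - (q * (int N + 1) + 1)"
      proof -
        have "(\<Sum>i\<in>I. int (K i) * - q) = int N * - q" by (simp only: sum_distrib_right of_nat_sum)
        then show ?thesis using ord_dp[OF d] ord_poly_pderiv[OF d] f' i by (simp add: algebra_simps)
      qed
    qed (use True i f' in \<open>auto simp: q_def\<close>)
  next
    case False
    then have nn: "0 \<le> ord d (f - fls_const e)" for e using pole_shift(2)[OF d f(1) nc(2) nc(1)] by simp
    show ?thesis
    proof (cases "\<exists>i\<in>I. ord d (f - fls_const (a i)) \<noteq> 0")
      case True
      then obtain i where i: "i \<in> I" "ord d (f - fls_const (a i)) \<noteq> 0" by blast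
      define m where "m = ord d (f - fls_const (a i))"
      have m: "0 < m" using i nn[of "a i"] by (simp add: m_def)
      have j: "ord d (f - fls_const (a j)) = 0" if "j \<in> I - {i}" for j
      proof -
        have ne: "a i - a j \<noteq> 0" using I i that by (auto dest: inj_onD)
        have "ord d (fls_const (a i - a j) + (f - fls_const (a i))) = ord d (fls_const (a i - a j))"
          using m ne shift_mer by (intro ord_add_eq(2)[OF d]) (simp_all add: ord_const[OF d] m_def)
        moreover have "fls_const (a i - a j) + (f - fls_const (a i)) = f - fls_const (a j)" by (simp flip: fls_minus_const)
        ultimately show ?thesis using ord_const[OF d ne] by simp
      qed
      have "fls_deriv (f - fls_const (a i)) = fls_deriv f" by simp
      then have f': "ord d (fls_deriv f) = m - 1" using ord_deriv(2)[OF d shift_mer] i(2) by (simp add: m_def)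
      show ?thesis
      proof (rule val[of i m])
        have "(\<Sum>j\<in>I. int (K j) * ord d (f - fls_const (a j))) = int (K i) * m"
          using j by (subst sum.remove[OF I(1) i(1)]) (simp add: m_def)
        then show "ord d (dp f) = m * (int (K i) + 1) - 1"
          using ord_dp[OF d] ord_poly_pderiv[OF d] f' by (simp add: algebra_simps)
      qed (use i m j f' False in \<open>auto simp: m_def\<close>)
    next
      case nov: False
      show ?thesis
        using nov False ord_dp[OF d] ord_poly_pderiv[OF d] ord_deriv_nonneg[OF d f(1) nc(2) _ f(2)] by (intro other) auto
    qed
  qed
qed

lemma sum_zp_cases:
  assumes d: "abv d < R"
  shows "i \<in> I \<Longrightarrow> (\<And>j. j \<in> I - {i} \<Longrightarrow> ord d (f - fls_const (a j)) \<le> 0) \<Longrightarrow> (\<Sum>j\<in>I. c j * zp (f - fls_const (a j)) d) = c i * zp (f - fls_const (a i)) d"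
    and "(\<And>j. j \<in> I \<Longrightarrow> ord d (f - fls_const (a j)) \<le> 0) \<Longrightarrow> (\<Sum>j\<in>I. c j * zp (f - fls_const (a j)) d) = 0"
proof -
  assume "i \<in> I" and j: "\<And>j. j \<in> I - {i} \<Longrightarrow> ord d (f - fls_const (a j)) \<le> 0"
  then show "(\<Sum>j\<in>I. c j * zp (f - fls_const (a j)) d) = c i * zp (f - fls_const (a i)) d"
    using sum.remove[OF I(1), of i "\<lambda>j. c j * zp (f - fls_const (a j)) d"] by (simp add: zp_def)
next
  show "(\<And>j. j \<in> I \<Longrightarrow> ord d (f - fls_const (a j)) \<le> 0) \<Longrightarrow> (\<Sum>j\<in>I. c j * zp (f - fls_const (a j)) d) = 0"
    by (simp add: zp_def)
qed

text \<open>Poles of \<open>f'\<close> and \<open>P'(f)\<close> occur only at poles of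
  \<open>f\<close>, where neither factor vanishes, so zeros of the product simply add up. As for
  proximity to 0: where \<open>f\<close> is large, \<open>P'(f)\<close> is not small, and where
  \<open>f\<close> is bounded so is \<open>f'\<close>, which therefore cannot compensate for a small
  \<open>P'(f)\<close>.\<close>

lemma T_dp_lower: "(\<lambda>r. real N * T r f + cnt r (zp (fls_deriv f))) \<preceq> (\<lambda>r. T r (dp f))"
proof -
  let ?Q = "pderiv P" and ?q = "fls_poly (pderiv P) f"
  note nc = fls_nonconst[OF f(2)]
  have q: "?q \<in> mer" "?q \<noteq> 0" using mer_poly[OF f(1)] fls_poly_nz[OF f pderiv_P_nz] by auto
  have f': "fls_deriv f \<in> mer" using f by (intro mer_deriv)
  obtain C where C: "1 \<le> C" "\<And>r. \<rho> \<le> r \<Longrightarrow> r < R \<Longrightarrow> C < gm r f \<Longrightarrow> psi r ?q = ln (abv (lead_coeff ?Q)) + degree ?Q * psi r f"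
    by (rule gm_poly[OF f pderiv_P_nz]) (rule that; assumption)
  define M where "M = \<bar>ln (abv (lead_coeff ?Q))\<bar> + ln C + \<bar>ln \<rho>\<bar>"
  have lnC: "0 \<le> ln C" using C(1) by simp
  have M: "max 0 (- psi r ?q) \<le> max 0 (- psi r (dp f)) + M" if r: "\<rho> \<le> r" "r < R" for r
  proof (cases "C < gm r f")
    case True
    then have "0 \<le> psi r f" using C(1) by (simp add: psi_def)
    then have "0 \<le> degree ?Q * psi r f" by simp
    then show ?thesis using C(2)[OF r True] lnC unfolding M_def by linarith
  next
    case False
    then have "psi r f \<le> ln C" unfolding psi_def
      using gm_pos[of r f] f nc r rho_pos by (intro ln_mono) auto
    moreover have "psi r (dp f) = psi r (fls_deriv f) + psi r ?q"
      unfolding dp_def by (rule psi_mult[OF f' q(1) f(2) q(2) r])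
    ultimately show ?thesis using psi_deriv_le[OF f r] lnC unfolding M_def by linarith
  qed
  have zp: "cnt r (zp (dp f)) = cnt r (zp ?q) + cnt r (zp (fls_deriv f))" if r: "r < R" for r
  proof -
    have "cnt r (zp (dp f)) = cnt r (\<lambda>d. zp ?q d + zp (fls_deriv f) d)"
    proof (rule cnt_cong[OF r])
      fix d :: 'a assume d: "abv d < R"
      show "zp (dp f) d = zp ?q d + zp (fls_deriv f) d"
      proof (cases "ord d f < 0")
        case True
        then have "ord d ?q \<le> 0" using ord_poly_pole[OF f d pderiv_P_nz True] by (simp add: mult_le_0_iff)
        moreover have "ord d (fls_deriv f) < 0" using ord_deriv(2)[OF d f(1) nc(2)] True by simp
        ultimately show ?thesis using ord_dp[OF d] by (simp add: zp_def)
      next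
        case False
        then show ?thesis using ord_poly_nonneg[OF f d pderiv_P_nz] ord_deriv_nonneg[OF d f(1) nc(2) _ f(2)] ord_dp[OF d] by (simp add: zp_def)
      qed
    qed
    then show ?thesis using r f' f(2) q by (simp add: cnt_add lf_zp)
  qed
  have "(\<lambda>r. real N * T r f) \<preceq> (\<lambda>r. T r ?q)" using T_poly(2)[OF f pderiv_P_nz] unfolding degree_pderiv_N .
  also have "\<dots> \<preceq> (\<lambda>r. cnt r (zp ?q) + max 0 (- psi r ?q))" by (rule T_le_zp[OF q])
  finally have "(\<lambda>r. real N * T r f) \<preceq> (\<lambda>r. cnt r (zp ?q) + max 0 (- psi r ?q))" .
  from bdle_add[OF this bdle_le[of "\<lambda>r. cnt r (zp (fls_deriv f))", OF order_refl]]
  have "(\<lambda>r. real N * T r f + cnt r (zp (fls_deriv f))) \<preceq> (\<lambda>r. cnt r (zp ?q) + max 0 (- psi r ?q) + cnt r (zp (fls_deriv f)))" .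
  also have "\<dots> \<preceq> (\<lambda>r. cnt r (zp (dp f)) + max 0 (- psi r (dp f)))"
    by (rule bdleI[where C = M]) (use M zp in fastforce)
  also have "\<dots> \<preceq> (\<lambda>r. T r (dp f))" by (rule zp_le_T[OF dp_mer])
  finally show ?thesis .
qed

lemma cnt_zp_deriv_le: "(\<lambda>r. cnt r (zp (fls_deriv f))) \<preceq> (\<lambda>r. 2 * T r f)"
proof -
  note nc = fls_nonconst[OF f(2)]
  have "(\<lambda>r. cnt r (zp (fls_deriv f))) \<preceq> (\<lambda>r. T r (fls_deriv f))" by (intro bdle_le T_zp)
  also have "\<dots> \<preceq> (\<lambda>r. T r f + cnt r (pb f))" by (rule T_deriv[OF f])
  also have "\<dots> \<preceq> (\<lambda>r. 2 * T r f)"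
  proof (rule bdle_le)
    fix r assume r: "\<rho> \<le> r" "r < R"
    have "cnt r (pb f) \<le> cnt r (pl f)"
      using r f nc by (intro cnt_mono lf_pb lf_pl) (auto simp: pb_def pl_def)
    then show "T r f + cnt r (pb f) \<le> 2 * T r f" using T_pl[of r f] by linarith
  qed
  finally show ?thesis .
qed

text \<open>Twice the truncated count costs 4 per zero of some \<open>f - a i\<close>, 4 per pole
  and 2 per other zero of \<open>f'\<close>. One copy of the zeros of \<open>f'\<close> is supplied
  by \<open>T_dp_lower\<close>, the other costs at most \<open>2 * T r f\<close>; with the
  \<open>T r f\<close> on the left the total is \<open>4 * card I + 4 + 2 + 1\<close>.\<close>

lemma T_dp_z2:
  assumes N: "4 * card I + 7 \<le> N"
  shows "(\<lambda>r. T r f + 2 * cnt r (z2 (dp f))) \<preceq> (\<lambda>r. T r (dp f))"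
proof -
  note nc = fls_nonconst[OF f(2)]
  have f': "fls_deriv f \<in> mer" using f by (intro mer_deriv)
  have pw: "2 * z2 (dp f) d \<le> (\<Sum>i\<in>I. 4 * zp (f - fls_const (a i)) d) + 4 * pl f d + 2 * zp (fls_deriv f) d"
    if d: "abv d < R" for d
  proof -
    have nn: "0 \<le> (\<Sum>i\<in>I. 4 * zp (f - fls_const (a i)) d)" by (intro sum_nonneg) auto
    have z4: "2 * z2 (dp f) d \<le> 4" by (simp add: z2_def)
    show ?thesis
    using d
    proof (cases rule: dp_cases)
      case (pole q)
      then have "1 \<le> pl f d" by (simp add: pl_def)
      then show ?thesis using z4 nn zp_nonneg[of "fls_deriv f" d] by linarith
    next
      case (val i m)
      then have "(\<Sum>i\<in>I. 4 * zp (f - fls_const (a i)) d) = 4 * zp (f - fls_const (a i)) d"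
        by (intro sum_zp_cases[OF d, where c = "\<lambda>_. 4"]) auto
      moreover have "1 \<le> zp (f - fls_const (a i)) d" using val by (simp add: zp_def)
      ultimately show ?thesis using z4 zp_nonneg[of "fls_deriv f" d] pl_nonneg[of f d] by linarith
    next
      case other
      then have "2 * z2 (dp f) d \<le> 2 * zp (fls_deriv f) d" by (simp add: z2_def zp_def)
      then show ?thesis using nn pl_nonneg[of f d] by linarith
    qed
  qed
  obtain C1 where C1: "\<And>r. \<rho> \<le> r \<Longrightarrow> r < R \<Longrightarrow> real N * T r f + cnt r (zp (fls_deriv f)) \<le> T r (dp f) + C1"
    using T_dp_lower unfolding bdle_def by blast
  obtain C2 where C2: "\<And>r. \<rho> \<le> r \<Longrightarrow> r < R \<Longrightarrow> cnt r (zp (fls_deriv f)) \<le> 2 * T r f + C2"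
    using cnt_zp_deriv_le unfolding bdle_def by blast
  have "(\<lambda>r. \<Sum>i\<in>I. T r (f - fls_const (a i))) \<preceq> (\<lambda>r. \<Sum>i\<in>I. T r f)"
    using f nc by (intro bdle_sum T_shift)
  then obtain C3 where C3: "\<And>r. \<rho> \<le> r \<Longrightarrow> r < R \<Longrightarrow> (\<Sum>i\<in>I. T r (f - fls_const (a i))) \<le> (\<Sum>i\<in>I. T r f) + C3"
    unfolding bdle_def by blast
  show ?thesis
  proof (rule bdleI)
    fix r assume r: "\<rho> \<le> r" "r < R"
    have lfI: "lf (\<lambda>d. \<Sum>i\<in>I. 4 * zp (f - fls_const (a i)) d)" by (intro lf_sum lf_cmult lf_zp shift_mer)
    have "cnt r (\<lambda>d. 2 * z2 (dp f) d) \<le> cnt r (\<lambda>d. (\<Sum>i\<in>I. 4 * zp (f - fls_const (a i)) d) + 4 * pl f d + 2 * zp (fls_deriv f) d)"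
      using pw by (intro cnt_mono lf_add lfI lf_cmult lf_zp lf_pl lf_z2 f' f nc r dp_mer)
    also have "\<dots> = 4 * (\<Sum>i\<in>I. cnt r (zp (f - fls_const (a i)))) + 4 * cnt r (pl f) + 2 * cnt r (zp (fls_deriv f))"
    proof -
      have "cnt r (\<lambda>d. \<Sum>i\<in>I. 4 * zp (f - fls_const (a i)) d) = (\<Sum>i\<in>I. cnt r (\<lambda>d. 4 * zp (f - fls_const (a i)) d))"
        by (intro cnt_sum lf_cmult lf_zp shift_mer r)
      then show ?thesis
        using r f f' nc(2) by (simp add: cnt_add cnt_cmult lf_cmult lf_add lf_zp lf_pl lfI sum_distrib_left)
    qed
    finally have "2 * cnt r (z2 (dp f)) \<le> 4 * (\<Sum>i\<in>I. cnt r (zp (f - fls_const (a i)))) + 4 * cnt r (pl f) + 2 * cnt r (zp (fls_deriv f))"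
      by (simp add: cnt_cmult)
    moreover have "(\<Sum>i\<in>I. cnt r (zp (f - fls_const (a i)))) \<le> real (card I) * T r f + C3"
      using C3[OF r] sum_mono[of I "\<lambda>i. cnt r (zp (f - fls_const (a i)))" "\<lambda>i. T r (f - fls_const (a i))", OF T_zp] by simp
    moreover have "(4 * real (card I) + 7) * T r f \<le> real N * T r f"
      using N T_nonneg[OF f(1) nc(2) r] by (intro mult_right_mono) linarith+
    ultimately show "T r f + 2 * cnt r (z2 (dp f)) \<le> T r (dp f) + (C1 + C2 + 4 * C3)"
      using C1[OF r] C2[OF r] T_pl[of r f] by (simp add: distrib_right)
  qed
qed

end

end

context disc
begin

text \<open>The only points where division by \<alpha> can change orders, hence spoil shared points
  or truncated counts.\<close>

definition exc :: "'a::ultrametric_field fls \<Rightarrow> 'a \<Rightarrow> real" where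
  "exc \<alpha> d = of_bool (ord d \<alpha> \<noteq> 0)"

lemma exc_cases: "exc \<alpha> d = 0 \<or> exc \<alpha> d = 1"
  by (simp add: exc_def)

context
  fixes \<alpha> :: "'a::{ultrametric_field, complete_space, alg_closed_field} fls"
  assumes \<alpha>: "\<alpha> \<in> mer" "\<alpha> \<noteq> 0"
begin

lemma lf_exc: "lf (exc \<alpha>)"
  by (rule lf_subset[OF lf_ord[OF \<alpha>]]) (simp add: exc_def)

lemma cnt_exc:
  assumes r: "\<rho> \<le> r" "r < R"
  shows "cnt r (exc \<alpha>) \<le> 2 * T r \<alpha>"
proof -
  have "cnt r (exc \<alpha>) \<le> cnt r (\<lambda>d. zp \<alpha> d + pl \<alpha> d)"
    by (intro cnt_mono lf_exc lf_add lf_zp lf_pl \<alpha> r) (auto simp: exc_def zp_def pl_def)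
  also have "\<dots> = cnt r (zp \<alpha>) + cnt r (pl \<alpha>)" using \<alpha> r by (intro cnt_add lf_zp lf_pl)
  finally show ?thesis using T_zp[of r \<alpha>] T_pl[of r \<alpha>] by linarith
qed

end

end

context diff_poly
begin

lemmas dp_cases' = dp_cases [consumes 3, case_names pole val other]

context
  fixes \<alpha> f :: "'a fls"
  assumes \<alpha>: "\<alpha> \<in> mer" "\<alpha> \<noteq> 0" and f: "f \<in> mer" "fls_deriv f \<noteq> 0" and N: "4 * card I + 7 \<le> N"
begin

text \<open>The 9 is \<open>2 * 4 + 1\<close>: truncated counts change by at most 2 at each
  exceptional point, these points number at most \<open>2 * T r \<alpha>\<close>, and replacing
  \<open>T r (dp f)\<close> costs one more.\<close>

lemma T_dp_div: "(\<lambda>r. T r f + 2 * cnt r (z2 (dp f / \<alpha>))) \<preceq> (\<lambda>r. T r (dp f / \<alpha>) + 9 * T r \<alpha>)"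
proof -
  have F: "dp f / \<alpha> \<in> mer" "dp f / \<alpha> \<noteq> 0" using dp_mer[OF f] \<alpha> by (auto intro: mer_divide)
  have pw: "z2 (dp f / \<alpha>) d \<le> z2 (dp f) d + 2 * exc \<alpha> d" if d: "abv d < R" for d
    using ord_divide[OF d dp_mer(1)[OF f] \<alpha>(1) dp_mer(2)[OF f] \<alpha>(2)] by (auto simp: z2_def exc_def)
  obtain C where C: "\<And>r. \<rho> \<le> r \<Longrightarrow> r < R \<Longrightarrow> T r f + 2 * cnt r (z2 (dp f)) \<le> T r (dp f) + C"
    using T_dp_z2[OF f N] unfolding bdle_def by blast
  show ?thesis
  proof (rule bdleI)
    fix r assume r: "\<rho> \<le> r" "r < R"
    have "cnt r (z2 (dp f / \<alpha>)) \<le> cnt r (\<lambda>d. z2 (dp f) d + 2 * exc \<alpha> d)"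
      by (intro cnt_mono lf_add lf_cmult lf_z2 lf_exc F dp_mer f \<alpha> r pw)
    also have "\<dots> = cnt r (z2 (dp f)) + 2 * cnt r (exc \<alpha>)"
      using r by (simp add: cnt_add cnt_cmult lf_cmult lf_z2 lf_exc dp_mer f \<alpha>)
    finally have "cnt r (z2 (dp f / \<alpha>)) \<le> cnt r (z2 (dp f)) + 4 * T r \<alpha>" using cnt_exc[OF \<alpha> r] by linarith
    moreover have "T r (dp f) \<le> T r (dp f / \<alpha>) + T r \<alpha>"
      using T_mult[OF F(1) \<alpha>(1) F(2) \<alpha>(2) r] \<alpha> by simp
    ultimately show "T r f + 2 * cnt r (z2 (dp f / \<alpha>)) \<le> T r (dp f / \<alpha>) + 9 * T r \<alpha> + C"
      using C[OF r] by linarith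
  qed
qed

lemma dp_div_const:
  assumes "fls_deriv (dp f / \<alpha>) = 0"
  shows "(\<lambda>r. T r f) \<preceq> (\<lambda>r. 9 * T r \<alpha>)"
proof -
  obtain e where e: "dp f / \<alpha> = fls_const e" using assms fls_deriv_eq_0_iff by blast
  have e0: "e \<noteq> 0" using e dp_mer(2)[OF f] \<alpha> by auto
  obtain C where C: "\<And>r. \<rho> \<le> r \<Longrightarrow> r < R \<Longrightarrow> T r f + 2 * cnt r (z2 (dp f / \<alpha>)) \<le> T r (dp f / \<alpha>) + 9 * T r \<alpha> + C"
    using T_dp_div unfolding bdle_def by blast
  show ?thesis
  proof (rule bdleI)
    fix r assume r: "\<rho> \<le> r" "r < R"
    have "cnt r (zp (fls_const e)) = cnt r (\<lambda>d::'a. 0)"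
      by (rule cnt_cong[OF r(2)]) (simp add: zp_def ord_const e0)
    moreover have "cnt r (pl (fls_const e)) = cnt r (\<lambda>d::'a. 0)"
      by (rule cnt_cong[OF r(2)]) (simp add: pl_def ord_const e0)
    ultimately have "T r (fls_const e) = 0" by (simp add: T_def)
    moreover have "0 \<le> cnt r (z2 (dp f / \<alpha>))" by (intro cnt_nonneg r) (simp add: z2_def)
    ultimately show "T r f \<le> 9 * T r \<alpha> + C" using C[OF r] e by simp
  qed
qed

end

text \<open>\<open>sharing_one\<close> bounds only its second function, so it is applied in both
  orders. The sum of the two bounds contains each truncated count twice, which is what
  \<open>T_dp_div\<close> outweighs.\<close>

lemma sharing_dp:
  assumes \<alpha>: "\<alpha> \<in> mer" "\<alpha> \<noteq> 0" and f: "f \<in> mer" "fls_deriv f \<noteq> 0" and g: "g \<in> mer" "fls_deriv g \<noteq> 0"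
    and N: "4 * card I + 7 \<le> N"
    and share: "\<And>d. abv d < R \<Longrightarrow> dp f \<noteq> \<alpha> \<Longrightarrow> dp g \<noteq> \<alpha> \<Longrightarrow> max 0 (ord d (dp f - \<alpha>)) = max 0 (ord d (dp g - \<alpha>))"
  shows "dp f = dp g \<or> dp f * dp g = \<alpha> * \<alpha> \<or> (\<exists>M. (\<lambda>r. T r f) \<preceq> (\<lambda>r. M * T r \<alpha>) \<or> (\<lambda>r. T r g) \<preceq> (\<lambda>r. M * T r \<alpha>))"
proof -
  let ?F = "dp f / \<alpha>" and ?G = "dp g / \<alpha>"
  consider "fls_deriv ?F = 0" | "fls_deriv ?G = 0" | "fls_deriv ?F \<noteq> 0" "fls_deriv ?G \<noteq> 0" by blast
  then show ?thesis
  proof cases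
    case 1
    then show ?thesis using dp_div_const[OF \<alpha> f N] by blast
  next
    case 2
    then show ?thesis using dp_div_const[OF \<alpha> g N] by blast
  next
    case 3
    have F: "?F \<in> mer" and G: "?G \<in> mer" using dp_mer f g \<alpha> by (auto intro: mer_divide)
    note ncF = fls_nonconst[OF 3(1)] and ncG = fls_nonconst[OF 3(2)]
    have F1: "?F - 1 = (dp f - \<alpha>) / \<alpha>" "dp f - \<alpha> \<noteq> 0" using \<alpha> ncF(1)[of 1] by (auto simp: field_simps)
    have G1: "?G - 1 = (dp g - \<alpha>) / \<alpha>" "dp g - \<alpha> \<noteq> 0" using \<alpha> ncG(1)[of 1] by (auto simp: field_simps)
    have sh: "max 0 (ord d (?F - 1)) = max 0 (ord d (?G - 1))" if d: "abv d < R" and E: "exc \<alpha> d = 0" for d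
    proof -
      have "ord d \<alpha> = 0" using E by (simp add: exc_def)
      then have "ord d (?F - 1) = ord d (dp f - \<alpha>)" "ord d (?G - 1) = ord d (dp g - \<alpha>)"
        unfolding F1(1) G1(1) using F1(2) G1(2) dp_mer f g \<alpha> by (simp_all add: ord_divide[OF d] mer_diff)
      then show ?thesis using share[OF d] F1(2) G1(2) by simp
    qed
    note S1 = sharing_one[OF F 3(1) G 3(2) lf_exc[OF \<alpha>] exc_cases sh]
    note S2 = sharing_one[OF G 3(2) F 3(1) lf_exc[OF \<alpha>] exc_cases sh[symmetric]]
    consider "?F = ?G" | "?F * ?G = 1"
      | "(\<lambda>r. T r ?G) \<preceq> (\<lambda>r. cnt r (\<lambda>d. z2 ?F d + z2 ?G d + 2 * exc \<alpha> d))"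
        "(\<lambda>r. T r ?F) \<preceq> (\<lambda>r. cnt r (\<lambda>d. z2 ?G d + z2 ?F d + 2 * exc \<alpha> d))"
    proof (cases "?F = ?G \<or> ?F * ?G = 1")
      case False
      then have "?G \<noteq> ?F" "?G * ?F \<noteq> 1" by (auto simp only: mult.commute)
      then show ?thesis using that(3) S1 S2 False by blast
    qed (use that in blast)
    then show ?thesis
    proof cases
      case 1
      then show ?thesis using \<alpha> by simp
    next
      case 2
      then have "dp f * dp g = \<alpha> * \<alpha>" using \<alpha> by (simp add: field_simps)
      then show ?thesis by blast
    next
      case TT: 3
      obtain C1 where C1: "\<And>r. \<rho> \<le> r \<Longrightarrow> r < R \<Longrightarrow> T r ?G \<le> cnt r (\<lambda>d. z2 ?F d + z2 ?G d + 2 * exc \<alpha> d) + C1"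
        using TT(1) unfolding bdle_def by blast
      obtain C2 where C2: "\<And>r. \<rho> \<le> r \<Longrightarrow> r < R \<Longrightarrow> T r ?F \<le> cnt r (\<lambda>d. z2 ?G d + z2 ?F d + 2 * exc \<alpha> d) + C2"
        using TT(2) unfolding bdle_def by blast
      obtain C3 where C3: "\<And>r. \<rho> \<le> r \<Longrightarrow> r < R \<Longrightarrow> T r f + 2 * cnt r (z2 ?F) \<le> T r ?F + 9 * T r \<alpha> + C3"
        using T_dp_div[OF \<alpha> f N] unfolding bdle_def by blast
      obtain C4 where C4: "\<And>r. \<rho> \<le> r \<Longrightarrow> r < R \<Longrightarrow> T r g + 2 * cnt r (z2 ?G) \<le> T r ?G + 9 * T r \<alpha> + C4"
        using T_dp_div[OF \<alpha> g N] unfolding bdle_def by blast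
      \<comment> \<open>Two uses of \<open>T_dp_div\<close> give \<open>2 * 9\<close>, and four
        times the count of exceptional points gives the other 8.\<close>
      have "(\<lambda>r. T r f) \<preceq> (\<lambda>r. 26 * T r \<alpha>)"
      proof (rule bdleI)
        fix r assume r: "\<rho> \<le> r" "r < R"
        have "cnt r (\<lambda>d. z2 ?F d + z2 ?G d + 2 * exc \<alpha> d) = cnt r (z2 ?F) + cnt r (z2 ?G) + 2 * cnt r (exc \<alpha>)"
          "cnt r (\<lambda>d. z2 ?G d + z2 ?F d + 2 * exc \<alpha> d) = cnt r (z2 ?F) + cnt r (z2 ?G) + 2 * cnt r (exc \<alpha>)"
          using r F G ncF(2) ncG(2) \<alpha> by (simp_all add: cnt_add cnt_cmult lf_add lf_cmult lf_z2 lf_exc)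
        then show "T r f \<le> 26 * T r \<alpha> + (C1 + C2 + C3 + C4)"
          using C1[OF r] C2[OF r] C3[OF r] C4[OF r] cnt_exc[OF \<alpha> r] T_nonneg[OF g(1) fls_nonconst(2)[OF g(2)] r]
          by linarith
      qed
      then show ?thesis by blast
    qed
  qed
qed

text \<open>Away from zeros and poles of \<alpha>, a pole of \<open>dp f\<close> is a zero of
  \<open>dp g\<close> of the same order, and conversely. A pole of one function paired with a zero
  of order \<open>m\<close> of the other minus \<open>a i\<close> contributes 2 to the two second
  main theorems, and \<open>c i * m\<close> pays for it. Since the weights sum to less than
  \<open>card I - 1\<close>, a positive multiple of \<open>T r f\<close> remains.\<close>

lemma product_dp:
  fixes c :: "nat \<Rightarrow> real"
  assumes \<alpha>: "\<alpha> \<in> mer" "\<alpha> \<noteq> 0" and f: "f \<in> mer" "fls_deriv f \<noteq> 0" and g: "g \<in> mer" "fls_deriv g \<noteq> 0"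
    and eq: "dp f * dp g = \<alpha> * \<alpha>"
    and c: "\<And>i. i \<in> I \<Longrightarrow> 0 \<le> c i"
      "\<And>i m q :: nat. i \<in> I \<Longrightarrow> 0 < m \<Longrightarrow> 0 < q \<Longrightarrow> m * (K i + 1) = q * (N + 1) + 2 \<Longrightarrow> 2 \<le> c i * m"
    and csum: "(\<Sum>i\<in>I. c i) < real (card I) - 1"
  shows "\<exists>M. (\<lambda>r. T r f) \<preceq> (\<lambda>r. M * T r \<alpha>)"
proof -
  define s where "s h d = (\<Sum>i\<in>I. zp (h - fls_const (a i)) d) - zp (fls_deriv h) d + pb h d" for h :: "'a fls" and d
  define t where "t h d = (\<Sum>i\<in>I. c i * zp (h - fls_const (a i)) d)" for h :: "'a fls" and d
  have lfs1: "lf (s h)" if "h \<in> mer" "fls_deriv h \<noteq> 0" for h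
    unfolding s_def[abs_def]
    by (intro lf_add lf_diff lf_sum lf_zp lf_pb mer_deriv mer_diff mer_const that fls_nonconst[OF that(2)])
  have lfs2: "lf (t h)" if "h \<in> mer" "fls_deriv h \<noteq> 0" for h
    unfolding t_def[abs_def]
    by (intro lf_sum lf_cmult lf_zp mer_diff mer_const that fls_nonconst[OF that(2)])
  note lfs = lfs1 lfs2
  have tnn: "0 \<le> t h d" for h d unfolding t_def using c(1) by (intro sum_nonneg) auto
  have sv: "s h d = 1" if "abv d < R" "i \<in> I" "0 < m" "ord d (h - fls_const (a i)) = m"
      "\<And>j. j \<in> I - {i} \<Longrightarrow> ord d (h - fls_const (a j)) = 0" "0 \<le> ord d h" "ord d (fls_deriv h) = m - 1"
      "h \<in> mer" "fls_deriv h \<noteq> 0" for h d i m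
    using sum_zp_cases(1)[OF that(8,9,1,2), of "\<lambda>_. 1"] that by (simp add: s_def zp_def pb_def)
  have sp: "s h d = 1" if "0 < q" "ord d h = - q" "\<And>i. i \<in> I \<Longrightarrow> ord d (h - fls_const (a i)) = - q" "ord d (fls_deriv h) = - q - 1" for h d q
    using that by (simp add: s_def zp_def pb_def)
  have so: "s h d = - of_int (ord d (fls_deriv h))" if "0 \<le> ord d h" "\<And>i. i \<in> I \<Longrightarrow> ord d (h - fls_const (a i)) = 0" "0 \<le> ord d (fls_deriv h)" for h d
    using that by (simp add: s_def zp_def pb_def)
  \<comment> \<open>Opposite a pole of \<open>h1\<close>, a pole of \<open>h2\<close> is impossible
    by sign, a zero of \<open>h2 - a i\<close> is paid by its weight, and a mere zero of
    \<open>h2'\<close> contributes at most -1.\<close>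
  have key: "s h1 d + s h2 d \<le> t h2 d"
    if d: "abv d < R" and h1: "h1 \<in> mer" "fls_deriv h1 \<noteq> 0" and h2: "h2 \<in> mer" "fls_deriv h2 \<noteq> 0"
      and o: "ord d (dp h1) = - ord d (dp h2)" and p: "ord d h1 < 0" for h1 h2 d
  proof -
    obtain q where q: "0 < q" "s h1 d = 1" "ord d (dp h1) = - (q * (int N + 1) + 1)"
      using h1 d
    proof (cases rule: dp_cases')
      case (pole q)
      then show ?thesis using that sp[of q d h1] by blast
    qed (use p in simp_all)
    have N1: "0 < int N + 1" by linarith
    have qN: "0 < q * (int N + 1)" by (rule mult_pos_pos[OF q(1) N1])
    from h2 d show ?thesis
    proof (cases rule: dp_cases')
      case (pole q')
      have "0 < q' * (int N + 1)" by (rule mult_pos_pos[OF pole(1) N1])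
      then show ?thesis using pole o q qN by linarith
    next
      case (val i m)
      have "t h2 d = c i * zp (h2 - fls_const (a i)) d"
        unfolding t_def using val by (intro sum_zp_cases(1)[OF h2 d]) auto
      moreover have "zp (h2 - fls_const (a i)) d = m" using val by (simp add: zp_def)
      \<comment> \<open>The 2 combines the \<open>- 1\<close> at a zero with the \<open>+ 1\<close>
        at a pole in \<open>dp_cases\<close>.\<close>
      moreover have "m * (int (K i) + 1) = q * (int N + 1) + 2" using val o q by linarith
      then have "nat m * (K i + 1) = nat q * (N + 1) + 2"
        using val(2) q(1) by (simp add: algebra_simps flip: of_nat_eq_iff[where 'a = int])
      then have "2 \<le> c i * nat m" using c(2)[OF val(1), of "nat m" "nat q"] val(2) q(1) by simp
      ultimately show ?thesis using sv[OF d val(1-6) h2] val(2) q(2) by simp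
    next
      case other
      have "1 \<le> ord d (fls_deriv h2)" using other o q qN by linarith
      then show ?thesis using so[of d h2] other q(2) tnn[of h2 d] by simp
    qed
  qed
  have s1: "s h d \<le> 1" if d: "abv d < R" and h: "h \<in> mer" "fls_deriv h \<noteq> 0" for h d
    using h d
  proof (cases rule: dp_cases')
    case (val i m)
    then show ?thesis using sv[OF d val(1-6) h] by simp
  qed (use sp so in force)+
  have pw: "s f d + s g d \<le> t f d + t g d + 2 * exc \<alpha> d" if d: "abv d < R" for d
  proof (cases "exc \<alpha> d = 0")
    case False
    then have "exc \<alpha> d = 1" using exc_cases by blast
    then show ?thesis using s1[OF d f] s1[OF d g] tnn[of f d] tnn[of g d] by linarith
  next
    case True
    then have "ord d \<alpha> = 0" by (simp add: exc_def)
    then have "ord d (dp f * dp g) = 0" unfolding eq using \<alpha> by (simp add: ord_mult[OF d])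
    then have o: "ord d (dp f) + ord d (dp g) = 0" using dp_mer f g by (simp add: ord_mult[OF d])
    show ?thesis
    proof (cases "ord d f < 0 \<or> ord d g < 0")
      case True
      then show ?thesis using key[OF d f g] key[OF d g f] o tnn[of f d] tnn[of g d] \<open>exc \<alpha> d = 0\<close> by force
    next
      case nopole: False
      \<comment> \<open>Without poles both orders are nonnegative with sum 0, hence both vanish,
        whereas a zero of \<open>h - a i\<close> would make the order positive.\<close>
      have nn: "0 \<le> ord d (dp h) \<and> (ord d (dp h) = 0 \<longrightarrow> s h d \<le> 0)" if h: "h \<in> mer" "fls_deriv h \<noteq> 0" "0 \<le> ord d h" for h
        using h(1,2) d
      proof (cases rule: dp_cases')
        case (val i m)
        define X where "X = m * (int (K i) + 1)"
        have "1 * (1 + 1) \<le> X" unfolding X_def using val(1,2) K[of i] by (intro mult_mono) auto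
        then have "0 < ord d (dp h)" using val(7)[folded X_def] by simp
        then show ?thesis by simp
      qed (use h so in force)+
      then show ?thesis using nn[OF f] nn[OF g] nopole o tnn[of f d] tnn[of g d] \<open>exc \<alpha> d = 0\<close> by force
    qed
  qed
  have cI: "card (a ` I) = card I" using I by (intro card_image)
  have smt: "(\<lambda>r. (real (card I) - 1) * T r h) \<preceq> (\<lambda>r. cnt r (s h))" if h: "h \<in> mer" "fls_deriv h \<noteq> 0" for h
    using second_main[OF h, of "a ` I"] I cI by (simp add: s_def[abs_def] sum.reindex)
  have tb: "(\<lambda>r. cnt r (t h)) \<preceq> (\<lambda>r. (\<Sum>i\<in>I. c i) * T r h)" if h: "h \<in> mer" "fls_deriv h \<noteq> 0" for h
  proof -
    have "(\<lambda>r. cnt r (t h)) \<preceq> (\<lambda>r. \<Sum>i\<in>I. c i * T r (h - fls_const (a i)))"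
    proof (rule bdle_le)
      fix r assume r: "\<rho> \<le> r" "r < R"
      have "cnt r (t h) = (\<Sum>i\<in>I. cnt r (\<lambda>d. c i * zp (h - fls_const (a i)) d))"
        unfolding t_def by (intro cnt_sum lf_cmult lf_zp mer_diff mer_const h fls_nonconst(1)[OF h(2)] r)
      also have "\<dots> \<le> (\<Sum>i\<in>I. c i * T r (h - fls_const (a i)))"
        unfolding cnt_cmult using c(1) T_zp by (intro sum_mono mult_left_mono) auto
      finally show "cnt r (t h) \<le> (\<Sum>i\<in>I. c i * T r (h - fls_const (a i)))" .
    qed
    also have "\<dots> \<preceq> (\<lambda>r. \<Sum>i\<in>I. c i * T r h)"
      using h fls_nonconst[OF h(2)] c(1) by (intro bdle_sum bdle_cmult T_shift)
    finally show ?thesis by (simp add: sum_distrib_right)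
  qed
  obtain C1 where C1: "\<And>r. \<rho> \<le> r \<Longrightarrow> r < R \<Longrightarrow> (real (card I) - 1) * T r f \<le> cnt r (s f) + C1"
    using smt[OF f] unfolding bdle_def by blast
  obtain C2 where C2: "\<And>r. \<rho> \<le> r \<Longrightarrow> r < R \<Longrightarrow> (real (card I) - 1) * T r g \<le> cnt r (s g) + C2"
    using smt[OF g] unfolding bdle_def by blast
  obtain C3 where C3: "\<And>r. \<rho> \<le> r \<Longrightarrow> r < R \<Longrightarrow> cnt r (t f) \<le> (\<Sum>i\<in>I. c i) * T r f + C3"
    using tb[OF f] unfolding bdle_def by blast
  obtain C4 where C4: "\<And>r. \<rho> \<le> r \<Longrightarrow> r < R \<Longrightarrow> cnt r (t g) \<le> (\<Sum>i\<in>I. c i) * T r g + C4"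
    using tb[OF g] unfolding bdle_def by blast
  define \<epsilon> where "\<epsilon> = real (card I) - 1 - (\<Sum>i\<in>I. c i)"
  have \<epsilon>: "0 < \<epsilon>" using csum by (simp add: \<epsilon>_def)
  have "(\<lambda>r. T r f) \<preceq> (\<lambda>r. (4 / \<epsilon>) * T r \<alpha>)"
  proof (rule bdleI)
    fix r assume r: "\<rho> \<le> r" "r < R"
    have "cnt r (\<lambda>d. s f d + s g d) \<le> cnt r (\<lambda>d. t f d + t g d + 2 * exc \<alpha> d)"
      by (intro cnt_mono lf_add lf_cmult lfs lf_exc \<alpha> f g r pw)
    then have "cnt r (s f) + cnt r (s g) \<le> cnt r (t f) + cnt r (t g) + 2 * cnt r (exc \<alpha>)"
      using r by (simp add: cnt_add cnt_cmult lf_add lf_cmult lfs lf_exc \<alpha> f g)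
    then have "\<epsilon> * T r f + \<epsilon> * T r g \<le> 4 * T r \<alpha> + (C1 + C2 + C3 + C4)"
      using C1[OF r] C2[OF r] C3[OF r] C4[OF r] cnt_exc[OF \<alpha> r] unfolding \<epsilon>_def left_diff_distrib by linarith
    moreover have "0 \<le> \<epsilon> * T r g" using \<epsilon> T_nonneg[OF g(1) fls_nonconst(2)[OF g(2)] r] by simp
    ultimately have "\<epsilon> * T r f \<le> 4 * T r \<alpha> + (C1 + C2 + C3 + C4)" by linarith
    then show "T r f \<le> (4 / \<epsilon>) * T r \<alpha> + (C1 + C2 + C3 + C4) / \<epsilon>"
      using \<epsilon> by (simp add: pos_le_divide_eq mult.commute flip: add_divide_distrib)
  qed
  then show ?thesis by blast
qed

text \<open>If the constant \<open>C\<close> in \<open>P(f) = P(g) + C\<close> is nonzero,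
  \<open>g\<close> takes a value in \<open>B\<close> only where \<open>f\<close> takes one in
  \<open>B1\<close>. The second main theorem then bounds \<open>card B - 1\<close> times
  \<open>T r g\<close> by \<open>card B1 + 1\<close> times it, while the condition on
  \<open>K j\<close> yields \<open>card B \<ge> card B1 + 3\<close>.\<close>

lemma equal_dp:
  assumes f: "f \<in> mer" "fls_deriv f \<noteq> 0" and g: "g \<in> mer" "fls_deriv g \<noteq> 0"
    and eq: "dp f = dp g" and j: "j \<in> I" "N - K j + 3 \<le> K j"
  shows "fls_poly P f = fls_poly P g \<or> (\<lambda>r. T r g) \<preceq> (\<lambda>r. 0)"
proof (rule disjCI)
  assume nb: "\<not> (\<lambda>r. T r g) \<preceq> (\<lambda>r. 0)"
  have "fls_deriv (fls_poly P f) = fls_deriv (fls_poly P g)"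
    using eq by (simp add: fls_deriv_poly dp_def)
  then obtain C where C: "fls_poly P f = fls_const C + fls_poly P g" by (auto simp: fls_deriv_eq_iff_ex)
  have "C = 0"
  proof (rule ccontr)
    assume C0: "C \<noteq> 0"
    \<comment> \<open>Chosen so that \<open>P(g) - e = P(f) - P(a j)\<close>; since
      \<open>C \<noteq> 0\<close>, the point \<open>a j\<close> is not a root of
      \<open>Q\<close>.\<close>
    define e where "e = poly P (a j) - C"
    define Q where "Q = P - [:e:]"
    define Q1 where "Q1 = P - [:poly P (a j):]"
    define B where "B = {x. poly Q x = 0}"
    define B1 where "B1 = {x. poly Q1 x = 0}"
    note rs = roots_shift[OF dP b I K j(1)]
    have nz: "Q \<noteq> 0" "Q1 \<noteq> 0" using rs(3) by (auto simp: Q_def Q1_def)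
    have fin: "finite B" "finite B1" unfolding B_def B1_def using nz by (auto intro: poly_roots_finite)
    have cB: "K j < card B" using rs(1)[of e] C0 by (simp add: B_def Q_def e_def)
    have cB1: "card B1 \<le> Suc (N - K j)" using rs(2) by (simp add: B1_def Q1_def)
    have diff: "fls_poly (P - [:x:]) h = fls_poly P h - fls_const x" for x h
    proof -
      have "P - [:x:] = P + [:- x:]" by simp
      then have "fls_poly (P - [:x:]) h = fls_poly P h + fls_poly [:- x:] h" by (simp only: fls_poly_add)
      then show ?thesis by simp
    qed
    have QQ: "fls_poly Q g = fls_poly Q1 f"
      unfolding Q_def Q1_def diff C e_def by (simp flip: fls_minus_const)
    have P0: "P \<noteq> 0" using pderiv_P_nz by auto
    have pw: "(\<Sum>x\<in>B. zp (g - fls_const x) d) - zp (fls_deriv g) d + pb g d \<le> (\<Sum>x\<in>B1. zp (f - fls_const x) d) + pl g d"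
      if d: "abv d < R" for d
    proof (cases "ord d g < 0")
      case True
      then have "(\<Sum>x\<in>B. zp (g - fls_const x) d) = 0"
        using pole_shift(1)[OF d g(1) fls_nonconst(2)[OF g(2)] fls_nonconst(1)[OF g(2)]] by (simp add: zp_def)
      moreover have "0 \<le> (\<Sum>x\<in>B1. zp (f - fls_const x) d)" by (intro sum_nonneg) simp
      moreover have "pb g d \<le> pl g d" by (auto simp: pb_def pl_def)
      ultimately show ?thesis using zp_nonneg[of "fls_deriv g" d] by linarith
    next
      case reg: False
      have nnS: "0 \<le> (\<Sum>x\<in>B1. zp (f - fls_const x) d)" by (intro sum_nonneg) simp
      have pbg: "pb g d = 0" using reg by (simp add: pb_def)
      show ?thesis
      proof (cases "\<exists>x\<in>B. 0 < ord d (g - fls_const x)")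
        case False
        then have "(\<Sum>x\<in>B. zp (g - fls_const x) d) = 0" by (intro sum.neutral) (auto simp: zp_def)
        then show ?thesis using nnS pbg pl_nonneg[of g d] zp_nonneg[of "fls_deriv g" d] by linarith
      next
        case True
        then obtain x where x: "x \<in> B" "0 < ord d (g - fls_const x)" by blast
        have gx: "g - fls_const y \<in> mer" "g - fls_const y \<noteq> 0" for y
          using g fls_nonconst(1)[OF g(2)] by (auto intro: mer_diff)
        have z: "zp (g - fls_const y) d = 0" if y: "y \<in> B - {x}" for y
        proof -
          have ne: "x - y \<noteq> 0" using y by auto
          have "ord d (fls_const (x - y) + (g - fls_const x)) = ord d (fls_const (x - y))"
            using x ne gx by (intro ord_add_eq(2)[OF d]) (simp_all add: ord_const[OF d])
          moreover have "fls_const (x - y) + (g - fls_const x) = g - fls_const y" by (simp flip: fls_minus_const)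
          ultimately show ?thesis using ord_const[OF d ne] by (simp add: zp_def)
        qed
        have "fls_deriv (g - fls_const x) = fls_deriv g" by simp
        then have "ord d (fls_deriv g) = ord d (g - fls_const x) - 1" using ord_deriv(2)[OF d gx] x(2) by simp
        then have lhs: "(\<Sum>x\<in>B. zp (g - fls_const x) d) - zp (fls_deriv g) d = 1"
          using sum.remove[OF fin(1) x(1), of "\<lambda>x. zp (g - fls_const x) d"] z x(2) by (simp add: zp_def)
        have "0 < ord d (fls_poly Q g)"
        proof -
          obtain Q2 where Q2: "Q = [:- x, 1:] * Q2" using x(1) by (auto simp: B_def poly_eq_0_iff_dvd elim: dvdE)
          have Q20: "Q2 \<noteq> 0" using nz Q2 by auto
          have "ord d (fls_poly Q g) = ord d (g - fls_const x) + ord d (fls_poly Q2 g)"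
            unfolding Q2 fls_poly_mult fls_poly_lin by (intro ord_mult[OF d] gx mer_poly g fls_poly_nz Q20)
          then show ?thesis using x(2) ord_poly_nonneg[OF g d Q20] reg by simp
        qed
        then have pos: "0 < ord d (fls_poly Q1 f)" using QQ by simp
        have "\<exists>y\<in>B1. 0 < ord d (f - fls_const y)"
        proof (rule ccontr)
          assume neg: "\<not> ?thesis"
          obtain A where A: "Q1 = smult (lead_coeff Q1) (\<Prod>x\<in>#A. [:- x, 1:])"
            "fls_poly Q1 f = fls_const (lead_coeff Q1) * (\<Prod>x\<in>#A. f - fls_const x)"
            by (rule fls_poly_linear_factors[OF nz(2)]) (rule that; assumption)
          have AB: "y \<in> B1" if "y \<in># A" for y
          proof -
            have "poly (\<Prod>x\<in>#A. [:- x, 1:]) y = 0" using that by (auto simp: poly_prod_mset prod_mset_zero_iff)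
            then show ?thesis unfolding B1_def by (subst A(1)) simp
          qed
          have "ord d (fls_poly Q1 f) = (\<Sum>x\<in>#A. ord d (f - fls_const x))"
            unfolding A(2) using ord_mult[OF d mer_const mer_prod_mset[OF f] _ prod_mset_shift_nz[OF f]] nz(2)
            by (simp add: ord_const[OF d] ord_prod_mset_shift[OF f d])
          also have "\<dots> \<le> (\<Sum>x\<in>#A. 0)" using neg AB by (intro sum_mset_mono) (auto simp: not_less)
          finally show False using pos by simp
        qed
        then obtain y where y: "y \<in> B1" "0 < ord d (f - fls_const y)" by blast
        have "1 \<le> zp (f - fls_const y) d" using y(2) by (simp add: zp_def)
        also have "\<dots> \<le> (\<Sum>x\<in>B1. zp (f - fls_const x) d)" using y(1) fin by (intro member_le_sum) auto
        finally show ?thesis using lhs pbg pl_nonneg[of g d] by linarith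
      qed
    qed
    \<comment> \<open>The relation between \<open>P(f)\<close> and \<open>P(g)\<close> makes the
      characteristic functions comparable, so that the count for \<open>f\<close> can be charged to
      \<open>g\<close>.\<close>
    have PT: "(\<lambda>r. degree P * T r f) \<preceq> (\<lambda>r. degree P * T r g)"
    proof -
      have "(\<lambda>r. degree P * T r f) \<preceq> (\<lambda>r. T r (fls_poly P f))" by (rule T_poly(2)[OF f P0])
      also have "\<dots> \<preceq> (\<lambda>r. T r (fls_poly P g))"
      proof -
        have "fls_poly P g = fls_poly P f - fls_const C" using C by simp
        then show ?thesis using T_shift'[of "fls_poly P f" C] mer_poly[OF f(1), of P] fls_poly_nz[OF f P0] fls_poly_nz[OF g P0] by simp
      qed
      also have "\<dots> \<preceq> (\<lambda>r. degree P * T r g)" by (rule T_poly(1)[OF g P0])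
      finally show ?thesis .
    qed
    have dP0: "0 < degree P" using pderiv_P_nz by (metis pderiv_eq_0_iff not_gr_zero)
    have fg: "(\<lambda>r. T r f) \<preceq> (\<lambda>r. T r g)"
      using bdle_cmult[OF PT, of "1 / degree P"] dP0 by simp
    have "(\<lambda>r. \<Sum>x\<in>B1. T r (f - fls_const x)) \<preceq> (\<lambda>r. \<Sum>x\<in>B1. T r f)"
      using f fls_nonconst[OF f(2)] by (intro bdle_sum T_shift)
    then obtain C1 where C1: "\<And>r. \<rho> \<le> r \<Longrightarrow> r < R \<Longrightarrow> (\<Sum>x\<in>B1. T r (f - fls_const x)) \<le> (\<Sum>x\<in>B1. T r f) + C1"
      unfolding bdle_def by blast
    obtain C2 where C2: "\<And>r. \<rho> \<le> r \<Longrightarrow> r < R \<Longrightarrow> T r f \<le> T r g + C2" using fg unfolding bdle_def by blast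
    obtain C3 where C3: "\<And>r. \<rho> \<le> r \<Longrightarrow> r < R \<Longrightarrow> (real (card B) - 1) * T r g \<le>
        cnt r (\<lambda>d. (\<Sum>x\<in>B. zp (g - fls_const x) d) - zp (fls_deriv g) d + pb g d) + C3"
      using second_main[OF g fin(1)] unfolding bdle_def by blast
    have "(\<lambda>r. T r g) \<preceq> (\<lambda>r. 0)"
    proof (rule bdleI)
      fix r assume r: "\<rho> \<le> r" "r < R"
      have fx: "f - fls_const x \<in> mer" "f - fls_const x \<noteq> 0" for x using f fls_nonconst(1)[OF f(2)] by (auto intro: mer_diff)
      have gx: "g - fls_const x \<in> mer" "g - fls_const x \<noteq> 0" for x using g fls_nonconst(1)[OF g(2)] by (auto intro: mer_diff)
      have g0: "g \<noteq> 0" using fls_nonconst(2)[OF g(2)] .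
      have lfB: "lf (\<lambda>d. \<Sum>x\<in>B1. zp (f - fls_const x) d)" by (intro lf_sum lf_zp fx)
      have "cnt r (\<lambda>d. (\<Sum>x\<in>B. zp (g - fls_const x) d) - zp (fls_deriv g) d + pb g d)
          \<le> cnt r (\<lambda>d. (\<Sum>x\<in>B1. zp (f - fls_const x) d) + pl g d)"
        by (intro cnt_mono lf_add lf_diff lf_sum lf_zp lf_pb lf_pl lfB fx gx g g0 mer_deriv r pw)
      also have "\<dots> = (\<Sum>x\<in>B1. cnt r (zp (f - fls_const x))) + cnt r (pl g)"
      proof -
        have "cnt r (\<lambda>d. \<Sum>x\<in>B1. zp (f - fls_const x) d) = (\<Sum>x\<in>B1. cnt r (zp (f - fls_const x)))"
          by (intro cnt_sum lf_zp fx r)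
        then show ?thesis using cnt_add[OF lfB lf_pl[OF g(1) g0] r(2)] by simp
      qed
      also have "\<dots> \<le> (\<Sum>x\<in>B1. T r (f - fls_const x)) + T r g"
        using T_zp T_pl by (intro add_mono sum_mono) auto
      also have "\<dots> \<le> card B1 * T r f + C1 + T r g" using C1[OF r] by simp
      also have "card B1 * T r f \<le> card B1 * (T r g + C2)" using C2[OF r] by (intro mult_left_mono) auto
      finally have "(real (card B) - 1) * T r g \<le> card B1 * T r g + T r g + (card B1 * C2 + C1 + C3)"
        using C3[OF r] by (simp add: distrib_left)
      moreover have "(real (card B1) + 2) * T r g \<le> (real (card B) - 1) * T r g"
        using cB cB1 j(2) T_nonneg[OF g(1) g0 r] by (intro mult_right_mono) linarith+
      ultimately show "T r g \<le> 0 + (card B1 * C2 + C1 + C3)" by (simp add: distrib_right)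
    qed
    then show False using nb by blast
  qed
  then show "fls_poly P f = fls_poly P g" using C by simp
qed

end

section \<open>Characteristic functions with respect to an origin\<close>

lemma powi_exp_ln: "0 < x \<Longrightarrow> x powi k = exp (of_int k * ln (x :: real))"
  using powr_real_of_int'[of x k] by (simp add: powr_def)

lemma abv_powi: "abv (x powi k) = abv (x :: 'a::ultrametric_field) powi k"
  by (simp add: power_int_def abv_power abv_inverse power_inverse)

text \<open>Roots of high order of an element whose absolute value is not 1 have absolute values
  arbitrarily near 1, and integer powers of such a root step into every interval.\<close>

lemma abv_dense:
  fixes y0 :: "'a::{ultrametric_field, alg_closed_field}"
  assumes y0: "y0 \<noteq> 0" "abv y0 \<noteq> 1" and st: "0 < s" "s < t"
  obtains x :: 'a where "s < abv x" "abv x < t"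
proof -
  obtain y :: 'a where y: "1 < abv y"
  proof (cases "1 < abv y0")
    case False
    then have "1 < abv (inverse y0)" using y0 by (simp add: abv_inverse one_less_inverse_iff)
    then show ?thesis using that by blast
  qed (use that in blast)
  have "1 < t / s" using st by simp
  then obtain n where n: "abv y < (t / s) ^ n" using real_arch_pow by blast
  have n0: "n > 0" using n y by (cases n) auto
  obtain z where z: "z ^ n = y" using nth_root_exists[of n y] n0 by blast
  have zy: "abv z ^ n = abv y" using z by (simp flip: abv_power)
  have z1: "1 < abv z" using zy y by (metis abv_nonneg not_le power_le_one)
  have zt: "abv z < t / s" using n zy st by (intro power_less_imp_less_base[of "abv z" n]) auto
  define L where "L = ln (abv z)"
  have L: "0 < L" "L < ln t - ln s"
  proof -
    show "0 < L" unfolding L_def by (rule ln_gt_zero[OF z1])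
    have "L < ln (t / s)" unfolding L_def using z1 zt by (intro ln_less_cancel_iff[THEN iffD2]) auto
    then show "L < ln t - ln s" using st by (simp add: ln_div)
  qed
  \<comment> \<open>The first power exceeding \<open>s\<close>; one step \<open>L\<close> is shorter
    than the logarithmic length of the interval.\<close>
  define k where "k = \<lfloor>ln s / L\<rfloor> + 1"
  have "ln s / L < of_int k" "of_int k \<le> ln s / L + 1" unfolding k_def by linarith+
  then have k: "ln s < of_int k * L" "of_int k * L \<le> ln s + L" using L by (simp_all add: field_simps)
  have "0 < abv z" using z1 by linarith
  then have eq: "abv (z powi k) = exp (of_int k * L)" unfolding abv_powi L_def by (rule powi_exp_ln)
  have "exp (ln s) < exp (of_int k * L)" "exp (of_int k * L) < exp (ln t)"
    using k L by (simp_all only: exp_less_cancel_iff)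
  then show ?thesis using that[of "z powi k"] st by (simp add: eq)
qed

section \<open>Translation to the disk of centre \<open>c\<close>\<close>

context disc
begin

text \<open>Convergence at one point with absolute value between \<open>r\<close> and
  \<open>R\<close> bounds the terms at radius \<open>r\<close>. Such points exist for every
  \<open>r\<close> once the absolute value is nontrivial, which is what \<open>y0\<close>
  witnesses.\<close>

lemma disk_analytic_eq:
  fixes c y0 :: "'a::{ultrametric_field, complete_space, alg_closed_field}"
  assumes y0: "y0 \<noteq> 0" "abv y0 \<noteq> 1"
  shows "disk_analytic c R = anal"
proof (intro set_eqI iffI)
  fix F :: "'a fps" assume F: "F \<in> disk_analytic c R"
  show "F \<in> anal"
  proof (rule analI)
    fix r :: real assume r: "0 < r" "r < R"
    obtain x :: 'a where x: "r < abv x" "abv x < R" by (rule abv_dense[OF y0 r])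
    have "c + x \<in> ball c R" using x by (simp add: dist_abv)
    then have "summable (\<lambda>n. fps_nth F n * (c + x - c) ^ n)" using F unfolding disk_analytic_def by blast
    then have "summable (\<lambda>n. fps_nth F n * x ^ n)" by simp
    then have "(\<lambda>n. abv (fps_nth F n * x ^ n)) \<longlonglongrightarrow> 0" by (rule summable_abv_tendsto_0)
    then have "Bseq (\<lambda>n. abv (fps_nth F n * x ^ n))" using convergent_imp_Bseq convergentI by blast
    then obtain B where B: "\<And>n. norm (abv (fps_nth F n * x ^ n)) \<le> B" by (auto simp: Bseq_def)
    have "abv (fps_nth F n) * r ^ n \<le> B" for n
    proof -
      have "abv (fps_nth F n) * r ^ n \<le> abv (fps_nth F n) * abv x ^ n"
        using r x by (intro mult_left_mono power_mono) auto
      also have "\<dots> \<le> B" using B[of n] by (simp add: abv_mult abv_power abs_mult)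
      finally show ?thesis .
    qed
    then show "\<exists>B. \<forall>n. abv (fps_nth F n) * r ^ n \<le> B" by blast
  qed
next
  fix F :: "'a fps" assume F: "F \<in> anal"
  have "summable (\<lambda>n. fps_nth F n * (x - c) ^ n)" if "x \<in> ball c R" for x
  proof -
    have d: "abv (x - c) < R" using that by (simp add: dist_abv abv_minus_commute)
    show ?thesis using anal_tendsto_0[OF F _ d] by (intro ultra_summable) (simp add: abv_mult abv_power)
  qed
  then show "F \<in> disk_analytic c R" by (simp add: disk_analytic_def)
qed

context
  fixes c :: "'a::{ultrametric_field, complete_space, alg_closed_field, field_char_0}"
  assumes disk: "disk_analytic c R = anal"
begin

lemma disk_mero_eq: "disk_mero c R = mer"
  by (simp add: disk_mero_def disk mer_def)

lemma disk_mero_bounded_eq: "disk_mero_bounded c R = fraction_field_of analb"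
  by (simp add: disk_mero_bounded_def disk_analytic_bounded_def disk analb_def)

lemma mero_order_eq: "mero_order c R h \<gamma> = ord (\<gamma> - c) h"
  unfolding mero_order_def ord_def disk fps_val_def ev_def lin_def ..

text \<open>Beyond radius \<open>\<rho>\<close> the distances to \<open>z\<close> and to the centre
  agree, so the two counts differ by a finite sum over points within \<open>\<rho>\<close> that does
  not depend on \<open>r\<close>, whatever value the logarithm takes at 0.\<close>

lemma Z_fun_eq:
  assumes z: "abv (z - c) \<le> \<rho>" and h: "h \<in> mer" "h \<noteq> 0"
  shows "\<exists>C. \<forall>r. \<rho> \<le> r \<longrightarrow> r < R \<longrightarrow> Z_fun c R z r h = cnt r (zp h) + C"
proof -
  define S where "S r = {d. abv d \<le> r \<and> zp h d \<noteq> 0}" for r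
  define D where "D d = zp h d * (ln (max (abv d) \<rho>) - ln (abv (d - (z - c))))" for d
  have "Z_fun c R z r h = cnt r (zp h) + sum D (S \<rho>)" if r: "\<rho> \<le> r" "r < R" for r
  proof -
    have fin: "finite (S r)" using lf_finite[OF lf_zp[OF h] r(2)] by (simp add: S_def)
    have dz: "abv (d - (z - c)) \<le> r \<longleftrightarrow> abv d \<le> r" for d
      using abv_diff_le[of d "z - c"] abv_add_le[of "d - (z - c)" "z - c"] z r by (auto simp: max_def split: if_splits)
    have set: "{\<gamma>. \<gamma> \<in> ball c R \<and> mero_order c R h \<gamma> > 0 \<and> abv (\<gamma> - z) \<le> r} = (\<lambda>d. c + d) ` S r"
    proof (intro set_eqI iffI)
      fix \<gamma> assume "\<gamma> \<in> {\<gamma>. \<gamma> \<in> ball c R \<and> mero_order c R h \<gamma> > 0 \<and> abv (\<gamma> - z) \<le> r}"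
      then have "\<gamma> - c \<in> S r" using dz[of "\<gamma> - c"] by (auto simp: S_def mero_order_eq zp_def)
      then show "\<gamma> \<in> (\<lambda>d. c + d) ` S r" by (intro image_eqI[of _ _ "\<gamma> - c"]) auto
    next
      fix \<gamma> assume "\<gamma> \<in> (\<lambda>d. c + d) ` S r"
      then obtain d where d: "\<gamma> = c + d" "d \<in> S r" by blast
      then show "\<gamma> \<in> {\<gamma>. \<gamma> \<in> ball c R \<and> mero_order c R h \<gamma> > 0 \<and> abv (\<gamma> - z) \<le> r}"
        using dz[of d] r by (auto simp: S_def mero_order_eq zp_def dist_abv max_def algebra_simps split: if_splits)
    qed
    have "Z_fun c R z r h = (\<Sum>d\<in>S r. of_int (ord d h) * (ln r - ln (abv (c + d - z))))"
      unfolding Z_fun_def set by (subst sum.reindex) (auto simp: mero_order_eq)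
    also have "\<dots> = (\<Sum>d\<in>S r. zp h d * wt r d + D d)"
    proof (rule sum.cong)
      fix d assume "d \<in> S r"
      then have "zp h d = of_int (ord d h)" by (auto simp: S_def zp_def max_def split: if_splits)
      then show "of_int (ord d h) * (ln r - ln (abv (c + d - z))) = zp h d * wt r d + D d"
        by (simp add: D_def wt_def algebra_simps)
    qed simp
    also have "\<dots> = cnt r (zp h) + sum D (S r)" by (simp add: cnt_def S_def sum.distrib)
    also have "sum D (S r) = sum D (S \<rho>)"
    proof (rule sum.mono_neutral_right[OF fin])
      show "S \<rho> \<subseteq> S r" using r by (auto simp: S_def)
      show "\<forall>d\<in>S r - S \<rho>. D d = 0"
      proof
        fix d assume "d \<in> S r - S \<rho>"
        then have "\<rho> < abv d" by (auto simp: S_def)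
        then have "abv (d - (z - c)) = abv d" "max (abv d) \<rho> = abv d" using abv_diff_eq[of "z - c" d] z by auto
        then show "D d = 0" by (simp add: D_def)
      qed
    qed
    finally show ?thesis .
  qed
  then show ?thesis by blast
qed

lemma T_fun_close:
  assumes z: "abv (z - c) \<le> \<rho>" and h: "h \<in> mer" "h \<noteq> 0"
  shows "\<exists>C. \<forall>r. \<rho> \<le> r \<longrightarrow> r < R \<longrightarrow> \<bar>T_fun c R z r h - T r h\<bar> \<le> C"
proof -
  obtain C1 where C1: "\<And>r. \<rho> \<le> r \<Longrightarrow> r < R \<Longrightarrow> Z_fun c R z r h = cnt r (zp h) + C1"
    using Z_fun_eq[OF z h] by blast
  have h': "inverse h \<in> mer" "inverse h \<noteq> 0" using h mer_inverse by auto
  obtain C2 where C2: "\<And>r. \<rho> \<le> r \<Longrightarrow> r < R \<Longrightarrow> Z_fun c R z r (inverse h) = cnt r (zp (inverse h)) + C2"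
    using Z_fun_eq[OF z h'] by blast
  have N: "N_fun c R z r h = cnt r (pl h) + C2" if r: "\<rho> \<le> r" "r < R" for r
  proof -
    have "cnt r (zp (inverse h)) = cnt r (pl h)"
      using h by (intro cnt_cong[OF r(2)]) (simp add: zp_def pl_def ord_inverse)
    then show ?thesis using C2[OF r] by (simp add: N_fun_def inverse_eq_divide)
  qed
  show ?thesis
  proof (intro exI[of _ "\<bar>C1 + ln (abv (mero_val c R h z))\<bar> + \<bar>C2\<bar>"] allI impI)
    fix r assume r: "\<rho> \<le> r" "r < R"
    show "\<bar>T_fun c R z r h - T r h\<bar> \<le> \<bar>C1 + ln (abv (mero_val c R h z))\<bar> + \<bar>C2\<bar>"
      unfolding T_fun_def T_def C1[OF r] N[OF r] by linarith
  qed
qed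

text \<open>Being large at one radius means being large from there on, because \<open>T\<close>
  increases with the radius.\<close>

lemma T_unbounded:
  fixes f :: "'a fls"
  assumes f: "f \<in> mer" "f \<noteq> 0" "f \<notin> fraction_field_of analb"
  shows "\<forall>\<^sub>F r in at_left R. B < T r f"
proof -
  have "\<exists>r\<ge>\<rho>. r < R \<and> B < T r f"
    using bounded_T_imp_bounded[OF f(1,2), of B] f(3) by (meson not_less)
  then obtain r where r: "\<rho> \<le> r" "r < R" "B < T r f" by blast
  have "B < T s f" if "r < s" "s < R" for s
    using T_mono[OF f(1,2) r(1), of s] that r(3) by simp
  then show ?thesis using r(2) by (auto simp: eventually_at_left)
qed

text \<open>Near \<open>R\<close> the limit makes the given multiple of \<open>T r \<alpha>\<close>
  less than half of \<open>T r f\<close> up to a constant, which would bound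
  \<open>T r f\<close>.\<close>

lemma small_contradiction:
  assumes f: "f \<in> mer" "f \<noteq> 0" "f \<notin> fraction_field_of analb" and \<alpha>: "\<alpha> \<in> mer" "\<alpha> \<noteq> 0"
    and z: "abv (z - c) \<le> \<rho>" and lim: "((\<lambda>r. T_fun c R z r \<alpha> / T_fun c R z r f) \<longlongrightarrow> 0) (at_left R)"
  shows "\<not> (\<lambda>r. T r f) \<preceq> (\<lambda>r. M * T r \<alpha>)"
proof
  assume "(\<lambda>r. T r f) \<preceq> (\<lambda>r. M * T r \<alpha>)"
  then obtain C where C: "\<And>r. \<rho> \<le> r \<Longrightarrow> r < R \<Longrightarrow> T r f \<le> M * T r \<alpha> + C" unfolding bdle_def by blast
  obtain C1 where C1: "\<And>r. \<rho> \<le> r \<Longrightarrow> r < R \<Longrightarrow> \<bar>T_fun c R z r f - T r f\<bar> \<le> C1" using T_fun_close[OF z f(1,2)] by blast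
  obtain C2 where C2: "\<And>r. \<rho> \<le> r \<Longrightarrow> r < R \<Longrightarrow> \<bar>T_fun c R z r \<alpha> - T r \<alpha>\<bar> \<le> C2" using T_fun_close[OF z \<alpha>] by blast
  \<comment> \<open>A positive substitute for \<open>M\<close>, by which inequalities can be
    multiplied and divided.\<close>
  define M' where "M' = \<bar>M\<bar> + 1"
  have M': "0 < M'" "M \<le> M'" by (auto simp: M'_def)
  define X where "X = M' * C2"
  define B where "B = 2 * X + 2 * C + \<bar>C1\<bar>"
  have "\<forall>\<^sub>F r in at_left R. T_fun c R z r \<alpha> / T_fun c R z r f < 1 / (2 * M')"
    using M' by (intro order_tendstoD(2)[OF lim]) auto
  moreover have "\<forall>\<^sub>F r in at_left R. \<bar>B\<bar> + \<bar>C1\<bar> < T r f" by (rule T_unbounded[OF f])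
  moreover have "\<forall>\<^sub>F r in at_left R. \<rho> \<le> r \<and> r < R"
    using rho_less by (auto simp: eventually_at_left intro!: exI[of _ \<rho>])
  ultimately have "\<forall>\<^sub>F r in at_left R. False"
  proof eventually_elim
    case (elim r)
    then have r: "\<rho> \<le> r" "r < R" by auto
    have pos: "0 < T_fun c R z r f" using elim(2) C1[OF r] by linarith
    have "T_fun c R z r \<alpha> < 1 / (2 * M') * T_fun c R z r f" using elim(1) pos by (simp only: pos_divide_less_eq)
    then have "M' * T_fun c R z r \<alpha> < M' * (1 / (2 * M') * T_fun c R z r f)" using M'(1) by (simp only: mult_less_cancel_left_pos)
    also have "\<dots> = T_fun c R z r f / 2" using M'(1) by simp
    finally have "M' * T_fun c R z r \<alpha> < T_fun c R z r f / 2" .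
    moreover have "M' * T r \<alpha> \<le> M' * (T_fun c R z r \<alpha> + C2)" using C2[OF r] M'(1) by (intro mult_left_mono) linarith+
    then have "M' * T r \<alpha> \<le> M' * T_fun c R z r \<alpha> + X" by (simp add: distrib_left X_def)
    moreover have "M * T r \<alpha> \<le> M' * T r \<alpha>" using M'(2) T_nonneg[OF \<alpha> r] by (rule mult_right_mono)
    ultimately have "T r f < T_fun c R z r f / 2 + X + C" using C[OF r] by linarith
    then have "T r f < B" using C1[OF r] unfolding B_def by linarith
    then show False using elim(2) by linarith
  qed
  then show False by (simp add: eventually_False trivial_limit_at_left_real)
qed

lemma unbounded_nonconst:
  assumes "f \<in> disk_mero_unbounded c R"
  shows "f \<in> mer" "f \<notin> fraction_field_of analb" "fls_deriv f \<noteq> 0"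
proof -
  show f: "f \<in> mer" "f \<notin> fraction_field_of analb"
    using assms by (auto simp: disk_mero_unbounded_def disk_mero_eq disk_mero_bounded_eq)
  have "fls_const e \<in> fraction_field_of analb" for e :: 'a
  proof -
    have "bnd (fps_const e) (abv e)" unfolding bnd_def using R_pos by (auto simp: fps_const_def)
    then have "fps_const e \<in> analb" "(1::'a fps) \<in> analb" using bnd_analb bnd_one by blast+
    moreover have "fls_const e = fps_to_fls (fps_const e) / fps_to_fls 1" by simp
    ultimately show ?thesis unfolding fraction_field_of_def by (smt (verit) mem_Collect_eq zero_neq_one)
  qed
  then show "fls_deriv f \<noteq> 0" using f(2) fls_deriv_eq_0_iff by metis
qed

end

end

text \<open>For \<open>R \<le> 1\<close> coefficients are bounded by 1; for \<open>R > 1\<close>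
  convergence at distance 1 from the centre leaves only polynomials. So the existence of an
  unbounded \<open>f\<close> yields an element of absolute value other than 0 and 1.\<close>

lemma trivial_abv_no_unbounded:
  assumes triv: "\<And>y::'a::ultrametric_field. y \<noteq> 0 \<Longrightarrow> abv y = 1" and R: "0 < R"
  shows "disk_mero_unbounded (c::'a) R = {}"
proof -
  have a01: "abv y \<le> 1" for y :: 'a using triv[of y] by (cases "y = 0") auto
  have "disk_analytic_bounded c R = disk_analytic c R"
  proof (intro equalityI subsetI)
    fix F assume F: "F \<in> disk_analytic c R"
    have "bdd_above (range (\<lambda>n. abv (fps_nth F n) * R ^ n))"
    proof (cases "1 < R")
      case True
      then have "c + 1 \<in> ball c R" by (simp add: dist_abv)
      then have "summable (\<lambda>n. fps_nth F n * (c + 1 - c) ^ n)" using F unfolding disk_analytic_def by blast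
      then have "(\<lambda>n. abv (fps_nth F n)) \<longlonglongrightarrow> 0" using summable_abv_tendsto_0 by fastforce
      from order_tendstoD(2)[OF this, of 1] obtain n0 where n0: "\<And>n. n \<ge> n0 \<Longrightarrow> abv (fps_nth F n) < 1"
        by (auto simp: eventually_sequentially)
      then have z: "fps_nth F n = 0" if "n \<ge> n0" for n using that triv[of "fps_nth F n"] by fastforce
      have "abv (fps_nth F n) * R ^ n \<le> R ^ n0" for n
      proof (cases "n \<ge> n0")
        case False
        then have "abv (fps_nth F n) * R ^ n \<le> 1 * R ^ n0"
          using True a01 by (intro mult_mono power_increasing) auto
        then show ?thesis by simp
      qed (use z True in auto)
      then show ?thesis by (auto simp: bdd_above_def)
    next
      case False
      have "abv (fps_nth F n) * R ^ n \<le> 1" for n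
        using R False a01 by (intro mult_le_one power_le_one) auto
      then show ?thesis by (auto simp: bdd_above_def)
    qed
    then show "F \<in> disk_analytic_bounded c R" using F by (simp add: disk_analytic_bounded_def)
  qed (simp add: disk_analytic_bounded_def)
  then show ?thesis by (simp add: disk_mero_unbounded_def disk_mero_def disk_mero_bounded_def)
qed

section \<open>Multiplicities in the case \<open>f' P'(f) g' P'(g) = \<alpha>\<^sup>2\<close>\<close>

text \<open>The equation relates a zero of order \<open>m\<close> of \<open>f - a\<^sub>1\<close> to a pole of order \<open>q\<close> of \<open>g\<close>.\<close>

lemma main_multiplicity:
  fixes m q n k :: nat
  assumes "k + 3 \<le> n" "0 < q" and eq: "m * (n + 1) = q * (n + k + 1) + 2"
  shows "3 \<le> m" and "n \<noteq> 2 * k + 1 \<Longrightarrow> n \<noteq> 3 * k + 1 \<Longrightarrow> 5 \<le> m"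
proof -
  have "q * (n + 1) \<le> q * (n + k + 1)" by simp
  then have "q * (n + 1) < m * (n + 1)" using eq by linarith
  then have qm: "q < m" using mult_less_cancel2 by blast
  \<comment> \<open>Only \<open>q < m \<le> 4\<close> is left. For \<open>(m, q)\<close> equal to
    \<open>(2, 1)\<close>, \<open>(3, 2)\<close>, \<open>(4, 2)\<close>, \<open>(4, 3)\<close> the
    equation reads \<open>n = k + 1\<close>, \<open>n = 2 k + 1\<close>, \<open>n = k\<close>,
    \<open>n = 3 k + 1\<close>; with \<open>q = 1\<close> and \<open>m \<ge> 3\<close> it makes
    \<open>n\<close> smaller than \<open>k\<close>.\<close>
  have *: "m = 2 \<or> m = 3 \<or> m = 4 \<or> 5 \<le> m" using qm assms(2) by linarith
  have **: "q = 1 \<or> q = 2 \<or> q = 3 \<or> 4 \<le> q" using assms(2) by linarith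
  show "3 \<le> m" using * ** qm eq assms(1) by auto
  show "5 \<le> m" if "n \<noteq> 2 * k + 1" "n \<noteq> 3 * k + 1" using * ** qm eq assms(1) that by auto
qed

text \<open>For \<open>l = 2\<close>, where the only other exponent is \<open>k\<close>. If
  \<open>m < 4\<close>, size alone leaves \<open>m = 3\<close> and \<open>q = 1\<close>, that is,
  \<open>n = 2 k\<close>.\<close>

lemma simple_multiplicity:
  fixes m q n k :: nat
  assumes "k + 3 \<le> n" "0 < q" "n \<noteq> 2 * k" and eq: "m * (k + 1) = q * (n + k + 1) + 2"
  shows "4 \<le> m"
proof (rule ccontr)
  assume "\<not> 4 \<le> m"
  then have "m * (k + 1) \<le> 3 * (k + 1)" by (intro mult_right_mono) auto
  moreover have "1 * (n + k + 1) \<le> q * (n + k + 1)" using assms(2) by (intro mult_right_mono) auto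
  ultimately have m: "m = 3" using eq assms(1) \<open>\<not> 4 \<le> m\<close>
    by (cases "m = 0"; cases "m = 1"; cases "m = 2") auto
  have "q = 1"
  proof (rule ccontr)
    assume "q \<noteq> 1"
    then have "2 * (n + k + 1) \<le> q * (n + k + 1)" using assms(2) by (intro mult_right_mono) auto
    then show False using eq m assms(1) by simp
  qed
  then show False using eq m assms(3) by simp
qed

text \<open>Each weight is 2 divided by a lower bound for \<open>m\<close>. For \<open>l = 2\<close>
  the bounds are 5 and 4, and \<open>2 / 5 + 1 / 2 < 1\<close>. For \<open>l \<ge> 3\<close> they
  are 3 and, because \<open>q \<ge> 1\<close>, the quotient
  \<open>(n + k + 3) / (K i + 1)\<close>.\<close>

lemma weights_exist:
  fixes K :: "nat \<Rightarrow> nat" and n k l :: nat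
  assumes l: "2 \<le> l" and K: "K 1 = n" "\<And>i. i \<in> {2..l} \<Longrightarrow> 0 < K i" "k = (\<Sum>i = 2..l. K i)" and nk: "k + 3 \<le> n"
    and l2: "l = 2 \<longrightarrow> n \<noteq> 2 * k \<and> n \<noteq> 2 * k + 1 \<and> n \<noteq> 3 * k + 1"
  shows "\<exists>c. (\<forall>i\<in>{1..l}. 0 \<le> c i) \<and>
    (\<forall>i\<in>{1..l}. \<forall>m q :: nat. 0 < m \<longrightarrow> 0 < q \<longrightarrow> m * (K i + 1) = q * (n + k + 1) + 2 \<longrightarrow> 2 \<le> c i * real m) \<and>
    (\<Sum>i = 1..l. c i) < real l - 1"
proof (cases "l = 2")
  case True
  have "K 2 = k" using K(3) True by simp
  define c where "c i = (if i = 1 then 2 / 5 else 1 / 2 :: real)" for i :: nat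
  have "2 \<le> c i * real m"
    if "i \<in> {1..l}" "0 < q" "m * (K i + 1) = q * (n + k + 1) + 2" for i m q :: nat
  proof (cases "i = 1")
    case i: True
    then have "5 \<le> m" using main_multiplicity(2)[OF nk that(2)] that(3) K(1) l2 True by simp
    then show ?thesis using i by (simp add: c_def)
  next
    case False
    then have "i = 2" using that(1) True by simp
    then have "4 \<le> m" using simple_multiplicity[OF nk that(2)] that(3) \<open>K 2 = k\<close> l2 True by simp
    then show ?thesis using False by (simp add: c_def)
  qed
  moreover have "(\<Sum>i = 1..l. c i) < real l - 1" using True by (simp add: c_def numeral_2_eq_2)
  ultimately show ?thesis by (intro exI[of _ c]) (auto simp: c_def)
next
  case False
  then have l3: "3 \<le> l" using l by simp
  define c where "c i = (if i = 1 then 2 / 3 else 2 * (K i + 1) / (n + k + 3) :: real)" for i :: nat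
  have c0: "0 \<le> c i" for i by (simp add: c_def)
  have "2 \<le> c i * real m"
    if "i \<in> {1..l}" "0 < q" "m * (K i + 1) = q * (n + k + 1) + 2" for i m q :: nat
  proof (cases "i = 1")
    case i: True
    then have "3 \<le> m" using main_multiplicity(1)[OF nk that(2)] that(3) K(1) by simp
    then show ?thesis using i by (simp add: c_def)
  next
    case False
    have "1 * (n + k + 1) \<le> q * (n + k + 1)" using that(2) by (intro mult_right_mono) auto
    then have "n + k + 3 \<le> m * (K i + 1)" unfolding that(3) by simp
    then have "real (n + k + 3) \<le> real (m * (K i + 1))" by (rule of_nat_mono)
    then show ?thesis using False by (simp add: c_def field_simps)
  qed
  moreover have "(\<Sum>i = 1..l. c i) < real l - 1"
  proof -
    have "(\<Sum>i = 1..l. c i) = 2 / 3 + (\<Sum>i = 2..l. 2 * (real (K i) + 1) / (n + k + 3))"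
      using l by (subst sum.atLeast_Suc_atMost) (auto simp: c_def numeral_2_eq_2 intro!: sum.cong)
    also have "(\<Sum>i = 2..l. 2 * (real (K i) + 1) / (n + k + 3)) = 2 * (real k + (real l - 1)) / (n + k + 3)"
    proof -
      have "(\<Sum>i = 2..l. real (K i) + 1) = real k + (real l - 1)" using l by (simp add: K(3) sum.distrib)
      then show ?thesis by (simp only: sum_divide_distrib[symmetric] sum_distrib_left[symmetric])
    qed
    finally have eq: "(\<Sum>i = 1..l. c i) = 2 / 3 + 2 * (real k + (real l - 1)) / (n + k + 3)" .
    have kl: "l - 1 \<le> k"
    proof -
      have "(\<Sum>i = 2..l. 1) \<le> (\<Sum>i = 2..l. K i)" using K(2) by (intro sum_mono) (simp add: Suc_le_eq)
      then show ?thesis using K(3) by simp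
    qed
    have nk': "real k + 3 \<le> real n" and kl': "real l - 1 \<le> real k" using nk kl l by simp_all
    \<comment> \<open>For \<open>l = 3\<close> the factor is 4/3 and the claim follows from
      \<open>n \<ge> k + 3\<close>; for \<open>l \<ge> 4\<close> it is at least 2, and
      \<open>k + l - 1 \<le> 2 k < n + k + 3\<close>.\<close>
    have "2 * (real k + (real l - 1)) < (real l - 1 - 2 / 3) * (n + k + 3)"
    proof (cases "l = 3")
      case True
      have "2 * (real k + 2) < 4 / 3 * (real n + real k + 3)" using nk' by simp
      then show ?thesis using True by simp
    next
      case False
      then have "2 \<le> real l - 1 - 2 / 3" using l3 by linarith
      then have le: "2 * real (n + k + 3) \<le> (real l - 1 - 2 / 3) * real (n + k + 3)"
        by (intro mult_right_mono) auto
      have "2 * (real k + (real l - 1)) < 2 * real (n + k + 3)" using nk' kl' by simp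
      also note le
      finally show ?thesis .
    qed
    then have "2 * (real k + (real l - 1)) / (n + k + 3) < real l - 1 - 2 / 3"
      by (subst pos_divide_less_eq) auto
    then show ?thesis using eq by linarith
  qed
  ultimately show ?thesis using c0 by (intro exI[of _ c]) auto
qed

section \<open>Combination of the cases\<close>

lemma (in diff_poly) sharing_small_imp_poly_eq:
  fixes c z1 z2 :: 'a and f g \<alpha> :: "'a fls" and w :: "nat \<Rightarrow> real"
  assumes disk: "disk_analytic c R = anal"
    and fg: "f \<in> disk_mero_unbounded c R" "g \<in> disk_mero_unbounded c R"
    and \<alpha>: "\<alpha> \<in> disk_mero c R" "\<alpha> \<noteq> 0"
    and z1: "abv (z1 - c) \<le> \<rho>" "((\<lambda>r. T_fun c R z1 r \<alpha> / T_fun c R z1 r f) \<longlongrightarrow> 0) (at_left R)"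
    and z2: "abv (z2 - c) \<le> \<rho>" "((\<lambda>r. T_fun c R z2 r \<alpha> / T_fun c R z2 r g) \<longlongrightarrow> 0) (at_left R)"
    and share: "share_CM c R \<alpha> (dp f) (dp g)"
    and N: "4 * card I + 7 \<le> N" and j: "j \<in> I" "N - K j + 3 \<le> K j"
    and w: "\<And>i. i \<in> I \<Longrightarrow> 0 \<le> w i"
      "\<And>i m q :: nat. i \<in> I \<Longrightarrow> 0 < m \<Longrightarrow> 0 < q \<Longrightarrow> m * (K i + 1) = q * (N + 1) + 2 \<Longrightarrow> 2 \<le> w i * m"
      "(\<Sum>i\<in>I. w i) < real (card I) - 1"
  shows "fls_poly P f = fls_poly P g"
proof -
  note f = unbounded_nonconst[OF disk fg(1)] and g = unbounded_nonconst[OF disk fg(2)]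
  have \<alpha>m: "\<alpha> \<in> mer" "\<alpha> \<noteq> 0" using \<alpha> by (simp_all add: disk_mero_eq[OF disk])
  have notf: "\<not> (\<lambda>r. T r f) \<preceq> (\<lambda>r. M * T r \<alpha>)" for M
    by (rule small_contradiction[OF disk f(1) fls_nonconst(2)[OF f(3)] f(2) \<alpha>m z1])
  have notg: "\<not> (\<lambda>r. T r g) \<preceq> (\<lambda>r. M * T r \<alpha>)" for M
    by (rule small_contradiction[OF disk g(1) fls_nonconst(2)[OF g(3)] g(2) \<alpha>m z2])
  have "max 0 (ord d (dp f - \<alpha>)) = max 0 (ord d (dp g - \<alpha>))"
    if d: "abv d < R" and nz: "dp f \<noteq> \<alpha>" "dp g \<noteq> \<alpha>" for d
  proof -
    have "c + d \<in> ball c R" using d by (simp add: dist_abv)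
    then have "zero_mult c R (dp f - \<alpha>) (c + d) = zero_mult c R (dp g - \<alpha>) (c + d)"
      using share unfolding share_CM_def by blast
    then have "nat (ord d (dp f - \<alpha>)) = nat (ord d (dp g - \<alpha>))"
      using nz by (simp add: zero_mult_def mero_order_eq[OF disk])
    then show ?thesis by linarith
  qed
  note sharing_dp[OF \<alpha>m f(1,3) g(1,3) N this]
  then consider "dp f = dp g" | "dp f * dp g = \<alpha> * \<alpha>" using notf notg by blast
  then show ?thesis
  proof cases
    case 1
    have "\<not> (\<lambda>r. T r g) \<preceq> (\<lambda>r. 0)" using notg[of 0] by simp
    then show ?thesis using equal_dp[OF f(1,3) g(1,3) 1 j] by blast
  next
    case 2
    have "\<exists>M. (\<lambda>r. T r f) \<preceq> (\<lambda>r. M * T r \<alpha>)"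
      by (rule product_dp[where c = w, OF \<alpha>m f(1,3) g(1,3) 2]; fact w)
    then show ?thesis using notf by blast
  qed
qed

theorem theorem4:
  fixes c :: "'a::{ultrametric_field, complete_space, alg_closed_field, field_char_0}"
    and R :: real
    and P :: "'a poly"
    and b :: 'a
    and a :: "nat \<Rightarrow> 'a"
    and l n kk :: nat
    and k :: "nat \<Rightarrow> nat"
    and f g \<alpha> :: "'a fls"
  assumes "R > 0"
    and "uniqueness_poly P (disk_mero_unbounded c R)"
    and "pderiv P = smult b ([:- a 1, 1:] ^ n * (\<Prod>i = 2..l. [:- a i, 1:] ^ k i))"
    and "b \<noteq> 0"
    and "l \<ge> 2"
    and "inj_on a {1..l}"
    and "n > 0"
    and "\<forall>i\<in>{2..l}. k i > 0"
    and "\<forall>i\<in>{2..<l}. k i \<ge> k (i + 1)"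
    and "kk = (\<Sum>i = 2..l. k i)"
    and "int n \<ge> 10 + (\<Sum>i = 3..l. max 0 (4 - int (k i))) + max 0 (5 - int (k 2))"
    and "n \<ge> kk + 3"
    and "l = 2 \<longrightarrow> n \<noteq> 2 * kk \<and> n \<noteq> 2 * kk + 1 \<and> n \<noteq> 3 * kk + 1"
    and "l = 3 \<longrightarrow> n \<noteq> 2 * kk + 1 \<and> (\<forall>i\<in>{2, 3}. int n \<noteq> 3 * int (k i) - int kk)"
    and "f \<in> disk_mero_unbounded c R"
    and "g \<in> disk_mero_unbounded c R"
    and "\<alpha> \<in> disk_mero c R"
    and "\<alpha> \<noteq> 0"
    and "small_wrt c R \<alpha> f"
    and "small_wrt c R \<alpha> g"
    and "share_CM c R \<alpha> (fls_deriv f * fls_poly (pderiv P) f) (fls_deriv g * fls_poly (pderiv P) g)"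
  shows "f = g"
proof -
  define K where "K i = (if i = 1 then n else k i)" for i :: nat
  have split: "{1..l} = insert 1 {2..l}" using assms(5) by auto
  have dP: "pderiv P = smult b (\<Prod>i\<in>{1..l}. [:- a i, 1:] ^ K i)"
    unfolding assms(3) split by (simp add: K_def)
  have K: "0 < K i" if "i \<in> {1..l}" for i using that assms(7,8) by (auto simp: K_def)
  have N: "(\<Sum>i\<in>{1..l}. K i) = n + kk" unfolding split by (simp add: K_def assms(10))
  have K2: "(\<Sum>i = 2..l. K i) = kk" unfolding assms(10) by (intro sum.cong) (auto simp: K_def)
  \<comment> \<open>\<open>max 0 (4 - x) + x \<ge> 4\<close> and its analogue for 5 turn the lower
    bound for \<open>n\<close> into \<open>n + kk \<ge> 10 + 5 + 4 (l - 2)\<close>, which is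
    \<open>4 l + 7\<close>.\<close>
  have N7: "4 * card {1..l} + 7 \<le> (\<Sum>i\<in>{1..l}. K i)"
  proof -
    have "(\<Sum>i = 3..l. 4) \<le> (\<Sum>i = 3..l. max 0 (4 - int (k i)) + int (k i))" by (intro sum_mono) auto
    then have "4 * (int l - 2) \<le> (\<Sum>i = 3..l. max 0 (4 - int (k i))) + (\<Sum>i = 3..l. int (k i))"
      using assms(5) by (simp add: sum.distrib)
    moreover have "int kk = int (k 2) + (\<Sum>i = 3..l. int (k i))"
      using assms(5,10) by (simp add: sum.atLeast_Suc_atMost numeral_3_eq_3 numeral_2_eq_2)
    ultimately show ?thesis unfolding N using assms(11) by simp
  qed
  obtain y0 :: 'a where y0: "y0 \<noteq> 0" "abv y0 \<noteq> 1"
    using trivial_abv_no_unbounded[OF _ assms(1), of c] assms(15) by fastforce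
  obtain z1 where z1: "z1 \<in> ball c R" "((\<lambda>r. T_fun c R z1 r \<alpha> / T_fun c R z1 r f) \<longlongrightarrow> 0) (at_left R)"
    using assms(19) unfolding small_wrt_def by blast
  obtain z2 where z2: "z2 \<in> ball c R" "((\<lambda>r. T_fun c R z2 r \<alpha> / T_fun c R z2 r g) \<longlongrightarrow> 0) (at_left R)"
    using assms(20) unfolding small_wrt_def by blast
  \<comment> \<open>Large enough to enclose both origins; \<open>R / 2\<close> keeps it positive
    when they coincide with the centre.\<close>
  define \<rho> where "\<rho> = max (R / 2) (max (abv (z1 - c)) (abv (z2 - c)))"
  have \<rho>: "0 < \<rho>" "\<rho> < R" "abv (z1 - c) \<le> \<rho>" "abv (z2 - c) \<le> \<rho>"
    using assms(1) z1(1) z2(1) by (auto simp: \<rho>_def dist_abv abv_minus_commute)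
  interpret diff_poly R \<rho> P b a "{1..l}" K
    using \<rho> dP assms(4,6) K by unfold_locales auto
  have K1: "K 1 = n" by (simp add: K_def)
  have K0: "0 < K i" if "i \<in> {2..l}" for i by (rule K) (use that in auto)
  obtain w where w: "\<And>i. i \<in> {1..l} \<Longrightarrow> 0 \<le> w i"
    "\<And>i m q :: nat. i \<in> {1..l} \<Longrightarrow> 0 < m \<Longrightarrow> 0 < q \<Longrightarrow> m * (K i + 1) = q * (n + kk + 1) + 2 \<Longrightarrow> 2 \<le> w i * real m"
    "(\<Sum>i = 1..l. w i) < real l - 1"
    using weights_exist[OF assms(5) K1 K0 K2[symmetric] assms(12,13)] by blast
  have share: "share_CM c R \<alpha> (dp f) (dp g)" using assms(21) by (simp add: dp_def)
  have "fls_poly P f = fls_poly P g"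
  proof (rule sharing_small_imp_poly_eq[OF disk_analytic_eq[OF y0] assms(15-18) \<rho>(3) z1(2) \<rho>(4) z2(2) share N7, of 1 w])
    show "(\<Sum>i\<in>{1..l}. K i) - K 1 + 3 \<le> K 1" unfolding N using assms(12) by (simp add: K_def)
  qed (use assms(5) w(1,3) w(2)[folded N] in simp_all)
  then show ?thesis using assms(2,15,16) unfolding uniqueness_poly_def by blast
qed

end
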